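(* Let $g=(x,t)\in N_{3,2}$ with $x=|x|e_1\ne0$, $t=(t_1,t_2,0)$, $t_1,t_2>0$ and $\pi t_2^2=|x|^2t_1$. Then $$p_h(x,t)=\mathbf C\,2\sqrt{2\pi}\,\pi^3\,h^{-3}\,t_2^{-1}\,|x|\,(|x|^4+\pi^2t_2^2)^{-1/2}\,e^{-\frac{d(g)^2}{4h}}\,(1+o_g(1))\qquad\text{as }h\to0^+,$$ where $o_g(1)\to0$ as $h\to0^+$ for fixed $g$.
   Context: $N_{3,2}=\mathbb R^3\times\mathbb R^3$ with $(x,t)\cdot(x',t')=(x+x',\,t+t'-\tfrac12x\times x')$ ($\times$ = cross product). Left-invariant fields: $X_1=\partial_{x_1}-\tfrac12x_3\partial_{t_2}+\tfrac12x_2\partial_{t_3}$, $X_2=\partial_{x_2}+\tfrac12x_3\partial_{t_1}-\tfrac12x_1\partial_{t_3}$, $X_3=\partial_{x_3}-\tfrac12x_2\partial_{t_1}+\tfrac12x_1\partial_{t_2}$; $\Delta=X_1^2+X_2^2+X_3^2$. $d(g)$ is the Carnot--Carathéodory distance from the identity to $g$ (infimum of lengths of horizontal curves, $X_1,X_2,X_3$ orthonormal). The heat kernel of $\partial_h-\Delta$ (with respect to Lebesgue measure) is $p_h(x,t)=\mathbf C\,h^{-9/2}\,p(x/\sqrt h,t/h)$ with a positive (normalizing) constant $\mathbf C$ and $$p(x,t)=\int_{\mathbb R^3}\frac{|\lambda|}{\sinh|\lambda|}\exp\Big\{-\tfrac14\Big[|x|^2+\tfrac{|\lambda|\coth|\lambda|-1}{|\lambda|^2}\big(|\lambda|^2|x|^2-(\lambda\cdot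 x)^2\big)-4i\,t\cdot\lambda\Big]\Big\}d\lambda .$$ $e_1=(1,0,0)$. *)

theory Defs
  imports "HOL-Analysis.Analysis"
begin

unbundle cross3_syntax

text \<open>The group $N_{3,2}$: the first component is $x$, the second $t$; the identity is \<open>0\<close>.\<close>

type_synonym n32 = "(real^3) \<times> (real^3)"

fun n32_mult :: "n32 \<Rightarrow> n32 \<Rightarrow> n32" where
  "n32_mult (x, t) (x', t') = (x + x', t + t' - (1/2) *\<^sub>R (x \<times> x'))"

fun X1 :: "n32 \<Rightarrow> n32" where
  "X1 (x, t) = (axis 1 1, vector [0, - (x$3 / 2), x$2 / 2])"

fun X2 :: "n32 \<Rightarrow> n32" where
  "X2 (x, t) = (axis 2 1, vector [x$3 / 2, 0, - (x$1 / 2)])"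

fun X3 :: "n32 \<Rightarrow> n32" where
  "X3 (x, t) = (axis 3 1, vector [- (x$2 / 2), x$1 / 2, 0])"

definition horizontal_vector :: "real^3 \<Rightarrow> n32 \<Rightarrow> n32" where
  "horizontal_vector a g = a$1 *\<^sub>R X1 g + a$2 *\<^sub>R X2 g + a$3 *\<^sub>R X3 g"

text \<open>The fields are the left-invariant ones: at \<open>g\<close> they are the velocities of
  \<open>g \<cdot> (s a, 0)\<close> at \<open>s = 0\<close>.\<close>

lemma horizontal_vector_cross:
  "horizontal_vector a (x, t) = (a, - ((1/2) *\<^sub>R (x \<times> a)))"
  by (simp add: horizontal_vector_def cross3_def vec_eq_iff forall_3 axis_def
      vector_3 field_simps)

lemma horizontal_vector_left_invariant:
  "((\<lambda>s. n32_mult g (s *\<^sub>R a, 0)) has_vector_derivative horizontal_vector a g) (at 0)"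
proof -
  obtain x t where g: "g = (x, t)" by (cases g)
  have "((\<lambda>s. (x + s *\<^sub>R a, t - s *\<^sub>R ((1/2) *\<^sub>R (x \<times> a)))) has_vector_derivative
      (a, - ((1/2) *\<^sub>R (x \<times> a)))) (at 0)"
    by (rule has_vector_derivative_Pair) (auto intro!: derivative_eq_intros)
  then show ?thesis
    by (simp add: g horizontal_vector_cross cross_mult_right mult.commute)
qed

text \<open>Absolute continuity of a curve on an interval. The members of a division are
  compact intervals, possibly degenerate, with disjoint interiors; they need not
  cover \<open>S\<close>.\<close>

definition abs_continuous_curve_on :: "real set \<Rightarrow> (real \<Rightarrow> 'a::metric_space) \<Rightarrow> bool" where
  "abs_continuous_curve_on S \<gamma> \<longleftrightarrow>
    (\<forall>\<epsilon>>0. \<exists>\<delta>>0. \<forall>\<D>. \<D> division_of \<Union>\<D> \<and> \<Union>\<D> \<subseteq> S \<and> (\<Sum>I\<in>\<D>. Sup I - Inf I) < \<delta> \<longrightarrow>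
      (\<Sum>I\<in>\<D>. dist (\<gamma> (Inf I)) (\<gamma> (Sup I))) < \<epsilon>)"

text \<open>\<open>a\<close> collects the coordinates of the velocity in the frame \<open>X1, X2, X3\<close>; it is determined
  by the curve up to a null set, and (the frame being orthonormal) its Euclidean norm is the
  sub-Riemannian speed.\<close>

definition horizontal_curve :: "(real \<Rightarrow> n32) \<Rightarrow> (real \<Rightarrow> real^3) \<Rightarrow> bool" where
  "horizontal_curve \<gamma> a \<longleftrightarrow>
    abs_continuous_curve_on {0..1} \<gamma> \<and> a absolutely_integrable_on {0..1} \<and>
    (AE s in lebesgue. s \<in> {0..1} \<longrightarrow>
      (\<gamma> has_vector_derivative horizontal_vector (a s) (\<gamma> s)) (at s within {0..1}))"

definition cc_dist :: "n32 \<Rightarrow> real" where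
  "cc_dist g = Inf {integral {0..1} (\<lambda>s. norm (a s)) | \<gamma> a.
     horizontal_curve \<gamma> a \<and> \<gamma> 0 = 0 \<and> \<gamma> 1 = g}"

text \<open>The integrand is written with \<open>coth r = cosh r / sinh r\<close>; its value at \<open>\<lambda> = 0\<close>
  is irrelevant. It is complex-valued, so \<open>heat_profile\<close> and \<open>heat_kernel\<close> are, too.\<close>

definition heat_profile :: "real^3 \<Rightarrow> real^3 \<Rightarrow> complex" where
  "heat_profile x t = (LINT l|lborel.
     complex_of_real (norm l / sinh (norm l)) *
     exp (- (1/4) *
       (complex_of_real
          ((norm x)\<^sup>2 + (norm l * (cosh (norm l) / sinh (norm l)) - 1) / (norm l)\<^sup>2 *
                       ((norm l)\<^sup>2 * (norm x)\<^sup>2 - (l \<bullet> x)\<^sup>2))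
        - 4 * \<i> * complex_of_real (t \<bullet> l))))"

text \<open>The heat kernel is obtained for the value of \<open>C > 0\<close> that gives it total mass one.\<close>

definition heat_kernel :: "real \<Rightarrow> real \<Rightarrow> real^3 \<Rightarrow> real^3 \<Rightarrow> complex" where
  "heat_kernel C h x t =
     complex_of_real (C * h powr (-9/2)) * heat_profile ((1 / sqrt h) *\<^sub>R x) ((1 / h) *\<^sub>R t)"

end

theory Submission
  imports Defs "HOL-Complex_Analysis.Complex_Analysis" "HOL-Probability.Probability"
    "HOL-Real_Asymp.Real_Asymp"
begin

text \<open>The integrand of the heat profile extends meromorphically in \<open>\<lambda>\<close>, and the critical point of its
  phase lies on the polar set, at \<open>\<lambda> = (\<i> pi, 0, 0)\<close>. The contour is shifted to imaginary parts
  \<open>(pi - sqrt h, \<beta> sqrt h, 0)\<close>, with \<open>\<beta>\<close> read off from \<open>t\<close>; after \<open>\<lambda>\<close> is rescaled by \<open>h powr (1/2)\<close>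
  along the real direction \<open>(1, - \<beta>, 0)\<close> and by \<open>h powr (3/4)\<close> across it, dominated convergence leaves
  Gaussian integrals. The value of the phase at the critical point is the squared distance: projecting
  a horizontal curve to the plane orthogonal to \<open>x\<close> bounds its length from below by the isoperimetric
  inequality, and a helix attains the bound.\<close>

no_notation fps_nth (infixl "$" 75)

subsection \<open>Product expansions of the hyperbolic factors\<close>

text \<open>At the imaginary point i (pi - \<epsilon>, \<delta>, 0) the phase is, up to second-order
  terms, its critical value minus R^2 (\<delta> - \<beta> \<epsilon>)^2 / (pi \<epsilon>), where R =
  |x|. A first-order loss divided by h would ruin the estimate; only along \<delta> = \<beta>
  \<epsilon> is the loss of second order, so that \<epsilon> = sqrt h costs a bounded factor. There
  the singular denominator is of order sqrt h, so a transverse real displacement y changes the phase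
  by order y^2 / sqrt h, whence the scale h^(3/4); along (1, - \<beta>, 0) the first-order terms
  cancel and the scale is sqrt h. The Jacobian h^2 and the factor h^(-1/2) from the vanishing of
  sinh turn h^(-9/2) into h^(-3). The obstacle is the dominating function. The gain in the real part
  of the phase is estimated through the nearest pole only, and this bound does not grow for large
  \<lambda>, so Gaussian domination fails. The rescaled variables are instead bounded by powers of
  the gain and of 1 + A, with A the squared norm of the real part of \<lambda>; the exponential
  absorbs the former, the growth of sinh the latter.\<close>

definition pole :: "nat \<Rightarrow> real" where
  "pole k = (real (Suc k) * pi)\<^sup>2"

text \<open>For \<open>z = r\<^sup>2\<close> these are \<open>sinhc 0 z = sinh r / r\<close> and \<open>cothc 0 z = (r coth r - 1) / r\<^sup>2\<close>;
  \<open>sinhc 1\<close> leaves out the factor that vanishes at the critical point.\<close>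

definition sinhc :: "nat \<Rightarrow> complex \<Rightarrow> complex" where
  "sinhc n z = lim (\<lambda>N. \<Prod>k<N. 1 + z / of_real (pole (k + n)))"

definition cothc :: "nat \<Rightarrow> complex \<Rightarrow> complex" where
  "cothc n z = 2 * deriv (sinhc n) z / sinhc n z"

lemma pole_pos [simp]: "pole k > 0"
  by (simp add: pole_def)

lemma pole_nz [simp]: "pole k \<noteq> 0"
  using pole_pos[of k] by linarith

lemma pole_nonneg [simp]: "0 \<le> pole k"
  using pole_pos[of k] by linarith

lemma pole_0 [simp]: "pole 0 = pi\<^sup>2"
  by (simp add: pole_def)

lemma pole_Suc_gt: "pole (Suc k) > pi\<^sup>2"
proof -
  have "(1::real) * pi\<^sup>2 < (real (Suc (Suc k)))\<^sup>2 * pi\<^sup>2"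
    by (intro mult_strict_right_mono) (auto simp: power2_eq_square algebra_simps add_pos_nonneg)
  then show ?thesis by (simp add: pole_def power_mult_distrib)
qed

lemma pole_ge: "pole k \<ge> pi\<^sup>2"
  using pole_Suc_gt[of "k - 1"] by (cases k) auto

lemma summable_inverse_pole: "summable (\<lambda>k. 1 / pole (k + n))"
proof -
  have "summable (\<lambda>k. inverse ((real k) ^ 2))"
    by (rule inverse_power_summable) simp
  then have "summable (\<lambda>k. inverse ((real (k + Suc n)) ^ 2))"
    by (subst summable_iff_shift[of "\<lambda>k. inverse ((real k) ^ 2)"])
  then have "summable (\<lambda>k. inverse ((real (k + Suc n)) ^ 2) * (1 / pi\<^sup>2))"
    by (rule summable_mult2)
  moreover have "inverse ((real (k + Suc n)) ^ 2) * (1 / pi\<^sup>2) = 1 / pole (k + n)" for k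
    unfolding pole_def power_mult_distrib by (simp add: divide_inverse)
  ultimately show ?thesis by (simp only:)
qed

text \<open>Weierstrass M-test with majorants \<open>B / pole (k + n)\<close>. Working with the
  product in \<open>z\<close>, instead of a square root of \<open>z\<close>, gives the entire
  continuation and the removal of single factors without any choice of branch.\<close>

lemma uniform_limit_sinhc:
  "uniform_limit (cball 0 B) (\<lambda>N z. \<Prod>k<N. 1 + z / of_real (pole (k + n))) (sinhc n) sequentially"
proof -
  have nm: "norm (z / of_real (pole (k + n)) :: complex) = norm z * (1 / pole (k + n))" for z k
    using pole_pos[of "k + n"] by (simp add: norm_divide less_imp_le)
  have "uniformly_convergent_on (cball 0 B) (\<lambda>N z. \<Sum>k<N. norm (z / of_real (pole (k + n)) :: complex))"
    unfolding nm
  proof (rule Weierstrass_m_test'_ev)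
    show "\<forall>\<^sub>F k in sequentially. \<forall>z\<in>cball (0::complex) B. norm (norm z * (1 / pole (k + n))) \<le> B * (1 / pole (k + n))"
      using pole_pos by (intro always_eventually allI ballI) (auto simp: divide_right_mono less_imp_le)
    show "summable (\<lambda>k. B * (1 / pole (k + n)))"
      by (intro summable_mult summable_inverse_pole)
  qed
  then have "uniformly_convergent_on (cball 0 B) (\<lambda>N z. \<Prod>k<N. 1 + z / of_real (pole (k + n)) :: complex)"
    by (intro uniformly_convergent_on_prod continuous_intros) auto
  then show ?thesis
    unfolding uniformly_convergent_uniform_limit_iff sinhc_def[abs_def] .
qed

lemma sinhc_tendsto: "(\<lambda>N. \<Prod>k<N. 1 + z / of_real (pole (k + n))) \<longlonglongrightarrow> sinhc n z"
  by (rule tendsto_uniform_limitI[OF uniform_limit_sinhc[where B = "norm z"]]) auto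

lemma sinhc_holomorphic [holomorphic_intros]: "sinhc n holomorphic_on A"
proof -
  have "sinhc n field_differentiable at z" for z
  proof -
    have "sinhc n holomorphic_on ball 0 (norm z + 1)"
    proof (rule holomorphic_uniform_sequence[OF open_ball])
      fix N :: nat
      show "(\<lambda>z. \<Prod>k<N. 1 + z / of_real (pole (k + n)) :: complex) holomorphic_on ball 0 (norm z + 1)"
        by (intro holomorphic_intros) auto
    next
      fix x :: complex assume "x \<in> ball 0 (norm z + 1)"
      then obtain d where d: "d > 0" "cball x d \<subseteq> ball 0 (norm z + 1)"
        by (meson open_ball open_contains_cball)
      moreover have "uniform_limit (cball x d) (\<lambda>N z. \<Prod>k<N. 1 + z / of_real (pole (k + n))) (sinhc n) sequentially"
        by (rule uniform_limit_on_subset[OF uniform_limit_sinhc[where B = "norm z + 1"]]) (use d in auto)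
      ultimately show "\<exists>d>0. cball x d \<subseteq> ball 0 (norm z + 1) \<and>
        uniform_limit (cball x d) (\<lambda>N z. \<Prod>k<N. 1 + z / of_real (pole (k + n))) (sinhc n) sequentially"
        by blast
    qed
    then show ?thesis
      by (auto simp: holomorphic_on_open field_differentiable_def)
  qed
  then show ?thesis
    by (simp add: field_differentiable_at_within holomorphic_on_def)
qed

lemma sinhc_0_split: "sinhc 0 z = (1 + z / of_real (pi\<^sup>2)) * sinhc 1 z"
proof -
  have "(\<lambda>N. \<Prod>k<Suc N. 1 + z / of_real (pole (k + 0))) \<longlonglongrightarrow> sinhc 0 z"
    using sinhc_tendsto[of z 0] by (rule LIMSEQ_Suc)
  moreover have "(\<lambda>N. \<Prod>k<Suc N. 1 + z / of_real (pole (k + 0))) \<longlonglongrightarrow> (1 + z / of_real (pi\<^sup>2)) * sinhc 1 z"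
    unfolding prod.lessThan_Suc_shift using tendsto_mult[OF tendsto_const sinhc_tendsto[of z 1]] by simp
  ultimately show ?thesis by (rule LIMSEQ_unique)
qed

text \<open>Term-by-term logarithmic differentiation of the product: the Mittag-Leffler expansion of
  coth. It isolates the pole at \<open>- pi\<^sup>2\<close> and permits estimates pole by
  pole.\<close>

lemma cothc_sums:
  assumes "sinhc n z \<noteq> 0"
  shows "(\<lambda>k. 2 / (z + of_real (pole (k + n)))) sums cothc n z"
proof -
  have "(\<lambda>k. deriv (\<lambda>z. 1 + z / of_real (pole (k + n))) z / (1 + z / of_real (pole (k + n)))) sums
      (deriv (sinhc n) z / sinhc n z)"
  proof (rule logderiv_prodinf_complex_uniform_limit[where A = "ball 0 (norm z + 1)"])
    show "uniform_limit (ball 0 (norm z + 1)) (\<lambda>N z. \<Prod>k<N. 1 + z / of_real (pole (k + n))) (sinhc n) sequentially"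
      by (rule uniform_limit_on_subset[OF uniform_limit_sinhc[where B = "norm z + 1"]]) auto
  qed (use assms in \<open>auto intro!: holomorphic_intros\<close>)
  moreover have "deriv (\<lambda>z. 1 + z / of_real (pole (k + n))) z / (1 + z / of_real (pole (k + n))) =
      1 / (z + complex_of_real (pole (k + n)))" for k
  proof -
    have "deriv (\<lambda>z. 1 + z / complex_of_real (pole (k + n))) z = 1 / of_real (pole (k + n))"
      by (rule DERIV_imp_deriv) (auto intro!: derivative_eq_intros)
    then show ?thesis by (simp add: field_simps)
  qed
  ultimately have "(\<lambda>k. 1 / (z + complex_of_real (pole (k + n)))) sums (deriv (sinhc n) z / sinhc n z)"
    by simp
  from sums_mult[OF this, of 2] show ?thesis
    by (simp add: cothc_def)
qed

text \<open>Euler's product for the sine, with \<open>\<i> * w\<close> as the argument of the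
  sine.\<close>

lemma sinhc_square: "w * sinhc 0 (w\<^sup>2) = sinh w"
proof -
  define \<zeta> where "\<zeta> = \<i> * w / of_real pi"
  have "(\<lambda>n. of_real pi * \<zeta> * (\<Prod>k=1..n. 1 - \<zeta>^2 / of_nat k^2)) \<longlonglongrightarrow> sin (of_real pi * \<zeta>)"
    by (rule sin_product_formula_complex)
  also have "(\<lambda>n. of_real pi * \<zeta> * (\<Prod>k=1..n. 1 - \<zeta>^2 / of_nat k^2)) =
     (\<lambda>n. \<i> * w * (\<Prod>k<n. 1 + w\<^sup>2 / of_real (pole (k + 0))))"
  proof
    fix n
    have "(\<Prod>k=1..n. 1 - \<zeta>^2 / of_nat k^2) = (\<Prod>k<n. 1 - \<zeta>^2 / of_nat (Suc k)^2)"
      by (simp add: prod.atLeast1_atMost_eq)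
    also have "\<dots> = (\<Prod>k<n. 1 + w\<^sup>2 / of_real (pole (k + 0)))"
      by (intro prod.cong refl) (simp add: \<zeta>_def pole_def power_mult_distrib power_divide)
    finally show "of_real pi * \<zeta> * (\<Prod>k=1..n. 1 - \<zeta>^2 / of_nat k^2) = \<i> * w * (\<Prod>k<n. 1 + w\<^sup>2 / of_real (pole (k + 0)))"
      by (simp add: \<zeta>_def)
  qed
  also have "sin (of_real pi * \<zeta>) = \<i> * sinh w"
    by (simp add: \<zeta>_def sinh_conv_sin[of w] sin_i_times)
  finally have "(\<lambda>n. \<i> * w * (\<Prod>k<n. 1 + w\<^sup>2 / of_real (pole (k + 0)))) \<longlonglongrightarrow> \<i> * sinh w" .
  moreover have "(\<lambda>n. \<i> * w * (\<Prod>k<n. 1 + w\<^sup>2 / of_real (pole (k + 0)))) \<longlonglongrightarrow> \<i> * w * sinhc 0 (w\<^sup>2)"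
    by (intro tendsto_mult tendsto_const sinhc_tendsto)
  ultimately have "\<i> * w * sinhc 0 (w\<^sup>2) = \<i> * sinh w"
    by (rule LIMSEQ_unique[rotated])
  then show ?thesis by simp
qed

text \<open>Differentiating \<open>w * sinhc 0 (w\<^sup>2) = sinh w\<close> expresses the derivative
  of \<open>sinhc 0\<close> through \<open>cosh\<close>.\<close>

lemma cothc_square:
  assumes "w \<noteq> 0" "sinh w \<noteq> 0"
  shows "cothc 0 (w\<^sup>2) = (w * (cosh w / sinh w) - 1) / w\<^sup>2"
proof -
  have S: "sinhc 0 (w\<^sup>2) = sinh w / w"
    using sinhc_square[of w] assms by (simp add: field_simps)
  have "(sinhc 0 has_field_derivative deriv (sinhc 0) (w\<^sup>2)) (at (w\<^sup>2))"
    using sinhc_holomorphic[of 0 UNIV] by (simp add: holomorphic_derivI)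
  then have "((\<lambda>w. w * sinhc 0 (w\<^sup>2)) has_field_derivative (w * (deriv (sinhc 0) (w\<^sup>2) * (2 * w)) + sinhc 0 (w\<^sup>2))) (at w)"
    by (auto intro!: derivative_eq_intros DERIV_chain2[of "sinhc 0"])
  then have "(sinh has_field_derivative (w * (deriv (sinhc 0) (w\<^sup>2) * (2 * w)) + sinhc 0 (w\<^sup>2))) (at w)"
    by (simp add: sinhc_square)
  moreover have "(sinh has_field_derivative cosh w) (at w)"
    by (auto intro!: derivative_eq_intros)
  ultimately have "w * (deriv (sinhc 0) (w\<^sup>2) * (2 * w)) + sinhc 0 (w\<^sup>2) = cosh w"
    by (rule DERIV_unique)
  then have "2 * deriv (sinhc 0) (w\<^sup>2) * w\<^sup>2 = cosh w - sinh w / w"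
    unfolding S by (simp add: power2_eq_square algebra_simps)
  then have "2 * deriv (sinhc 0) (w\<^sup>2) = (cosh w - sinh w / w) / w\<^sup>2"
    using assms by (simp add: eq_divide_eq)
  then have "cothc 0 (w\<^sup>2) = (cosh w - sinh w / w) / w\<^sup>2 / (sinh w / w)"
    by (simp only: cothc_def S)
  also have "\<dots> = (w * (cosh w / sinh w) - 1) / w\<^sup>2"
    using assms by (simp add: field_simps)
  finally show ?thesis .
qed

text \<open>Telescoping: the factor is (k + 1) (k + 3) / (k + 2)^2. The limit 1/2 is also a lower
  bound for every partial product, which serves the growth estimate for
  \<open>sinhc 1\<close>.\<close>

lemma prod_one_minus_inverse_pole:
  "(\<Prod>k<N. 1 - pi\<^sup>2 / pole (k + 1)) = (real N + 2) / (2 * (real N + 1))"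
proof (induction N)
  case (Suc N)
  have "1 - pi\<^sup>2 / pole (N + 1) = ((real N + 2)\<^sup>2 - 1) / (real N + 2)\<^sup>2"
    by (simp add: pole_def power_mult_distrib diff_divide_distrib add_ac)
  also have "\<dots> = (real N + 1) * (real N + 3) / (real N + 2)\<^sup>2"
    by (simp add: power2_eq_square algebra_simps)
  finally have "(\<Prod>k<Suc N. 1 - pi\<^sup>2 / pole (k + 1)) =
    (real N + 2) / (2 * (real N + 1)) * ((real N + 1) * (real N + 3) / (real N + 2)\<^sup>2)"
    unfolding prod.lessThan_Suc Suc by simp
  also have "\<dots> = (real N + 3) / (2 * (real N + 2))"
    by (simp add: divide_simps power2_eq_square) (simp add: algebra_simps)
  finally show ?case by (simp add: add_ac)
qed simp

lemma sinhc_1_value: "sinhc 1 (- of_real (pi\<^sup>2)) = 1 / 2"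
proof -
  have "(\<lambda>N. \<Prod>k<N. 1 + (- of_real (pi\<^sup>2)) / of_real (pole (k + 1))) \<longlonglongrightarrow> sinhc 1 (- of_real (pi\<^sup>2))"
    by (rule sinhc_tendsto)
  also have "(\<lambda>N. \<Prod>k<N. 1 + (- of_real (pi\<^sup>2)) / of_real (pole (k + 1))) =
      (\<lambda>N. complex_of_real ((real N + 2) / (2 * (real N + 1))))"
    unfolding prod_one_minus_inverse_pole[symmetric] by (simp del: One_nat_def)
  finally have "(\<lambda>N. complex_of_real ((real N + 2) / (2 * (real N + 1)))) \<longlonglongrightarrow> sinhc 1 (- of_real (pi\<^sup>2))" .
  moreover have "(\<lambda>N. complex_of_real ((real N + 2) / (2 * (real N + 1)))) \<longlonglongrightarrow> complex_of_real (1 / 2)"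
    by (intro tendsto_of_real) real_asymp
  ultimately show ?thesis using LIMSEQ_unique by fastforce
qed

text \<open>Partial fractions: the terms are 2 / (pi^2 (k + 1) (k + 3)). This value contributes the
  3 in the coefficient 4 + \<beta>^2 = (1 + \<beta>^2) + 3 of the limiting Gaussian.\<close>

lemma cothc_1_value: "cothc 1 (- of_real (pi\<^sup>2)) = of_real (3 / (2 * pi\<^sup>2))"
proof -
  have "(\<lambda>k. 2 / (- of_real (pi\<^sup>2) + complex_of_real (pole (k + 1)))) sums cothc 1 (- of_real (pi\<^sup>2))"
    by (rule cothc_sums) (simp only: sinhc_1_value, simp)
  moreover have "2 / (- of_real (pi\<^sup>2) + complex_of_real (pole (k + 1))) =
      complex_of_real ((1 / pi\<^sup>2) * (1 / (real k + 1) - 1 / (real k + 3)))" for k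
  proof -
    have "pole (k + 1) - pi\<^sup>2 = pi\<^sup>2 * ((real k + 1) * (real k + 3))"
      by (simp add: pole_def power_mult_distrib power2_eq_square algebra_simps)
    then have "2 / (pole (k + 1) - pi\<^sup>2) = (1 / pi\<^sup>2) * (1 / (real k + 1) - 1 / (real k + 3))"
      by (simp add: divide_simps)
    then show ?thesis
      by (metis add.commute of_real_diff of_real_divide of_real_numeral uminus_add_conv_diff)
  qed
  ultimately have "(\<lambda>k. complex_of_real ((1 / pi\<^sup>2) * (1 / (real k + 1) - 1 / (real k + 3)))) sums cothc 1 (- of_real (pi\<^sup>2))"
    by simp
  moreover have "(\<lambda>k. complex_of_real ((1 / pi\<^sup>2) * (1 / (real k + 1) - 1 / (real k + 3)))) sums complex_of_real ((1 / pi\<^sup>2) * (3 / 2))"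
  proof (intro sums_of_real sums_mult)
    \<comment> \<open>The denominators differ by two, so the telescoping sequence carries two
      adjacent terms; its initial value is - 3/2.\<close>
    define u where "u = (\<lambda>k::nat. - 1 / (real k + 1) - 1 / (real k + 2))"
    have "(\<lambda>k. u (Suc k) - u k) sums (0 - u 0)"
      by (rule telescope_sums) (unfold u_def, real_asymp)
    then show "(\<lambda>k. 1 / (real k + 1) - 1 / (real k + 3)) sums (3 / 2)"
      by (simp add: u_def algebra_simps)
  qed
  ultimately have "cothc 1 (- of_real (pi\<^sup>2)) = complex_of_real ((1 / pi\<^sup>2) * (3 / 2))"
    by (rule sums_unique2)
  then show ?thesis by simp
qed

lemma cothc_0_split:
  assumes "sinhc 0 z \<noteq> 0"
  shows "cothc 0 z = 2 / (z + of_real (pi\<^sup>2)) + cothc 1 z"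
proof -
  have "sinhc 1 z \<noteq> 0" using assms by (auto simp: sinhc_0_split)
  from cothc_sums[OF this] have "(\<lambda>k. 2 / (z + of_real (pole (Suc k)))) sums cothc 1 z"
    by simp
  from sums_Suc[OF this] have "(\<lambda>k. 2 / (z + of_real (pole k))) sums (cothc 1 z + 2 / (z + of_real (pi\<^sup>2)))"
    by simp
  with cothc_sums[OF assms] show ?thesis
    by (simp add: sums_unique2 add.commute)
qed

text \<open>Each factor satisfies |1 + z/p| \<ge> (p - pi^2 + A) / p \<ge> (1 - pi^2 / p) (1 + A /
  p). The first parts multiply to at least 1/2; of the second only \<open>K\<close> are kept, each
  at least (1 + A) / \<open>pole K\<close>. Thus \<open>K\<close> is a free parameter: growth of any
  prescribed polynomial order stands in for the exponential growth of sinh.\<close>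

lemma sinhc_1_lower_bound:
  assumes A: "A \<ge> 0" and le: "\<And>k. norm (z + of_real (pole (Suc k))) \<ge> pole (Suc k) - pi\<^sup>2 + A"
  shows "norm (sinhc 1 z) \<ge> (1 / 2) * ((1 + A) / (real (Suc K) * pi)\<^sup>2) ^ K"
proof -
  let ?P = "pole K" 
  let ?c = "(1 + A) / (real (Suc K) * pi)\<^sup>2"
  have factor: "norm (1 + z / of_real (pole (Suc k))) \<ge> (1 - pi\<^sup>2 / pole (Suc k)) * (1 + A / pole (Suc k))" for k
  proof -
    have eq: "1 + z / of_real (pole (Suc k)) = (z + of_real (pole (Suc k))) / of_real (pole (Suc k))"
      by (simp add: field_simps)
    have "norm (1 + z / of_real (pole (Suc k))) = norm (z + of_real (pole (Suc k))) / pole (Suc k)"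
      unfolding eq using pole_pos[of "Suc k"] by (simp add: norm_divide less_imp_le)
    also have "\<dots> \<ge> (pole (Suc k) - pi\<^sup>2 + A) / pole (Suc k)"
      using le[of k] pole_pos[of "Suc k"] by (intro divide_right_mono) (auto simp: less_imp_le)
    finally have 1: "norm (1 + z / of_real (pole (Suc k))) \<ge> (pole (Suc k) - pi\<^sup>2 + A) / pole (Suc k)" .
    have "(1 - pi\<^sup>2 / pole (Suc k)) * (1 + A / pole (Suc k)) = 1 - pi\<^sup>2 / pole (Suc k) + (1 - pi\<^sup>2 / pole (Suc k)) * (A / pole (Suc k))"
      by (simp only: distrib_left mult_1_right)
    also have "\<dots> \<le> 1 - pi\<^sup>2 / pole (Suc k) + 1 * (A / pole (Suc k))"
      using pole_pos[of "Suc k"] A by (intro add_left_mono mult_right_mono) auto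
    also have "\<dots> = (pole (Suc k) - pi\<^sup>2 + A) / pole (Suc k)"
      by (simp add: add_divide_distrib diff_divide_distrib)
    finally show ?thesis using 1 by linarith
  qed
  have pos: "1 - pi\<^sup>2 / pole (Suc k) > 0" for k
    using pole_Suc_gt[of k] pole_pos[of "Suc k"] by simp
  have partial: "norm (\<Prod>k<N. 1 + z / of_real (pole (k + 1))) \<ge> (1 / 2) * ?c ^ K" if "N \<ge> K" for N
  proof -
    have mono: "pole (Suc k) \<le> pole K" if "k < K" for k
      using that unfolding pole_def by (intro power_mono mult_right_mono) auto
    have c: "?c \<le> 1 + A / pole (Suc k)" if "k < K" for k
    proof -
      have "pole (Suc k) \<ge> 1" using pole_ge[of "Suc k"] pi_gt3
        by (smt (verit) one_le_power)
      then have "pole K \<ge> 1" "pole K \<ge> pole (Suc k)" using mono[OF that] by auto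
      then have "1 / pole K \<le> 1" "A / pole K \<le> A / pole (Suc k)"
        using A by (auto intro!: divide_left_mono)
      moreover have "?c = 1 / pole K + A / pole K"
        by (simp add: pole_def add_divide_distrib)
      ultimately show ?thesis by linarith
    qed
    have "(1 / 2) * ?c ^ K \<le> (\<Prod>k<N. 1 - pi\<^sup>2 / pole (k + 1)) * (\<Prod>k<N. 1 + A / pole (k + 1))"
    proof (rule mult_mono)
      show "1 / 2 \<le> (\<Prod>k<N. 1 - pi\<^sup>2 / pole (k + 1))"
        unfolding prod_one_minus_inverse_pole by (simp add: field_simps)
      have "?c ^ K = (\<Prod>k<K. ?c)" by simp
      also have "\<dots> \<le> (\<Prod>k<K. 1 + A / pole (k + 1))"
        using c A by (intro prod_mono) auto
      also have "\<dots> \<le> (\<Prod>k<N. 1 + A / pole (k + 1))"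
        using that A pole_pos by (intro prod_mono2) (auto simp: less_imp_le intro!: add_nonneg_nonneg)
      finally show "?c ^ K \<le> (\<Prod>k<N. 1 + A / pole (k + 1))" .
      show "0 \<le> (\<Prod>k<N. 1 - pi\<^sup>2 / pole (k + 1))"
        using pos by (intro prod_nonneg) (auto simp: less_imp_le)
      show "0 \<le> ?c ^ K" using A by simp
    qed
    also have "\<dots> = (\<Prod>k<N. (1 - pi\<^sup>2 / pole (Suc k)) * (1 + A / pole (Suc k)))"
      by (simp add: prod.distrib)
    also have "\<dots> \<le> (\<Prod>k<N. norm (1 + z / of_real (pole (Suc k))))"
      using factor pos A pole_pos by (intro prod_mono) (auto simp: less_imp_le intro!: mult_nonneg_nonneg add_nonneg_nonneg)
    finally show ?thesis by (simp add: prod_norm)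
  qed
  have "(\<lambda>N. norm (\<Prod>k<N. 1 + z / of_real (pole (k + 1)))) \<longlonglongrightarrow> norm (sinhc 1 z)"
    by (intro tendsto_norm sinhc_tendsto)
  moreover have "\<forall>\<^sub>F N in sequentially. (1 / 2) * ?c ^ K \<le> norm (\<Prod>k<N. 1 + z / of_real (pole (k + 1)))"
    using eventually_ge_at_top[of K] by eventually_elim (rule partial)
  ultimately show ?thesis
    by (rule tendsto_lowerbound) simp
qed

section \<open>Bounds in the tube where the imaginary part of \<lambda> has norm below pi\<close>

definition sq3 :: "complex \<Rightarrow> complex \<Rightarrow> complex \<Rightarrow> complex" where
  "sq3 u v w = u\<^sup>2 + v\<^sup>2 + w\<^sup>2"

lemma sq3_shift:
  "sq3 (Complex a \<tau>1) (Complex b \<tau>2) (of_real c) + of_real p =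
    Complex (p - \<tau>1\<^sup>2 - \<tau>2\<^sup>2 + (a\<^sup>2 + b\<^sup>2 + c\<^sup>2)) (2 * (a * \<tau>1 + b * \<tau>2))"
  by (simp add: sq3_def complex_eq_iff power2_eq_square algebra_simps)

text \<open>This is one term of the pole expansion, times the square of the components orthogonal to
  x. At \<open>a = b = c = 0\<close> the quotient is \<open>- \<tau>2\<^sup>2 / m\<close>, so the
  second summand is the exact excess over the purely imaginary point. Completing the square in
  \<open>b + 2 * \<tau>2 * s / m\<close> makes its nonnegativity visible: for fixed imaginary part,
  the real part of the term is smallest at \<open>a = b = c = 0\<close>.\<close>

lemma Re_quotient_identity:
  fixes a b c \<tau>1 \<tau>2 p :: real
  defines "m \<equiv> p - \<tau>1\<^sup>2 - \<tau>2\<^sup>2" and "s \<equiv> a * \<tau>1 + b * \<tau>2" and "A \<equiv> a\<^sup>2 + b\<^sup>2 + c\<^sup>2"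
  assumes m: "m > 0"
  shows "Re (((Complex b \<tau>2)\<^sup>2 + (of_real c)\<^sup>2) / (sq3 (Complex a \<tau>1) (Complex b \<tau>2) (of_real c) + of_real p)) =
    - \<tau>2\<^sup>2 / m + (m * c\<^sup>2 + m * (b + 2 * \<tau>2 * s / m)\<^sup>2 + A * (\<tau>2\<^sup>2 + b\<^sup>2 + c\<^sup>2) + \<tau>2\<^sup>2 * A\<^sup>2 / m) / ((m + A)\<^sup>2 + 4 * s\<^sup>2)"
proof -
  have A: "A \<ge> 0" by (simp add: A_def)
  have M: "sq3 (Complex a \<tau>1) (Complex b \<tau>2) (of_real c) + of_real p = Complex (m + A) (2 * s)"
    unfolding sq3_shift by (simp add: m_def A_def s_def)
  have Q: "(Complex b \<tau>2)\<^sup>2 + (of_real c)\<^sup>2 = Complex (b\<^sup>2 + c\<^sup>2 - \<tau>2\<^sup>2) (2 * b * \<tau>2)"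
    by (simp add: complex_eq_iff power2_eq_square)
  define N where "N = (m + A)\<^sup>2 + 4 * s\<^sup>2"
  have "(m + A)\<^sup>2 > 0" using m A by auto
  then have N: "N > 0" unfolding N_def by (simp add: add_pos_nonneg)
  have "Re (((Complex b \<tau>2)\<^sup>2 + (of_real c)\<^sup>2) / (sq3 (Complex a \<tau>1) (Complex b \<tau>2) (of_real c) + of_real p)) =
      ((b\<^sup>2 + c\<^sup>2 - \<tau>2\<^sup>2) * (m + A) + 4 * b * \<tau>2 * s) / N"
    unfolding M Q by (simp add: Re_divide N_def power2_eq_square algebra_simps)
  also have "\<dots> = - \<tau>2\<^sup>2 / m + (m * c\<^sup>2 + m * (b + 2 * \<tau>2 * s / m)\<^sup>2 + A * (\<tau>2\<^sup>2 + b\<^sup>2 + c\<^sup>2) + \<tau>2\<^sup>2 * A\<^sup>2 / m) / N"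
  proof -
    have "(m * c\<^sup>2 + m * (b + 2 * \<tau>2 * s / m)\<^sup>2 + A * (\<tau>2\<^sup>2 + b\<^sup>2 + c\<^sup>2) + \<tau>2\<^sup>2 * A\<^sup>2 / m) =
      (b\<^sup>2 + c\<^sup>2 - \<tau>2\<^sup>2) * (m + A) + 4 * b * \<tau>2 * s + \<tau>2\<^sup>2 / m * N"
      using m by (simp add: N_def field_simps) (simp add: power2_eq_square algebra_simps)
    then show ?thesis using N by (simp add: add_divide_distrib)
  qed
  finally show ?thesis unfolding N_def .
qed

context
  fixes a b c \<tau>1 \<tau>2 :: real
  assumes tube: "\<tau>1\<^sup>2 + \<tau>2\<^sup>2 < pi\<^sup>2"
begin

lemma norm_sq3_plus_pole_ge:
  "norm ((sq3 (Complex a \<tau>1) (Complex b \<tau>2) (of_real c)) + of_real p) \<ge> p - \<tau>1\<^sup>2 - \<tau>2\<^sup>2 + (a\<^sup>2 + b\<^sup>2 + c\<^sup>2)"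
  unfolding sq3_shift using complex_Re_le_cmod[of "Complex (p - \<tau>1\<^sup>2 - \<tau>2\<^sup>2 + (a\<^sup>2 + b\<^sup>2 + c\<^sup>2)) (2 * (a * \<tau>1 + b * \<tau>2))"]
  by simp

lemma norm_sinhc_1_tube:
  "norm (sinhc 1 (sq3 (Complex a \<tau>1) (Complex b \<tau>2) (of_real c))) \<ge> (1 / 2) * ((1 + (a\<^sup>2 + b\<^sup>2 + c\<^sup>2)) / (real (Suc K) * pi)\<^sup>2) ^ K"
proof (rule sinhc_1_lower_bound)
  show "pole (Suc k) - pi\<^sup>2 + (a\<^sup>2 + b\<^sup>2 + c\<^sup>2) \<le> norm ((sq3 (Complex a \<tau>1) (Complex b \<tau>2) (of_real c)) + of_real (pole (Suc k)))" for k
    using norm_sq3_plus_pole_ge[of "pole (Suc k)"] tube by simp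
qed auto

lemma sinhc_1_tube_nz: "sinhc 1 (sq3 (Complex a \<tau>1) (Complex b \<tau>2) (of_real c)) \<noteq> 0"
  using norm_sinhc_1_tube[of 0] by auto

text \<open>The factor of \<open>pole 0\<close> is kept separate because its lower bound, pi^2 -
  |\<tau>|^2 + A up to a constant, degenerates at the critical point; the other factors are bounded
  uniformly up to the boundary of the tube.\<close>

lemma norm_sinhc_0_tube:
  "norm (sinhc 0 (sq3 (Complex a \<tau>1) (Complex b \<tau>2) (of_real c))) \<ge> (pi\<^sup>2 - \<tau>1\<^sup>2 - \<tau>2\<^sup>2 + (a\<^sup>2 + b\<^sup>2 + c\<^sup>2)) / pi\<^sup>2 * ((1 / 2) * ((1 + (a\<^sup>2 + b\<^sup>2 + c\<^sup>2)) / (real (Suc K) * pi)\<^sup>2) ^ K)"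
proof -
  have "norm (1 + (sq3 (Complex a \<tau>1) (Complex b \<tau>2) (of_real c)) / of_real (pi\<^sup>2)) = norm (((sq3 (Complex a \<tau>1) (Complex b \<tau>2) (of_real c)) + of_real (pi\<^sup>2)) / of_real (pi\<^sup>2))"
    by (simp add: add_divide_distrib add.commute)
  also have "\<dots> = norm ((sq3 (Complex a \<tau>1) (Complex b \<tau>2) (of_real c)) + of_real (pi\<^sup>2)) / pi\<^sup>2"
    by (simp add: norm_divide norm_power)
  also have "\<dots> \<ge> (pi\<^sup>2 - \<tau>1\<^sup>2 - \<tau>2\<^sup>2 + (a\<^sup>2 + b\<^sup>2 + c\<^sup>2)) / pi\<^sup>2"
    using norm_sq3_plus_pole_ge[of "pi\<^sup>2"] by (simp add: divide_right_mono)
  finally show ?thesis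
    unfolding sinhc_0_split norm_mult using norm_sinhc_1_tube[of K] by (intro mult_mono) auto
qed

lemma sinhc_0_tube_nz: "sinhc 0 (sq3 (Complex a \<tau>1) (Complex b \<tau>2) (of_real c)) \<noteq> 0"
proof -
  have "0 < (pi\<^sup>2 - \<tau>1\<^sup>2 - \<tau>2\<^sup>2 + (a\<^sup>2 + b\<^sup>2 + c\<^sup>2)) / pi\<^sup>2 * ((1 / 2) * ((1 + (a\<^sup>2 + b\<^sup>2 + c\<^sup>2)) / (real (Suc 0) * pi)\<^sup>2) ^ 0)"
    using tube by (auto simp: add_pos_nonneg)
  also have "\<dots> \<le> norm (sinhc 0 (sq3 (Complex a \<tau>1) (Complex b \<tau>2) (of_real c)))" by (rule norm_sinhc_0_tube)
  finally show ?thesis by auto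
qed

end

lemma Re_mult_2_div: "Re (q * (2 / w)) = 2 * Re (q / w)"
proof -
  have eq: "q * (2 / w) = 2 * (q / w)" by simp
  have "Re (2 * x) = 2 * Re x" for x by simp
  then show ?thesis unfolding eq .
qed

text \<open>\<open>Re_quotient_identity\<close> is summed over the poles. The excess is kept for the
  pole at \<open>- pi\<^sup>2\<close> alone, without its last term, since this is the one that
  becomes large near the critical point; the other excesses are nonnegative and dropped. What
  remains of the farther poles is their value at the purely imaginary point.\<close>

lemma Re_cothc_0_tube:
  fixes a b c \<tau>1 \<tau>2 :: real
  assumes tube: "\<tau>1\<^sup>2 + \<tau>2\<^sup>2 < pi\<^sup>2"
  defines "m \<equiv> pi\<^sup>2 - \<tau>1\<^sup>2 - \<tau>2\<^sup>2" and "s \<equiv> a * \<tau>1 + b * \<tau>2" and "A \<equiv> a\<^sup>2 + b\<^sup>2 + c\<^sup>2"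
    and "Q \<equiv> (Complex b \<tau>2)\<^sup>2 + (of_real c)\<^sup>2" and "Z \<equiv> sq3 (Complex a \<tau>1) (Complex b \<tau>2) (of_real c)"
  shows "Re (Q * cothc 0 Z) \<ge> - 2 * \<tau>2\<^sup>2 / m - \<tau>2\<^sup>2 * Re (cothc 1 (- of_real (\<tau>1\<^sup>2 + \<tau>2\<^sup>2))) +
    2 * ((m * c\<^sup>2 + m * (b + 2 * \<tau>2 * s / m)\<^sup>2 + A * (\<tau>2\<^sup>2 + b\<^sup>2 + c\<^sup>2)) / ((m + A)\<^sup>2 + 4 * s\<^sup>2))"
proof -
  let ?N = "(m + A)\<^sup>2 + 4 * s\<^sup>2"
  have m: "m > 0" using tube by (simp add: m_def)
  have A: "A \<ge> 0" by (simp add: A_def)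
  have "Re (Q * (2 / (Z + of_real (pi\<^sup>2)))) = 2 * Re (Q / (Z + of_real (pi\<^sup>2)))"
    by (simp only: Re_mult_2_div)
  also have "\<dots> = 2 * (- \<tau>2\<^sup>2 / m + (m * c\<^sup>2 + m * (b + 2 * \<tau>2 * s / m)\<^sup>2 + A * (\<tau>2\<^sup>2 + b\<^sup>2 + c\<^sup>2) + \<tau>2\<^sup>2 * A\<^sup>2 / m) / ?N)"
    unfolding Q_def Z_def m_def s_def A_def
    by (subst Re_quotient_identity) (use m in \<open>auto simp: m_def\<close>)
  also have "\<dots> \<ge> - 2 * \<tau>2\<^sup>2 / m + 2 * ((m * c\<^sup>2 + m * (b + 2 * \<tau>2 * s / m)\<^sup>2 + A * (\<tau>2\<^sup>2 + b\<^sup>2 + c\<^sup>2)) / ?N)"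
    using m by (simp add: divide_right_mono)
  finally have first: "Re (Q * (2 / (Z + of_real (pi\<^sup>2)))) \<ge>
     - 2 * \<tau>2\<^sup>2 / m + 2 * ((m * c\<^sup>2 + m * (b + 2 * \<tau>2 * s / m)\<^sup>2 + A * (\<tau>2\<^sup>2 + b\<^sup>2 + c\<^sup>2)) / ?N)" .
  have Z0: "sq3 (Complex 0 \<tau>1) (Complex 0 \<tau>2) (of_real 0) = - of_real (\<tau>1\<^sup>2 + \<tau>2\<^sup>2)"
    by (simp add: sq3_def complex_eq_iff power2_eq_square)
  have "(\<lambda>k. 2 / (- of_real (\<tau>1\<^sup>2 + \<tau>2\<^sup>2) + of_real (pole (k + 1)))) sums cothc 1 (- of_real (\<tau>1\<^sup>2 + \<tau>2\<^sup>2))"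
    using sinhc_1_tube_nz[OF tube, of 0 0 0] unfolding Z0 by (rule cothc_sums)
  then have s1: "(\<lambda>k. - \<tau>2\<^sup>2 * Re (2 / (- of_real (\<tau>1\<^sup>2 + \<tau>2\<^sup>2) + of_real (pole (k + 1))))) sums
      (- \<tau>2\<^sup>2 * Re (cothc 1 (- of_real (\<tau>1\<^sup>2 + \<tau>2\<^sup>2))))"
    by (intro sums_mult sums_Re)
  have s2: "(\<lambda>k. Re (Q * (2 / (Z + of_real (pole (k + 1)))))) sums Re (Q * cothc 1 Z)"
    unfolding Z_def by (intro sums_Re sums_mult cothc_sums sinhc_1_tube_nz tube)
  have le: "- \<tau>2\<^sup>2 * Re (2 / (- of_real (\<tau>1\<^sup>2 + \<tau>2\<^sup>2) + of_real (pole (k + 1)))) \<le> Re (Q * (2 / (Z + of_real (pole (k + 1)))))" for k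
  proof -
    define p where "p = pole (k + 1)"
    have p: "p - \<tau>1\<^sup>2 - \<tau>2\<^sup>2 > 0"
      using tube pole_ge[of "k + 1"] by (simp add: p_def)
    have "- of_real (\<tau>1\<^sup>2 + \<tau>2\<^sup>2) + of_real p = complex_of_real (p - \<tau>1\<^sup>2 - \<tau>2\<^sup>2)"
      by simp
    then have eq: "2 / (- of_real (\<tau>1\<^sup>2 + \<tau>2\<^sup>2) + of_real p) = complex_of_real (2 / (p - \<tau>1\<^sup>2 - \<tau>2\<^sup>2))"
      by (simp only: of_real_divide of_real_numeral)
    have "- \<tau>2\<^sup>2 * Re (2 / (- of_real (\<tau>1\<^sup>2 + \<tau>2\<^sup>2) + of_real p)) = 2 * (- \<tau>2\<^sup>2 / (p - \<tau>1\<^sup>2 - \<tau>2\<^sup>2))"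
      unfolding eq Re_complex_of_real by simp
    also have "- \<tau>2\<^sup>2 / (p - \<tau>1\<^sup>2 - \<tau>2\<^sup>2) \<le> Re (Q / (Z + of_real p))"
      unfolding Q_def Z_def Re_quotient_identity[OF p]
      by (rule add_increasing2[OF _ order_refl], intro divide_nonneg_nonneg add_nonneg_nonneg mult_nonneg_nonneg)
        (use p in auto)
    then have "2 * (- \<tau>2\<^sup>2 / (p - \<tau>1\<^sup>2 - \<tau>2\<^sup>2)) \<le> 2 * Re (Q / (Z + of_real p))"
      by (rule mult_left_mono) simp
    also have "\<dots> = Re (Q * (2 / (Z + of_real p)))"
      by (simp only: Re_mult_2_div)
    finally show ?thesis unfolding p_def .
  qed
  have "- \<tau>2\<^sup>2 * Re (cothc 1 (- of_real (\<tau>1\<^sup>2 + \<tau>2\<^sup>2))) \<le> Re (Q * cothc 1 Z)"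
    by (rule sums_le[OF le s1 s2])
  moreover have "Q * cothc 0 Z = Q * (2 / (Z + of_real (pi\<^sup>2))) + Q * cothc 1 Z"
    unfolding Z_def by (subst cothc_0_split[OF sinhc_0_tube_nz[OF tube]]) (simp add: distrib_left)
  then have "Re (Q * cothc 0 Z) = Re (Q * (2 / (Z + of_real (pi\<^sup>2)))) + Re (Q * cothc 1 Z)"
    by (metis plus_complex.sel(1))
  ultimately show ?thesis using first by linarith
qed

text \<open>Termwise comparison with \<open>T = pi\<^sup>2\<close>. It keeps the contribution of the
  farther poles uniformly bounded as the contour approaches the critical point.\<close>

lemma Re_cothc_1_le:
  assumes "T \<le> pi\<^sup>2"
  shows "Re (cothc 1 (- of_real T)) \<le> 3 / (2 * pi\<^sup>2)"
proof -
  have pos: "pole (k + 1) - pi\<^sup>2 > 0" for k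
    using pole_Suc_gt[of k] by simp
  have nz: "sinhc 1 (- of_real T) \<noteq> 0"
  proof -
    have "norm (sinhc 1 (- of_real T)) \<ge> (1 / 2) * ((1 + 0) / (real (Suc 0) * pi)\<^sup>2) ^ 0"
    proof (rule sinhc_1_lower_bound)
      fix k
      have "- complex_of_real T + of_real (pole (Suc k)) = of_real (pole (Suc k) - T)" by simp
      then show "pole (Suc k) - pi\<^sup>2 + 0 \<le> norm (- complex_of_real T + of_real (pole (Suc k)))"
        using assms by (simp only: norm_of_real)
    qed simp
    then show ?thesis by auto
  qed
  have nz': "sinhc 1 (- of_real (pi\<^sup>2)) \<noteq> 0"
    by (simp only: sinhc_1_value) simp
  have Re: "Re (2 / (- of_real S + complex_of_real (pole (k + 1)))) = 2 / (pole (k + 1) - S)" for S k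
  proof -
    have "- of_real S + complex_of_real (pole (k + 1)) = of_real (pole (k + 1) - S)" by simp
    then have "2 / (- of_real S + complex_of_real (pole (k + 1))) = of_real (2 / (pole (k + 1) - S))"
      by (simp only: of_real_divide of_real_numeral)
    then show ?thesis by (simp only: Re_complex_of_real)
  qed
  have "(\<lambda>k. 2 / (pole (k + 1) - T)) sums Re (cothc 1 (- of_real T))"
    using sums_Re[OF cothc_sums[OF nz]] unfolding Re .
  moreover have "(\<lambda>k. 2 / (pole (k + 1) - pi\<^sup>2)) sums Re (cothc 1 (- of_real (pi\<^sup>2)))"
    using sums_Re[OF cothc_sums[OF nz']] unfolding Re .
  moreover have "2 / (pole (k + 1) - T) \<le> 2 / (pole (k + 1) - pi\<^sup>2)" for k
    using pos[of k] assms by (intro divide_left_mono mult_pos_pos) auto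
  ultimately have "Re (cothc 1 (- of_real T)) \<le> Re (cothc 1 (- of_real (pi\<^sup>2)))"
    by (rule sums_le[rotated])
  then show ?thesis unfolding cothc_1_value by (simp only: Re_complex_of_real)
qed

lemma cothc_holomorphic: "cothc n holomorphic_on {z. sinhc n z \<noteq> 0}"
proof -
  have "deriv (sinhc n) holomorphic_on UNIV"
    by (intro holomorphic_deriv sinhc_holomorphic) auto
  then have "deriv (sinhc n) holomorphic_on {z. sinhc n z \<noteq> 0}"
    by (rule holomorphic_on_subset) auto
  then show ?thesis
    unfolding cothc_def[abs_def]
    by (intro holomorphic_on_divide holomorphic_on_mult holomorphic_on_const sinhc_holomorphic) auto
qed

subsection \<open>Integrals over three-dimensional space\<close>

lemma integrable_inverse_1_plus_square': "integrable lborel (\<lambda>x::real. inverse (1 + x\<^sup>2))"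
  using integrable_inverse_1_plus_square by (simp add: set_integrable_def)

lemma tendsto_lborel_integral_symmetric:
  fixes f :: "real \<Rightarrow> 'a::euclidean_space"
  assumes "integrable lborel f"
  shows "(\<lambda>n. integral {- real n..real n} f) \<longlonglongrightarrow> (LINT x|lborel. f x)"
proof -
  have "(\<lambda>n. LINT x|lborel. indicator {- real n..real n} x *\<^sub>R f x) \<longlonglongrightarrow> (LINT x|lborel. f x)"
  proof (rule integral_dominated_convergence[where w = "\<lambda>x. norm (f x)"])
    show "AE x in lborel. (\<lambda>n. indicator {- real n..real n} x *\<^sub>R f x) \<longlonglongrightarrow> f x"
    proof (rule AE_I2)
      fix x :: real
      obtain N where N: "\<bar>x\<bar> \<le> real N" by (meson real_arch_simple)
      show "(\<lambda>n. indicator {- real n..real n} x *\<^sub>R f x) \<longlonglongrightarrow> f x"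
        by (rule tendsto_eventually) (use N in \<open>auto simp: eventually_sequentially indicator_def intro!: exI[of _ N]\<close>)
    qed
  qed (use assms in \<open>auto simp: indicator_def\<close>)
  moreover have "(LINT x|lborel. indicator {- real n..real n} x *\<^sub>R f x) = integral {- real n..real n} f" for n
  proof -
    have "set_integrable lborel {- real n..real n} f"
      using integrable_mult_indicator[OF _ assms, of "{- real n..real n}"] by (simp add: set_integrable_def)
    then have "(LINT x:{- real n..real n}|lborel. f x) = integral {- real n..real n} f"
      by (rule set_borel_integral_eq_integral)
    then show ?thesis by (simp add: set_lebesgue_integral_def)
  qed
  ultimately show ?thesis by simp
qed

text \<open>A primitive \<open>F\<close> on the convex strip takes the place of Cauchy's theorem on
  rectangles: horizontal integrals are differences of values of \<open>F\<close>, and the vertical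
  sides are increments of \<open>F\<close> of size O(1 / (1 + n^2)).\<close>

lemma contour_shift:
  fixes f :: "complex \<Rightarrow> complex"
  assumes hol: "f holomorphic_on {z. \<alpha> < Im z \<and> Im z < \<beta>}"
    and y: "\<alpha> < y1" "y1 < \<beta>" "\<alpha> < y2" "y2 < \<beta>"
    and bound: "\<And>x y. y \<in> closed_segment y1 y2 \<Longrightarrow> norm (f (Complex x y)) \<le> B * inverse (1 + x\<^sup>2)"
  shows "(LINT x|lborel. f (Complex x y1)) = (LINT x|lborel. f (Complex x y2))"
proof -
  let ?S = "{z. \<alpha> < Im z \<and> Im z < \<beta>}"
  have S: "convex ?S" "open ?S"
    unfolding Collect_conj_eq
    by (intro convex_Int convex_halfspace_Im_gt convex_halfspace_Im_lt open_Int open_halfspace_Im_gt open_halfspace_Im_lt)+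
  obtain F where F: "\<And>z. z \<in> ?S \<Longrightarrow> (F has_field_derivative f z) (at z within ?S)"
    using holomorphic_convex_primitive'[OF S hol] by blast
  then have F': "(F has_field_derivative f z) (at z)" if "z \<in> ?S" for z
    using that at_within_open[OF that S(2)] by metis
  have seg: "\<alpha> < y \<and> y < \<beta>" if "y \<in> closed_segment y1 y2" for y
    using that y by (auto simp: closed_segment_eq_real_ivl split: if_splits)
  have cont: "continuous_on UNIV (\<lambda>x. f (Complex x y))" if "y \<in> closed_segment y1 y2" for y
    by (rule continuous_on_compose2[OF holomorphic_on_imp_continuous_on[OF hol]])
      (use seg[OF that] in \<open>auto intro!: continuous_intros simp: Complex_eq\<close>)
  have int: "integrable lborel (\<lambda>x. f (Complex x y))" if y': "y \<in> closed_segment y1 y2" for y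
  proof (rule Bochner_Integration.integrable_bound)
    show "integrable lborel (\<lambda>x. B * inverse (1 + x\<^sup>2))"
      by (intro integrable_mult_right integrable_inverse_1_plus_square')
    show "(\<lambda>x. f (Complex x y)) \<in> borel_measurable lborel"
      using borel_measurable_continuous_onI[OF cont[OF y']] by simp
    show "AE x in lborel. norm (f (Complex x y)) \<le> norm (B * inverse (1 + x\<^sup>2))"
      using bound[OF y'] abs_ge_self order.trans by (intro AE_I2) (simp, blast)
  qed
  have FTC: "integral {- real n..real n} (\<lambda>x. f (Complex x y)) = F (Complex (real n) y) - F (Complex (- real n) y)"
    if y': "y \<in> closed_segment y1 y2" for y n
  proof (rule integral_unique, rule fundamental_theorem_of_calculus)
    fix x assume "x \<in> {- real n..real n}"
    have "((\<lambda>x. Complex x y) has_vector_derivative 1) (at x)"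
      unfolding Complex_eq by (auto intro!: derivative_eq_intros has_vector_derivative_of_real)
    moreover have "(F has_field_derivative f (Complex x y)) (at (Complex x y))"
      using seg[OF y'] by (intro F') auto
    ultimately have "((F \<circ> (\<lambda>x. Complex x y)) has_vector_derivative (1 * f (Complex x y))) (at x)"
      by (rule field_vector_diff_chain_at)
    then have "((\<lambda>x. F (Complex x y)) has_vector_derivative f (Complex x y)) (at x)"
      by (simp add: o_def)
    then show "((\<lambda>x. F (Complex x y)) has_vector_derivative f (Complex x y)) (at x within {- real n..real n})"
      by (simp add: has_vector_derivative_at_within)
  qed auto
  \<comment> \<open>The values 1 and - 1 of \<open>c\<close> are the right and the left vertical
    side.\<close>
  have side: "(\<lambda>n. F (Complex (c * real n) y2) - F (Complex (c * real n) y1)) \<longlonglongrightarrow> 0" if c: "c\<^sup>2 = 1" for c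
  proof (rule Lim_null_comparison)
    show "\<forall>\<^sub>F n in sequentially. norm (F (Complex (c * real n) y2) - F (Complex (c * real n) y1)) \<le>
        B * inverse (1 + (real n)\<^sup>2) * \<bar>y2 - y1\<bar>"
    proof (intro always_eventually allI)
      fix n
      let ?L = "closed_segment (Complex (c * real n) y1) (Complex (c * real n) y2)"
      have L: "\<exists>y \<in> closed_segment y1 y2. z = Complex (c * real n) y" if z: "z \<in> ?L" for z
      proof -
        from z obtain u where u: "0 \<le> u" "u \<le> 1" "z = (1 - u) *\<^sub>R Complex (c * real n) y1 + u *\<^sub>R Complex (c * real n) y2"
          by (auto simp: closed_segment_def)
        then have "z = Complex (c * real n) ((1 - u) *\<^sub>R y1 + u *\<^sub>R y2)"
          by (simp add: complex_eq_iff algebra_simps)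
        with u show ?thesis by (auto simp: closed_segment_def)
      qed
      have "norm (F (Complex (c * real n) y2) - F (Complex (c * real n) y1)) \<le>
        B * inverse (1 + (real n)\<^sup>2) * norm (Complex (c * real n) y2 - Complex (c * real n) y1)"
      proof (rule field_differentiable_bound[of ?L])
        fix z assume "z \<in> ?L"
        with L obtain y where y': "y \<in> closed_segment y1 y2" "z = Complex (c * real n) y" by blast
        show "(F has_field_derivative f z) (at z within ?L)"
          using seg[OF y'(1)] y'(2) by (intro has_field_derivative_at_within[OF F']) auto
        show "norm (f z) \<le> B * inverse (1 + (real n)\<^sup>2)"
          using bound[OF y'(1), of "c * real n"] c y'(2) by (simp add: power_mult_distrib)
      qed auto
      also have "norm (Complex (c * real n) y2 - Complex (c * real n) y1) = \<bar>y2 - y1\<bar>"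
        by (simp add: cmod_def)
      finally show "norm (F (Complex (c * real n) y2) - F (Complex (c * real n) y1)) \<le>
        B * inverse (1 + (real n)\<^sup>2) * \<bar>y2 - y1\<bar>" .
    qed
    show "(\<lambda>n. B * inverse (1 + (real n)\<^sup>2) * \<bar>y2 - y1\<bar>) \<longlonglongrightarrow> 0"
      by real_asymp
  qed
  have "(\<lambda>n. (F (Complex (1 * real n) y2) - F (Complex (1 * real n) y1)) -
      (F (Complex (- 1 * real n) y2) - F (Complex (- 1 * real n) y1))) \<longlonglongrightarrow> 0 - 0"
    by (intro tendsto_diff side) auto
  then have "(\<lambda>n. integral {- real n..real n} (\<lambda>x. f (Complex x y2)) - integral {- real n..real n} (\<lambda>x. f (Complex x y1))) \<longlonglongrightarrow> 0"
    by (simp add: FTC algebra_simps)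
  moreover have "(\<lambda>n. integral {- real n..real n} (\<lambda>x. f (Complex x y2)) - integral {- real n..real n} (\<lambda>x. f (Complex x y1))) \<longlonglongrightarrow>
     (LINT x|lborel. f (Complex x y2)) - (LINT x|lborel. f (Complex x y1))"
    by (intro tendsto_diff tendsto_lborel_integral_symmetric int) auto
  ultimately show ?thesis
    using LIMSEQ_unique by fastforce
qed

section \<open>Changes of variables for Lebesgue measure\<close>

lemma  Basis_real3: "(Basis :: (real \<times> real \<times> real) set) = {(1, 0, 0), (0, 1, 0), (0, 0, 1)}"
  by (auto simp: Basis_prod_def prod_eq_iff)

lemma prod_Basis_real3:
  "(\<Prod>b\<in>(Basis :: (real \<times> real \<times> real) set). f b) = f (1, 0, 0) * f (0, 1, 0) * f (0, 0, 1)"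
  by (simp add: Basis_real3 mult.assoc)

lemma prod_Basis_vec3:
  "(\<Prod>b\<in>(Basis :: (real^3) set). f b) = f (axis 1 1) * f (axis 2 1) * f (axis 3 1)"
proof -
  have eq: "(Basis :: (real^3) set) = {axis 1 1, axis 2 1, axis 3 1}"
    unfolding Basis_vec_def UNIV_3 by auto
  show ?thesis
    unfolding eq by (simp add: axis_eq_axis mult.assoc)
qed

text \<open>Lebesgue measure is determined by its values on boxes, and the two coordinate
  descriptions agree there. Nested pairs are the form in which Fubini's theorem permits contour
  shifts in one variable at a time.\<close>

lemma integral_lborel_vec3:
  fixes f :: "real^3 \<Rightarrow> complex"
  assumes [measurable]: "f \<in> borel_measurable borel"
  shows "(LINT l|lborel. f l) = (LINT p|lborel. f (vector [fst p, fst (snd p), snd (snd p)]))"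
proof -
  let ?T = "\<lambda>p :: real \<times> real \<times> real. vector [fst p, fst (snd p), snd (snd p)] :: real^3"
  have T: "?T p = fst p *\<^sub>R axis 1 1 + fst (snd p) *\<^sub>R axis 2 1 + snd (snd p) *\<^sub>R axis 3 1" for p
    by (simp add: vec_eq_iff forall_3 axis_def)
  have [measurable]: "?T \<in> borel_measurable borel"
    unfolding T by (intro borel_measurable_continuous_onI continuous_intros)
  have "lborel = distr lborel borel ?T"
  proof (rule lborel_eqI)
    fix l u :: "real^3"
    assume le: "\<And>b. b \<in> Basis \<Longrightarrow> l \<bullet> b \<le> u \<bullet> b"
    have le': "l $ i \<le> u $ i" for i
      using le[of "axis i 1"] by (auto simp: Basis_vec_def inner_axis)
    have pre: "?T -` box l u = box (l$1, l$2, l$3) (u$1, u$2, u$3)"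
      by (auto simp: mem_box_cart mem_box Basis_real3 forall_3)
    have "emeasure (distr lborel borel ?T) (box l u) = emeasure lborel (?T -` box l u)"
      by (subst emeasure_distr) auto
    also have "\<dots> = (\<Prod>b\<in>Basis. ((u$1, u$2, u$3) - (l$1, l$2, l$3)) \<bullet> b)"
      unfolding pre by (rule emeasure_lborel_box) (auto simp: Basis_real3 le')
    also have "(\<Prod>b\<in>Basis. ((u$1, u$2, u$3) - (l$1, l$2, l$3)) \<bullet> b) = (\<Prod>b\<in>Basis. (u - l) \<bullet> b)"
      unfolding prod_Basis_real3 prod_Basis_vec3 by (simp add: inner_axis)
    finally show "emeasure (distr lborel borel ?T) (box l u) = (\<Prod>b\<in>Basis. (u - l) \<bullet> b)" .
  qed simp
  then have "(LINT l|lborel. f l) = (LINT l|distr lborel borel ?T. f l)" by simp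
  also have "\<dots> = (LINT p|lborel. f (?T p))"
    by (subst integral_distr) auto
  finally show ?thesis .
qed

lemma lborel_distr_swap:
  "(lborel :: (real \<times> real \<times> real) measure) = distr lborel borel (\<lambda>p. (fst (snd p), fst p, snd (snd p)))"
proof (rule lborel_eqI)
  let ?T = "\<lambda>p :: real \<times> real \<times> real. (fst (snd p), fst p, snd (snd p))"
  have [measurable]: "?T \<in> borel_measurable borel"
    by (intro borel_measurable_continuous_onI continuous_intros)
  fix l u :: "real \<times> real \<times> real"
  assume le: "\<And>b. b \<in> Basis \<Longrightarrow> l \<bullet> b \<le> u \<bullet> b"
  have pre: "?T -` box l u = box (?T l) (?T u)"
    by (auto simp: mem_box Basis_real3 inner_prod_def)
  have le': "\<And>b. b \<in> Basis \<Longrightarrow> ?T l \<bullet> b \<le> ?T u \<bullet> b"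
    using le[of "(1, 0, 0)"] le[of "(0, 1, 0)"] le[of "(0, 0, 1)"] by (auto simp: Basis_real3 inner_prod_def)
  have "emeasure (distr lborel borel ?T) (box l u) = emeasure lborel (?T -` box l u)"
    by (subst emeasure_distr) auto
  also have "\<dots> = (\<Prod>b\<in>Basis. (?T u - ?T l) \<bullet> b)"
    unfolding pre by (rule emeasure_lborel_box) (rule le')
  also have "(\<Prod>b\<in>Basis. (?T u - ?T l) \<bullet> b) = (\<Prod>b\<in>Basis. (u - l) \<bullet> b)"
    unfolding prod_Basis_real3 by (simp add: inner_prod_def)
  finally show "emeasure (distr lborel borel ?T) (box l u) = (\<Prod>b\<in>Basis. (u - l) \<bullet> b)" .
qed simp

lemma
  fixes f :: "real \<times> real \<times> real \<Rightarrow> complex"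
  assumes [measurable]: "f \<in> borel_measurable borel"
  shows integral_lborel_swap: "(LINT p|lborel. f p) = (LINT p|lborel. f (fst (snd p), fst p, snd (snd p)))"
    and integrable_lborel_swap: "integrable lborel f \<Longrightarrow> integrable lborel (\<lambda>p. f (fst (snd p), fst p, snd (snd p)))"
proof -
  let ?T = "\<lambda>p :: real \<times> real \<times> real. (fst (snd p), fst p, snd (snd p))"
  have [measurable]: "?T \<in> borel_measurable borel"
    by (intro borel_measurable_continuous_onI continuous_intros)
  have "(LINT p|lborel. f p) = (LINT p|distr lborel borel ?T. f p)"
    using lborel_distr_swap by simp
  also have "\<dots> = (LINT p|lborel. f (?T p))"
    by (subst integral_distr) auto
  finally show "(LINT p|lborel. f p) = (LINT p|lborel. f (?T p))" .
  assume "integrable lborel f"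
  then have "integrable (distr lborel borel ?T) f"
    using lborel_distr_swap by simp
  then show "integrable lborel (\<lambda>p. f (?T p))"
    by (subst (asm) integrable_distr_eq) auto
qed

lemma integral_lborel_scale3:
  fixes f :: "real \<times> real \<times> real \<Rightarrow> complex"
  assumes [measurable]: "f \<in> borel_measurable borel" and c: "c1 > 0" "c2 > 0" "c3 > 0"
  shows "(LINT p|lborel. f p) = of_real (c1 * c2 * c3) * (LINT p|lborel. f (c1 * fst p, c2 * fst (snd p), c3 * snd (snd p)))"
proof -
  let ?T = "\<lambda>p :: real \<times> real \<times> real. (c1 * fst p, c2 * fst (snd p), c3 * snd (snd p))"
  define cc where "cc = (\<lambda>b. b \<bullet> (c1, c2, c3))"
  have [measurable]: "?T \<in> borel_measurable borel"
    by (intro borel_measurable_continuous_onI continuous_intros)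
  have T: "(\<lambda>x. 0 + (\<Sum>b\<in>Basis. (cc b * (x \<bullet> b)) *\<^sub>R b)) = ?T"
    by (rule ext) (auto simp: Basis_real3 cc_def inner_prod_def)
  have "lborel = density (distr lborel borel (\<lambda>x. 0 + (\<Sum>b\<in>Basis. (cc b * (x \<bullet> b)) *\<^sub>R b))) (\<lambda>_. (\<Prod>b\<in>Basis. \<bar>cc b\<bar>))"
    by (rule lborel_affine_euclidean) (use c in \<open>auto simp: Basis_real3 cc_def inner_prod_def\<close>)
  also have "(\<Prod>b\<in>Basis. \<bar>cc b\<bar>) = c1 * c2 * c3"
    unfolding prod_Basis_real3 using c by (simp add: cc_def inner_prod_def)
  finally have "lborel = density (distr lborel borel ?T) (\<lambda>_. ennreal (c1 * c2 * c3))"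
    unfolding T .
  then have "(LINT p|lborel. f p) = (LINT p|density (distr lborel borel ?T) (\<lambda>_. ennreal (c1 * c2 * c3)). f p)"
    by simp
  also have "\<dots> = (LINT p|distr lborel borel ?T. (c1 * c2 * c3) *\<^sub>R f p)"
    by (subst integral_density) (use c in auto)
  also have "\<dots> = (LINT p|lborel. (c1 * c2 * c3) *\<^sub>R f (?T p))"
    by (subst integral_distr) auto
  finally show ?thesis by (simp add: scaleR_conv_of_real)
qed

text \<open>A contour shift acts on one variable with the others fixed, and Fubini carries the
  equality to the full integral. The second variable is reached through
  \<open>integral_lborel_swap\<close>.\<close>

lemma integral_lborel_inner_first:
  fixes f g :: "real \<times> real \<times> real \<Rightarrow> complex"
  assumes f: "integrable lborel f" and g: "integrable lborel g"
    and eq: "\<And>y. (LINT x|lborel. f (x, y)) = (LINT x|lborel. g (x, y))"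
  shows "(LINT p|lborel. f p) = (LINT p|lborel. g p)"
proof -
  have *: "(LINT p|lborel. h p) = (LINT y|lborel. LINT x|lborel. h (x, y))" if "integrable lborel h"
    for h :: "real \<times> real \<times> real \<Rightarrow> complex"
    using lborel_pair.integral_snd[of "\<lambda>x y. h (x, y)"] that
    by (simp add: lborel_prod)
  show ?thesis unfolding *[OF f] *[OF g] eq ..
qed

lemma integrable_lborel_times:
  fixes f :: "'a::euclidean_space \<Rightarrow> real" and g :: "'b::euclidean_space \<Rightarrow> real"
  assumes f: "integrable lborel f" and g: "integrable lborel g"
  shows "integrable lborel (\<lambda>p. f (fst p) * g (snd p))"
proof -
  have [measurable]: "f \<in> borel_measurable borel" "g \<in> borel_measurable borel"
    using borel_measurable_integrable[OF f] borel_measurable_integrable[OF g] by auto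
  have "integrable (lborel \<Otimes>\<^sub>M lborel) (\<lambda>p. f (fst p) * g (snd p))"
  proof (rule lborel_pair.Fubini_integrable)
    show "integrable lborel (\<lambda>x. LINT y|lborel. norm (f (fst (x, y)) * g (snd (x, y))))"
      using integrable_norm[OF f] by (simp add: abs_mult)
    show "AE x in lborel. integrable lborel (\<lambda>y. f (fst (x, y)) * g (snd (x, y)))"
      using g by simp
  qed measurable
  then show ?thesis by (simp add: lborel_prod)
qed

lemma integrable_product_decay:
  "integrable lborel (\<lambda>p::real \<times> real \<times> real. inverse (1 + (fst p)\<^sup>2) * (inverse (1 + (fst (snd p))\<^sup>2) * inverse (1 + (snd (snd p))\<^sup>2)))"
  by (intro integrable_lborel_times[of "\<lambda>x. inverse (1 + x\<^sup>2)" "\<lambda>p. inverse (1 + (fst p)\<^sup>2) * inverse (1 + (snd p)\<^sup>2)"]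
      integrable_lborel_times[of "\<lambda>x. inverse (1 + x\<^sup>2)" "\<lambda>x. inverse (1 + x\<^sup>2)"] integrable_inverse_1_plus_square')

subsection \<open>The heat profile as a contour integral\<close>

text \<open>For x = R e_1 the bracket |\<lambda>|^2 |x|^2 - (\<lambda> . x)^2 is R^2 (v^2 + w^2).
  Hence \<open>hk_phase\<close> divided by - 4 h is the continuation to complex \<lambda> of the
  exponent in the heat profile at (x / sqrt h, t / h).\<close>

definition hk_phase :: "real \<Rightarrow> real \<Rightarrow> real \<Rightarrow> complex \<Rightarrow> complex \<Rightarrow> complex \<Rightarrow> complex" where
  "hk_phase R t1 t2 u v w = of_real (R\<^sup>2) * (1 + (v\<^sup>2 + w\<^sup>2) * cothc 0 (sq3 u v w)) -
     4 * \<i> * (of_real t1 * u + of_real t2 * v)"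

definition hk_integrand :: "real \<Rightarrow> real \<Rightarrow> real \<Rightarrow> real \<Rightarrow> complex \<Rightarrow> complex \<Rightarrow> complex \<Rightarrow> complex" where
  "hk_integrand R t1 t2 h u v w = exp (- hk_phase R t1 t2 u v w / of_real (4 * h)) / sinhc 0 (sq3 u v w)"

lemma of_real_Complex: "complex_of_real a = Complex a 0"
  by (simp add: complex_eq_iff)

lemma continuous_on_hk_integrand:
  assumes "continuous_on S u" "continuous_on S v" "continuous_on S w"
    and "\<And>x. x \<in> S \<Longrightarrow> sinhc 0 (sq3 (u x) (v x) (w x)) \<noteq> 0" and "h \<noteq> 0"
  shows "continuous_on S (\<lambda>x. hk_integrand R t1 t2 h (u x) (v x) (w x))"
proof -
  have q: "continuous_on S (\<lambda>x. sq3 (u x) (v x) (w x))"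
    unfolding sq3_def by (intro continuous_intros assms)
  have s: "continuous_on S (\<lambda>x. sinhc 0 (sq3 (u x) (v x) (w x)))"
    by (rule continuous_on_compose2[OF holomorphic_on_imp_continuous_on[OF sinhc_holomorphic[of 0 UNIV]] q]) simp
  have c: "continuous_on S (\<lambda>x. cothc 0 (sq3 (u x) (v x) (w x)))"
    by (rule continuous_on_compose2[OF holomorphic_on_imp_continuous_on[OF cothc_holomorphic[of 0]] q])
      (use assms in auto)
  show ?thesis
    unfolding hk_integrand_def hk_phase_def
    by (intro continuous_on_divide continuous_on_exp continuous_on_minus continuous_on_diff continuous_on_add
        continuous_on_mult continuous_on_power continuous_on_const assms c s)
      (use assms in auto)
qed

lemma holomorphic_on_hk_integrand:
  assumes "u holomorphic_on S" "v holomorphic_on S" "w holomorphic_on S"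
    and nz: "\<And>x. x \<in> S \<Longrightarrow> sinhc 0 (sq3 (u x) (v x) (w x)) \<noteq> 0"
    and h: "h \<noteq> 0"
  shows "(\<lambda>x. hk_integrand R t1 t2 h (u x) (v x) (w x)) holomorphic_on S"
proof -
  have q: "(\<lambda>x. sq3 (u x) (v x) (w x)) holomorphic_on S"
    unfolding sq3_def by (intro holomorphic_intros assms)
  have s: "(\<lambda>x. sinhc 0 (sq3 (u x) (v x) (w x))) holomorphic_on S"
    using holomorphic_on_compose[OF q sinhc_holomorphic] by (simp add: o_def)
  have c: "(\<lambda>x. cothc 0 (sq3 (u x) (v x) (w x))) holomorphic_on S"
    using holomorphic_on_compose_gen[OF q cothc_holomorphic[of 0]] nz by (auto simp: o_def)
  show ?thesis
    unfolding hk_integrand_def hk_phase_def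
    by (intro holomorphic_on_divide holomorphic_on_exp' holomorphic_on_minus holomorphic_on_diff
        holomorphic_on_add holomorphic_on_mult holomorphic_on_power holomorphic_on_const assms c s)
      (use nz h in auto)
qed

text \<open>The first line of the bound concerns the purely imaginary point alone, with the farther
  poles replaced by their bound at the critical point; the last line is the gain from the real part
  (a, b, c).\<close>

lemma Re_hk_phase_tube:
  fixes a b c \<tau>1 \<tau>2 :: real
  assumes tube: "\<tau>1\<^sup>2 + \<tau>2\<^sup>2 < pi\<^sup>2"
  defines "m \<equiv> pi\<^sup>2 - \<tau>1\<^sup>2 - \<tau>2\<^sup>2" and "s \<equiv> a * \<tau>1 + b * \<tau>2" and "A \<equiv> a\<^sup>2 + b\<^sup>2 + c\<^sup>2"
  shows "Re (hk_phase R t1 t2 (Complex a \<tau>1) (Complex b \<tau>2) (of_real c)) \<ge>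
    R\<^sup>2 * (1 - 2 * \<tau>2\<^sup>2 / m - \<tau>2\<^sup>2 * (3 / (2 * pi\<^sup>2))) + 4 * (t1 * \<tau>1 + t2 * \<tau>2) +
    2 * R\<^sup>2 * ((m * c\<^sup>2 + m * (b + 2 * \<tau>2 * s / m)\<^sup>2 + A * (\<tau>2\<^sup>2 + b\<^sup>2 + c\<^sup>2)) / ((m + A)\<^sup>2 + 4 * s\<^sup>2))"
proof -
  let ?E = "(m * c\<^sup>2 + m * (b + 2 * \<tau>2 * s / m)\<^sup>2 + A * (\<tau>2\<^sup>2 + b\<^sup>2 + c\<^sup>2)) / ((m + A)\<^sup>2 + 4 * s\<^sup>2)"
  let ?Q = "((Complex b \<tau>2)\<^sup>2 + (of_real c)\<^sup>2) * cothc 0 (sq3 (Complex a \<tau>1) (Complex b \<tau>2) (of_real c))"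
  have "\<tau>2\<^sup>2 * Re (cothc 1 (- of_real (\<tau>1\<^sup>2 + \<tau>2\<^sup>2))) \<le> \<tau>2\<^sup>2 * (3 / (2 * pi\<^sup>2))"
    using tube by (intro mult_left_mono Re_cothc_1_le) auto
  with Re_cothc_0_tube[OF tube, where a = a and b = b and c = c]
  have "Re ?Q \<ge> - 2 * \<tau>2\<^sup>2 / m - \<tau>2\<^sup>2 * (3 / (2 * pi\<^sup>2)) + 2 * ?E"
    unfolding m_def s_def A_def by linarith
  then have "R\<^sup>2 * (1 + Re ?Q) \<ge> R\<^sup>2 * (1 + (- 2 * \<tau>2\<^sup>2 / m - \<tau>2\<^sup>2 * (3 / (2 * pi\<^sup>2)) + 2 * ?E))"
    by (intro mult_left_mono add_left_mono) auto
  moreover have "Re (hk_phase R t1 t2 (Complex a \<tau>1) (Complex b \<tau>2) (of_real c)) =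
      R\<^sup>2 * (1 + Re ?Q) + 4 * (t1 * \<tau>1 + t2 * \<tau>2)"
    unfolding hk_phase_def by (simp add: algebra_simps)
  ultimately show ?thesis by (simp add: algebra_simps)
qed

lemma norm_hk_integrand_le:
  assumes h: "h > 0" and "B \<le> Re (hk_phase R t1 t2 u v w)" and "0 < d" "d \<le> norm (sinhc 0 (sq3 u v w))"
  shows "norm (hk_integrand R t1 t2 h u v w) \<le> exp (- B / (4 * h)) / d"
proof -
  have "Re (- hk_phase R t1 t2 u v w / of_real (4 * h)) = - Re (hk_phase R t1 t2 u v w) / (4 * h)"
    by (simp only: Re_divide_of_real) simp
  then have "norm (hk_integrand R t1 t2 h u v w) = exp (- Re (hk_phase R t1 t2 u v w) / (4 * h)) / norm (sinhc 0 (sq3 u v w))"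
    unfolding hk_integrand_def norm_divide norm_exp_eq_Re by simp
  also have "\<dots> \<le> exp (- B / (4 * h)) / d"
    using assms by (intro frac_le) (auto intro!: divide_right_mono)
  finally show ?thesis .
qed

text \<open>A crude bound for fixed \<open>h\<close>, uniform over a smaller closed tube. It only
  has to justify contour shifts and integrability, so the gain in the phase is discarded and all
  decay comes from \<open>sinhc 0\<close>. The exponent 3 grants one factor of decay to each real
  variable.\<close>

lemma hk_integrand_tube_bound:
  assumes h: "h > 0" and \<rho>: "\<rho> < pi\<^sup>2"
  obtains B where "B > 0" "\<And>a b c \<tau>1 \<tau>2. \<tau>1\<^sup>2 + \<tau>2\<^sup>2 \<le> \<rho> \<Longrightarrow>
    norm (hk_integrand R t1 t2 h (Complex a \<tau>1) (Complex b \<tau>2) (of_real c)) \<le> B * inverse ((1 + (a\<^sup>2 + b\<^sup>2 + c\<^sup>2)) ^ 3)"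
proof -
  define m0 where "m0 = pi\<^sup>2 - \<rho>"
  have m0: "m0 > 0" using \<rho> by (simp add: m0_def)
  define L where "L = R\<^sup>2 * (1 - 2 * pi\<^sup>2 / m0 - pi\<^sup>2 * (3 / (2 * pi\<^sup>2))) - 4 * (\<bar>t1\<bar> * pi + \<bar>t2\<bar> * pi)"
  define K where "K = (real (Suc 3) * pi)\<^sup>2"
  have K: "K > 0" by (simp add: K_def)
  define B where "B = exp (- L / (4 * h)) / (m0 / pi\<^sup>2 * ((1 / 2) * (1 / K ^ 3)))"
  show ?thesis
  proof (rule that)
    show "B > 0" using m0 K by (simp add: B_def)
    fix a b c \<tau>1 \<tau>2 :: real
    assume le: "\<tau>1\<^sup>2 + \<tau>2\<^sup>2 \<le> \<rho>"
    let ?A = "a\<^sup>2 + b\<^sup>2 + c\<^sup>2" and ?m = "pi\<^sup>2 - \<tau>1\<^sup>2 - \<tau>2\<^sup>2" and ?s = "a * \<tau>1 + b * \<tau>2"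
    have tube: "\<tau>1\<^sup>2 + \<tau>2\<^sup>2 < pi\<^sup>2" using le \<rho> by linarith
    have m: "m0 \<le> ?m" using le by (simp add: m0_def)
    have A: "?A \<ge> 0" "1 + ?A > 0" by (auto simp: add_pos_nonneg)
    have "\<tau>1\<^sup>2 \<le> pi\<^sup>2" "\<tau>2\<^sup>2 \<le> pi\<^sup>2" using tube by (auto intro: order.trans[rotated, OF less_imp_le[OF tube]])
    then have \<tau>: "\<bar>\<tau>1\<bar> \<le> pi" "\<bar>\<tau>2\<bar> \<le> pi"
      using abs_le_square_iff[of \<tau>1 pi] abs_le_square_iff[of \<tau>2 pi] by auto
    have 1: "2 * \<tau>2\<^sup>2 / ?m \<le> 2 * pi\<^sup>2 / m0"
      using \<open>\<tau>2\<^sup>2 \<le> pi\<^sup>2\<close> m m0 by (intro frac_le) auto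
    have 2: "\<tau>2\<^sup>2 * (3 / (2 * pi\<^sup>2)) \<le> pi\<^sup>2 * (3 / (2 * pi\<^sup>2))"
      using \<open>\<tau>2\<^sup>2 \<le> pi\<^sup>2\<close> by (intro mult_right_mono) auto
    have 3: "- (\<bar>t\<bar> * pi) \<le> t * \<tau>" if "\<bar>\<tau>\<bar> \<le> pi" for t \<tau> :: real
    proof -
      have "\<bar>t * \<tau>\<bar> \<le> \<bar>t\<bar> * pi" unfolding abs_mult using that by (intro mult_left_mono) auto
      then show ?thesis by linarith
    qed
    have 4: "R\<^sup>2 * (1 - 2 * pi\<^sup>2 / m0 - pi\<^sup>2 * (3 / (2 * pi\<^sup>2))) \<le> R\<^sup>2 * (1 - 2 * \<tau>2\<^sup>2 / ?m - \<tau>2\<^sup>2 * (3 / (2 * pi\<^sup>2)))"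
      using 1 2 by (intro mult_left_mono) auto
    have 5: "0 \<le> 2 * R\<^sup>2 * ((?m * c\<^sup>2 + ?m * (b + 2 * \<tau>2 * ?s / ?m)\<^sup>2 + ?A * (\<tau>2\<^sup>2 + b\<^sup>2 + c\<^sup>2)) / ((?m + ?A)\<^sup>2 + 4 * ?s\<^sup>2))"
      using tube by (intro mult_nonneg_nonneg divide_nonneg_nonneg add_nonneg_nonneg) auto
    have 6: "- (4 * (\<bar>t1\<bar> * pi + \<bar>t2\<bar> * pi)) \<le> 4 * (t1 * \<tau>1 + t2 * \<tau>2)"
    proof -
      have "- (4 * (x + y)) \<le> 4 * (u + v)" if "- x \<le> u" "- y \<le> v" for x y u v :: real
        using mult_left_mono[OF add_mono[OF that], of 4] by (simp add: algebra_simps)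
      then show ?thesis using 3[OF \<tau>(1), of t1] 3[OF \<tau>(2), of t2] .
    qed
    have comb: "x0 - w \<le> P" if "x0 \<le> x1" "0 \<le> E" "- w \<le> T" "x1 + T + E \<le> P" for x0 x1 w T E P :: real
      using that by linarith
    have ph: "L \<le> Re (hk_phase R t1 t2 (Complex a \<tau>1) (Complex b \<tau>2) (of_real c))"
      unfolding L_def by (rule comb[OF 4 5 6 Re_hk_phase_tube[OF tube]])
    let ?d = "m0 / pi\<^sup>2 * ((1 / 2) * ((1 + ?A) / K) ^ 3)"
    have "?d \<le> (?m + ?A) / pi\<^sup>2 * ((1 / 2) * ((1 + ?A) / K) ^ 3)"
      using add_mono[OF m A(1)] A K
      by (intro mult_right_mono divide_right_mono mult_nonneg_nonneg zero_le_power divide_nonneg_nonneg) simp_all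
    also have "\<dots> \<le> norm (sinhc 0 (sq3 (Complex a \<tau>1) (Complex b \<tau>2) (of_real c)))"
      unfolding K_def by (rule norm_sinhc_0_tube[OF tube])
    finally have d: "?d \<le> norm (sinhc 0 (sq3 (Complex a \<tau>1) (Complex b \<tau>2) (of_real c)))" .
    have "?d > 0" using m0 A K by (intro mult_pos_pos divide_pos_pos zero_less_power) simp_all
    from norm_hk_integrand_le[OF h ph this d]
    have "norm (hk_integrand R t1 t2 h (Complex a \<tau>1) (Complex b \<tau>2) (of_real c)) \<le> exp (- L / (4 * h)) / ?d" .
    also have "\<dots> = B * inverse ((1 + ?A) ^ 3)"
      using m0 K by (simp add: B_def field_simps)
    finally show "norm (hk_integrand R t1 t2 h (Complex a \<tau>1) (Complex b \<tau>2) (of_real c)) \<le> B * inverse ((1 + ?A) ^ 3)" .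
  qed
qed

lemma inverse_cube_le_product:
  fixes a b c :: real
  shows "inverse ((1 + (a\<^sup>2 + b\<^sup>2 + c\<^sup>2)) ^ 3) \<le> inverse (1 + a\<^sup>2) * (inverse (1 + b\<^sup>2) * inverse (1 + c\<^sup>2))"
proof -
  let ?X = "1 + (a\<^sup>2 + b\<^sup>2 + c\<^sup>2)"
  have "(1 + a\<^sup>2) * ((1 + b\<^sup>2) * (1 + c\<^sup>2)) \<le> ?X * (?X * ?X)"
    by (intro mult_mono) auto
  moreover have "0 < (1 + a\<^sup>2) * ((1 + b\<^sup>2) * (1 + c\<^sup>2))"
    by (intro mult_pos_pos) (auto simp: add_pos_nonneg)
  ultimately have "inverse (?X * (?X * ?X)) \<le> inverse ((1 + a\<^sup>2) * ((1 + b\<^sup>2) * (1 + c\<^sup>2)))"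
    by (rule le_imp_inverse_le)
  then show ?thesis by (simp add: power3_eq_cube mult.assoc)
qed

lemma inverse_cube_le_single:
  fixes a b c :: real
  shows "inverse ((1 + (a\<^sup>2 + b\<^sup>2 + c\<^sup>2)) ^ 3) \<le> inverse (1 + a\<^sup>2)" "inverse ((1 + (a\<^sup>2 + b\<^sup>2 + c\<^sup>2)) ^ 3) \<le> inverse (1 + b\<^sup>2)"
proof -
  let ?X = "1 + (a\<^sup>2 + b\<^sup>2 + c\<^sup>2)"
  have "?X ^ 1 \<le> ?X ^ 3" by (rule power_increasing) auto
  then have X: "?X \<le> ?X ^ 3" by simp
  have a: "0 < 1 + a\<^sup>2" "1 + a\<^sup>2 \<le> ?X" and b: "0 < 1 + b\<^sup>2" "1 + b\<^sup>2 \<le> ?X"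
    by (auto simp: add_pos_nonneg)
  show "inverse (?X ^ 3) \<le> inverse (1 + a\<^sup>2)" using order.trans[OF a(2) X] a(1) by (rule le_imp_inverse_le)
  show "inverse (?X ^ 3) \<le> inverse (1 + b\<^sup>2)" using order.trans[OF b(2) X] b(1) by (rule le_imp_inverse_le)
qed

lemma integrable_cube_decay:
  fixes f :: "real \<times> real \<times> real \<Rightarrow> complex"
  assumes "continuous_on UNIV f"
    and "\<And>a b c. norm (f (a, b, c)) \<le> B * inverse ((1 + (a\<^sup>2 + b\<^sup>2 + c\<^sup>2)) ^ 3)" and "B > 0"
  shows "integrable lborel f"
proof (rule Bochner_Integration.integrable_bound)
  show "integrable lborel (\<lambda>p::real \<times> real \<times> real. B * (inverse (1 + (fst p)\<^sup>2) * (inverse (1 + (fst (snd p))\<^sup>2) * inverse (1 + (snd (snd p))\<^sup>2))))"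
    by (intro integrable_mult_right integrable_product_decay)
  show "f \<in> borel_measurable lborel"
    using borel_measurable_continuous_onI[OF assms(1)] by simp
  show "AE p in lborel. norm (f p) \<le> norm (B * (inverse (1 + (fst p)\<^sup>2) * (inverse (1 + (fst (snd p))\<^sup>2) * inverse (1 + (snd (snd p))\<^sup>2))))"
  proof (rule AE_I2)
    fix p :: "real \<times> real \<times> real"
    obtain a b c where p: "p = (a, b, c)" by (cases p)
    have "norm (f p) \<le> B * inverse ((1 + (a\<^sup>2 + b\<^sup>2 + c\<^sup>2)) ^ 3)" unfolding p by (rule assms)
    also have "\<dots> \<le> B * (inverse (1 + a\<^sup>2) * (inverse (1 + b\<^sup>2) * inverse (1 + c\<^sup>2)))"
      using \<open>B > 0\<close> inverse_cube_le_product by (intro mult_left_mono) auto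
    finally show "norm (f p) \<le> norm (B * (inverse (1 + (fst p)\<^sup>2) * (inverse (1 + (fst (snd p))\<^sup>2) * inverse (1 + (snd (snd p))\<^sup>2))))"
      unfolding p by (simp add: mult.assoc)
  qed
qed

text \<open>The shear is invertible, so it distorts 1 + |\<lambda>|^2 by a bounded factor only: b^2
  \<le> 2 (b - \<beta> a)^2 + 2 \<beta>^2 a^2.\<close>

lemma shear_cube_le:
  fixes a b c \<beta> :: real
  shows "inverse ((1 + (a\<^sup>2 + (b - \<beta> * a)\<^sup>2 + c\<^sup>2)) ^ 3) \<le> (2 + 2 * \<beta>\<^sup>2) ^ 3 * inverse ((1 + (b\<^sup>2 + a\<^sup>2 + c\<^sup>2)) ^ 3)"
proof -
  let ?X = "1 + (a\<^sup>2 + (b - \<beta> * a)\<^sup>2 + c\<^sup>2)" and ?Y = "1 + (b\<^sup>2 + a\<^sup>2 + c\<^sup>2)"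
  have "b\<^sup>2 \<le> 2 * (b - \<beta> * a)\<^sup>2 + 2 * (\<beta> * a)\<^sup>2"
    using zero_le_power2[of "b - 2 * (\<beta> * a)"] by (simp add: power2_eq_square algebra_simps)
  moreover have "(2 + 2 * \<beta>\<^sup>2) * ?X = 2 + 2 * \<beta>\<^sup>2 + (2 + 2 * \<beta>\<^sup>2) * c\<^sup>2 + 2 * a\<^sup>2 + 2 * (\<beta> * a)\<^sup>2 + (2 + 2 * \<beta>\<^sup>2) * (b - \<beta> * a)\<^sup>2"
    by (simp add: power_mult_distrib algebra_simps)
  moreover have "1 * c\<^sup>2 \<le> (2 + 2 * \<beta>\<^sup>2) * c\<^sup>2" "2 * (b - \<beta> * a)\<^sup>2 \<le> (2 + 2 * \<beta>\<^sup>2) * (b - \<beta> * a)\<^sup>2"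
    by (intro mult_right_mono; simp add: add_increasing2)+
  moreover have "0 \<le> a\<^sup>2" "0 \<le> \<beta>\<^sup>2" by simp_all
  ultimately have "?Y \<le> (2 + 2 * \<beta>\<^sup>2) * ?X" by linarith
  then have "?Y ^ 3 \<le> ((2 + 2 * \<beta>\<^sup>2) * ?X) ^ 3" by (rule power_mono) simp
  then have "?Y ^ 3 \<le> (2 + 2 * \<beta>\<^sup>2) ^ 3 * ?X ^ 3" by (simp only: power_mult_distrib)
  moreover have "?X ^ 3 > 0" "?Y ^ 3 > 0" by (auto simp: add_pos_nonneg intro!: zero_less_power)
  ultimately show ?thesis by (simp add: field_simps)
qed

text \<open>First u is moved with Im v = 0, then v with Im u = \<tau>1; both paths stay in the tube.
  The shear is a translation of v by a real amount depending on u, hence harmless in the inner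
  integral, and q^8 = q^3 q^2 q^3 is the Jacobian of the scaling. The coordinate order (v, u, w) is
  the one left by the swap.\<close>

lemma hk_integral_shift:
  assumes h: "h > 0" and \<tau>: "0 \<le> \<tau>1" "0 \<le> \<tau>2" and tube: "\<tau>1\<^sup>2 + \<tau>2\<^sup>2 < pi\<^sup>2" and q: "q > 0"
  shows "(LINT p|lborel. hk_integrand R t1 t2 h (of_real (fst p)) (of_real (fst (snd p))) (of_real (snd (snd p)))) =
    of_real (q ^ 8) * (LINT p|lborel. hk_integrand R t1 t2 h (Complex (q\<^sup>2 * fst (snd p)) \<tau>1)
      (Complex (q ^ 3 * fst p - \<beta> * (q\<^sup>2 * fst (snd p))) \<tau>2) (of_real (q ^ 3 * snd (snd p))))"
proof -
  let ?F = "hk_integrand R t1 t2 h"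
  obtain B where B: "B > 0" and bound: "\<And>a b c \<sigma>1 \<sigma>2. \<sigma>1\<^sup>2 + \<sigma>2\<^sup>2 \<le> \<tau>1\<^sup>2 + \<tau>2\<^sup>2 \<Longrightarrow>
      norm (?F (Complex a \<sigma>1) (Complex b \<sigma>2) (of_real c)) \<le> B * inverse ((1 + (a\<^sup>2 + b\<^sup>2 + c\<^sup>2)) ^ 3)"
    using hk_integrand_tube_bound[OF h tube] by blast
  have cont: "continuous_on UNIV (\<lambda>p :: real \<times> real \<times> real. ?F (Complex (f p) \<sigma>1) (Complex (g p) \<sigma>2) (of_real (k p)))"
    if "continuous_on UNIV f" "continuous_on UNIV g" "continuous_on UNIV k" "\<sigma>1\<^sup>2 + \<sigma>2\<^sup>2 \<le> \<tau>1\<^sup>2 + \<tau>2\<^sup>2" for f g k \<sigma>1 \<sigma>2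
    using that tube h by (intro continuous_on_hk_integrand sinhc_0_tube_nz) (auto simp: Complex_eq intro!: continuous_intros)
  have sq1: "\<tau>1\<^sup>2 < pi\<^sup>2" using tube by (simp add: add_nonneg_pos le_less_trans[OF _ tube])
  have s1: "\<tau>1 < pi" using sq1 by (simp add: power_less_imp_less_base)
  let ?f0 = "\<lambda>p. ?F (Complex (fst p) 0) (Complex (fst (snd p)) 0) (of_real (snd (snd p)))"
  let ?f1 = "\<lambda>p. ?F (Complex (fst p) \<tau>1) (Complex (fst (snd p)) 0) (of_real (snd (snd p)))"
  let ?f2 = "\<lambda>p. ?F (Complex (fst (snd p)) \<tau>1) (Complex (fst p) 0) (of_real (snd (snd p)))"
  let ?f3 = "\<lambda>p. ?F (Complex (fst (snd p)) \<tau>1) (Complex (fst p - \<beta> * fst (snd p)) \<tau>2) (of_real (snd (snd p)))"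
  have i0: "integrable lborel ?f0"
    by (rule integrable_cube_decay[OF cont bound[THEN order.trans] B]) (auto intro!: continuous_intros)
  have i1: "integrable lborel ?f1"
    by (rule integrable_cube_decay[OF cont bound[THEN order.trans] B]) (auto intro!: continuous_intros)
  have i2: "integrable lborel ?f2"
    by (rule integrable_cube_decay[OF cont bound[THEN order.trans] B]) (auto intro!: continuous_intros simp: add_ac)
  have i3: "integrable lborel ?f3"
  proof (rule integrable_cube_decay)
    show "continuous_on UNIV ?f3"
      by (rule cont) (auto intro!: continuous_intros)
    show "0 < B * (2 + 2 * \<beta>\<^sup>2) ^ 3" using B by (auto intro!: mult_pos_pos zero_less_power simp: add_pos_nonneg)
    fix a b c :: real
    have "norm (?f3 (a, b, c)) \<le> B * inverse ((1 + (b\<^sup>2 + (a - \<beta> * b)\<^sup>2 + c\<^sup>2)) ^ 3)"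
      using bound[of \<tau>1 \<tau>2] by simp
    also have "\<dots> \<le> B * ((2 + 2 * \<beta>\<^sup>2) ^ 3 * inverse ((1 + (a\<^sup>2 + b\<^sup>2 + c\<^sup>2)) ^ 3))"
      using B by (intro mult_left_mono shear_cube_le) auto
    finally show "norm (?f3 (a, b, c)) \<le> B * (2 + 2 * \<beta>\<^sup>2) ^ 3 * inverse ((1 + (a\<^sup>2 + b\<^sup>2 + c\<^sup>2)) ^ 3)"
      by (simp only: mult.assoc)
  qed
  have "(LINT p|lborel. ?f0 p) = (LINT p|lborel. ?f1 p)"
  proof (rule integral_lborel_inner_first[OF i0 i1])
    fix y :: "real \<times> real"
    let ?g = "\<lambda>u. ?F u (Complex (fst y) 0) (of_real (snd y))"
    have "(LINT x|lborel. ?g (Complex x 0)) = (LINT x|lborel. ?g (Complex x \<tau>1))"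
    proof (rule contour_shift)
      show "?g holomorphic_on {z. - pi < Im z \<and> Im z < pi}"
      proof (rule holomorphic_on_hk_integrand)
        fix z assume "z \<in> {z. - pi < Im z \<and> Im z < pi}"
        then have "(Im z)\<^sup>2 + 0\<^sup>2 < pi\<^sup>2"
          using power_strict_mono[of "\<bar>Im z\<bar>" pi 2] by (simp add: abs_less_iff)
        from sinhc_0_tube_nz[OF this, of "Re z" "fst y" "snd y"]
        show "sinhc 0 (sq3 z (Complex (fst y) 0) (of_real (snd y))) \<noteq> 0"
          by simp
      qed (use h in auto)
      show "norm (?g (Complex x \<sigma>)) \<le> B * inverse (1 + x\<^sup>2)" if "\<sigma> \<in> closed_segment 0 \<tau>1" for x \<sigma>
      proof -
        have "0 \<le> \<sigma>" "\<sigma> \<le> \<tau>1" using that \<tau> by (auto simp: closed_segment_eq_real_ivl split: if_splits)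
        then have "\<sigma>\<^sup>2 \<le> \<tau>1\<^sup>2" by (intro power_mono) auto
        then have "\<sigma>\<^sup>2 + 0\<^sup>2 \<le> \<tau>1\<^sup>2 + \<tau>2\<^sup>2" by (simp add: add_increasing2)
        from bound[OF this, of x "fst y" "snd y"]
        have "norm (?g (Complex x \<sigma>)) \<le> B * inverse ((1 + (x\<^sup>2 + (fst y)\<^sup>2 + (snd y)\<^sup>2)) ^ 3)" .
        also have "\<dots> \<le> B * inverse (1 + x\<^sup>2)"
          using B by (intro mult_left_mono inverse_cube_le_single) auto
        finally show ?thesis .
      qed
    qed (use \<tau> s1 in auto)
    then show "(LINT x|lborel. ?f0 (x, y)) = (LINT x|lborel. ?f1 (x, y))" by simp
  qed
  also have "\<dots> = (LINT p|lborel. ?f2 p)"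
    using borel_measurable_integrable[OF i1] by (subst integral_lborel_swap) auto
  also have "\<dots> = (LINT p|lborel. ?f3 p)"
  proof (rule integral_lborel_inner_first[OF i2 i3])
    fix y :: "real \<times> real"
    let ?g = "\<lambda>v. ?F (Complex (fst y) \<tau>1) v (of_real (snd y))"
    \<comment> \<open>With \<open>Im u = \<tau>1\<close> fixed, \<open>r\<close> is the half-width
      of the strip in which \<open>v\<close> moves inside the tube.\<close>
    define r where "r = sqrt (pi\<^sup>2 - \<tau>1\<^sup>2)"
    have r: "r > 0" "r\<^sup>2 = pi\<^sup>2 - \<tau>1\<^sup>2" using sq1 by (auto simp: r_def)
    have "\<tau>2\<^sup>2 < r\<^sup>2" using tube r by simp
    then have \<tau>2: "\<tau>2 < r" using r(1) by (simp add: power_less_imp_less_base)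
    have "(LINT x|lborel. ?g (Complex x 0)) = (LINT x|lborel. ?g (Complex x \<tau>2))"
    proof (rule contour_shift)
      show "?g holomorphic_on {z. - r < Im z \<and> Im z < r}"
      proof (rule holomorphic_on_hk_integrand)
        fix z assume "z \<in> {z. - r < Im z \<and> Im z < r}"
        then have "(Im z)\<^sup>2 < r\<^sup>2"
          using r(1) power_strict_mono[of "\<bar>Im z\<bar>" r 2] by (simp add: abs_less_iff)
        then have "\<tau>1\<^sup>2 + (Im z)\<^sup>2 < pi\<^sup>2" using r by simp
        from sinhc_0_tube_nz[OF this, of "fst y" "Re z" "snd y"]
        show "sinhc 0 (sq3 (Complex (fst y) \<tau>1) z (of_real (snd y))) \<noteq> 0"
          by simp
      qed (use h in auto)
      show "norm (?g (Complex x \<sigma>)) \<le> B * inverse (1 + x\<^sup>2)" if "\<sigma> \<in> closed_segment 0 \<tau>2" for x \<sigma>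
      proof -
        have "0 \<le> \<sigma>" "\<sigma> \<le> \<tau>2" using that \<tau> by (auto simp: closed_segment_eq_real_ivl split: if_splits)
        then have "\<sigma>\<^sup>2 \<le> \<tau>2\<^sup>2" by (intro power_mono) auto
        then have "\<tau>1\<^sup>2 + \<sigma>\<^sup>2 \<le> \<tau>1\<^sup>2 + \<tau>2\<^sup>2" by simp
        from bound[OF this, of "fst y" x "snd y"]
        have "norm (?g (Complex x \<sigma>)) \<le> B * inverse ((1 + ((fst y)\<^sup>2 + x\<^sup>2 + (snd y)\<^sup>2)) ^ 3)" .
        also have "\<dots> \<le> B * inverse (1 + x\<^sup>2)"
          using B by (intro mult_left_mono inverse_cube_le_single) auto
        finally show ?thesis .
      qed
    qed (use \<tau> r \<tau>2 in auto)
    also have "\<dots> = (LINT x|lborel. ?g (Complex (x - \<beta> * fst y) \<tau>2))"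
      using lborel_integral_real_affine[of 1 "\<lambda>x. ?g (Complex x \<tau>2)" "- \<beta> * fst y"]
      by simp
    finally show "(LINT x|lborel. ?f2 (x, y)) = (LINT x|lborel. ?f3 (x, y))" by simp
  qed
  also have "\<dots> = of_real (q ^ 3 * q\<^sup>2 * q ^ 3) * (LINT p|lborel. ?f3 (q ^ 3 * fst p, q\<^sup>2 * fst (snd p), q ^ 3 * snd (snd p)))"
    by (rule integral_lborel_scale3) (use q borel_measurable_integrable[OF i3] in auto)
  also have "q ^ 3 * q\<^sup>2 * q ^ 3 = q ^ 8"
    by (simp flip: power_add)
  finally show ?thesis by (simp add: of_real_Complex)
qed

text \<open>Passing from (x, t) to (x / sqrt h, t / h) divides the whole phase by h while \<lambda>
  stays as it is. The two integrands agree except possibly at \<lambda> = 0, where the original one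
  divides by zero and the continued one is regular.\<close>

lemma heat_profile_eq_hk_integral:
  fixes x t :: "real^3"
  assumes x: "x = norm x *\<^sub>R axis 1 1" and t3: "t $ 3 = 0" and h: "h > 0"
  shows "heat_profile ((1 / sqrt h) *\<^sub>R x) ((1 / h) *\<^sub>R t) =
    (LINT p|lborel. hk_integrand (norm x) (t $ 1) (t $ 2) h (of_real (fst p)) (of_real (fst (snd p))) (of_real (snd (snd p))))"
proof -
  let ?R = "norm x"
  let ?F = "\<lambda>a b c. hk_integrand ?R (t $ 1) (t $ 2) h (of_real a) (of_real b) (of_real c)"
  have nz: "sinhc 0 (sq3 (of_real a) (of_real b) (of_real c)) \<noteq> 0" for a b c
    using sinhc_0_tube_nz[of 0 0 a b c] by (simp add: of_real_Complex)
  have comp: "continuous_on UNIV (\<lambda>l::real^3. complex_of_real (l $ i))" for i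
    by (intro continuous_intros)
  have cont: "continuous_on UNIV (\<lambda>l::real^3. ?F (l $ 1) (l $ 2) (l $ 3))"
    by (rule continuous_on_hk_integrand) (use nz h comp in auto)
  have eq: "complex_of_real (norm l / sinh (norm l)) * exp (- (1/4) *
       (complex_of_real ((norm ((1 / sqrt h) *\<^sub>R x))\<^sup>2 + (norm l * (cosh (norm l) / sinh (norm l)) - 1) / (norm l)\<^sup>2 *
           ((norm l)\<^sup>2 * (norm ((1 / sqrt h) *\<^sub>R x))\<^sup>2 - (l \<bullet> ((1 / sqrt h) *\<^sub>R x))\<^sup>2))
        - 4 * \<i> * complex_of_real (((1 / h) *\<^sub>R t) \<bullet> l))) = ?F (l $ 1) (l $ 2) (l $ 3)" if "l \<noteq> 0" for l :: "real^3"
  proof -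
    define r where "r = norm l"
    have r: "r > 0" using that by (simp add: r_def)
    have r2: "r\<^sup>2 = (l $ 1)\<^sup>2 + (l $ 2)\<^sup>2 + (l $ 3)\<^sup>2"
      unfolding r_def norm_vec_def L2_set_def by (simp add: sum_3)
    have sr: "sinh r \<noteq> 0" using r by simp
    have sq: "sq3 (of_real (l $ 1)) (of_real (l $ 2)) (of_real (l $ 3)) = (complex_of_real r)\<^sup>2"
      unfolding sq3_def by (simp only: of_real_power[symmetric] r2 of_real_add)
    have sinhr: "sinh (complex_of_real r) = complex_of_real (sinh r)"
      by (simp add: sinh_def exp_of_real scaleR_conv_of_real flip: of_real_minus)
    have coshr: "cosh (complex_of_real r) = complex_of_real (cosh r)"
      by (simp add: cosh_def exp_of_real scaleR_conv_of_real flip: of_real_minus)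
    have S: "sinhc 0 ((complex_of_real r)\<^sup>2) = complex_of_real (sinh r / r)"
      using sinhc_square[of "complex_of_real r"] r by (simp add: sinhr field_simps)
    have c: "cothc 0 ((complex_of_real r)\<^sup>2) = complex_of_real ((r * (cosh r / sinh r) - 1) / r\<^sup>2)"
      by (subst cothc_square) (use r sr in \<open>auto simp: sinhr coshr\<close>)
    have nx: "(norm ((1 / sqrt h) *\<^sub>R x))\<^sup>2 = ?R\<^sup>2 / h"
      using h by (simp add: power_mult_distrib power_divide)
    have "l \<bullet> x = ?R * l $ 1"
      by (subst x) (simp add: inner_axis mult.commute)
    then have lx: "(l \<bullet> ((1 / sqrt h) *\<^sub>R x))\<^sup>2 = ?R\<^sup>2 * (l $ 1)\<^sup>2 / h"
      using h by (simp add: power_mult_distrib power_divide)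
    have tl: "((1 / h) *\<^sub>R t) \<bullet> l = (t $ 1 * l $ 1 + t $ 2 * l $ 2) / h"
      using t3 by (simp add: inner_vec_def sum_3 add_divide_distrib)
    define g where "g = (r * (cosh r / sinh r) - 1) / r\<^sup>2"
    have br: "?R\<^sup>2 / h + g * (r\<^sup>2 * (?R\<^sup>2 / h) - ?R\<^sup>2 * (l $ 1)\<^sup>2 / h) = ?R\<^sup>2 * (1 + ((l $ 2)\<^sup>2 + (l $ 3)\<^sup>2) * g) / h"
      unfolding r2 using h by (simp add: field_simps)
    have "- (1/4) * (complex_of_real (?R\<^sup>2 / h + g * (r\<^sup>2 * (?R\<^sup>2 / h) - ?R\<^sup>2 * (l $ 1)\<^sup>2 / h))
        - 4 * \<i> * complex_of_real ((t $ 1 * l $ 1 + t $ 2 * l $ 2) / h)) =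
      - hk_phase ?R (t $ 1) (t $ 2) (of_real (l $ 1)) (of_real (l $ 2)) (of_real (l $ 3)) / of_real (4 * h)"
      unfolding br hk_phase_def sq c g_def[symmetric] using h by (simp add: field_simps)
    then show ?thesis
      unfolding hk_integrand_def sq S r_def[symmetric] nx lx tl g_def[symmetric]
      using r sr by simp
  qed
  have sc: "continuous_on UNIV (sinh :: real \<Rightarrow> real)" "continuous_on UNIV (cosh :: real \<Rightarrow> real)"
    by (intro continuous_intros)+
  note [measurable] = borel_measurable_continuous_onI[OF sc(1)] borel_measurable_continuous_onI[OF sc(2)]
  have [measurable]: "(exp :: complex \<Rightarrow> complex) \<in> borel_measurable borel"
    by (intro borel_measurable_continuous_onI continuous_intros)
  have [measurable]: "(\<lambda>l::real^3. ?F (l $ 1) (l $ 2) (l $ 3)) \<in> borel_measurable borel"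
    by (rule borel_measurable_continuous_onI[OF cont])
  have "heat_profile ((1 / sqrt h) *\<^sub>R x) ((1 / h) *\<^sub>R t) = integral\<^sup>L lborel (\<lambda>l::real^3. ?F (l $ 1) (l $ 2) (l $ 3))"
    unfolding heat_profile_def
  proof (rule Bochner_Integration.integral_cong_AE)
    show "AE l in lborel. complex_of_real (norm l / sinh (norm l)) * exp (- (1/4) *
       (complex_of_real ((norm ((1 / sqrt h) *\<^sub>R x))\<^sup>2 + (norm l * (cosh (norm l) / sinh (norm l)) - 1) / (norm l)\<^sup>2 *
           ((norm l)\<^sup>2 * (norm ((1 / sqrt h) *\<^sub>R x))\<^sup>2 - (l \<bullet> ((1 / sqrt h) *\<^sub>R x))\<^sup>2))
        - 4 * \<i> * complex_of_real (((1 / h) *\<^sub>R t) \<bullet> l))) = ?F (l $ 1) (l $ 2) (l $ 3)"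
      using AE_lborel_singleton[of "0 :: real^3"] by eventually_elim (rule eq)
  qed measurable
  also have "\<dots> = (LINT p|lborel. ?F (fst p) (fst (snd p)) (snd (snd p)))"
    by (subst integral_lborel_vec3) auto
  finally show ?thesis .
qed

text \<open>The reflection of \<lambda> to - \<lambda> conjugates the integrand. Reality of the
  kernel is what allows the relative error to be a real function.\<close>

lemma Im_heat_profile: "Im (heat_profile x t) = 0"
proof -
  let ?f = "\<lambda>l::real^3. complex_of_real (norm l / sinh (norm l)) * exp (- (1/4) *
       (complex_of_real ((norm x)\<^sup>2 + (norm l * (cosh (norm l) / sinh (norm l)) - 1) / (norm l)\<^sup>2 *
           ((norm l)\<^sup>2 * (norm x)\<^sup>2 - (l \<bullet> x)\<^sup>2)) - 4 * \<i> * complex_of_real (t \<bullet> l)))"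
  have cnj: "?f (- l) = cnj (?f l)" for l
    by (simp add: exp_cnj)
  have "lborel = density (distr lborel borel (\<lambda>l::real^3. 0 + (- 1) *\<^sub>R l)) (\<lambda>_. \<bar>- 1 :: real\<bar> ^ DIM(real^3))"
    by (rule lborel_affine) simp
  then have d: "(lborel :: (real^3) measure) = distr lborel borel uminus"
    by (simp add: density_1 fun_eq_iff)
  have sc: "continuous_on UNIV (sinh :: real \<Rightarrow> real)" "continuous_on UNIV (cosh :: real \<Rightarrow> real)"
    by (intro continuous_intros)+
  note [measurable] = borel_measurable_continuous_onI[OF sc(1)] borel_measurable_continuous_onI[OF sc(2)]
  have [measurable]: "(exp :: complex \<Rightarrow> complex) \<in> borel_measurable borel"
    by (intro borel_measurable_continuous_onI continuous_intros)
  have [measurable]: "?f \<in> borel_measurable borel" by measurable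
  have "(LINT l|lborel. ?f l) = (LINT l|distr lborel borel uminus. ?f l)"
    by (subst d) (rule refl)
  also have "\<dots> = (LINT l|lborel. ?f (- l))"
    by (rule integral_distr) measurable
  also have "\<dots> = cnj (LINT l|lborel. ?f l)"
    unfolding cnj by (rule Bochner_Integration.integral_cnj)
  finally have "heat_profile x t = cnj (heat_profile x t)"
    unfolding heat_profile_def .
  then show ?thesis by (simp add: complex_eq_iff)
qed

subsection \<open>Gaussian integrals and growth bounds\<close>

text \<open>From exp (k x^2 / 2) \<ge> 1 + k x^2 / 2 \<ge> m (1 + x^2) with
  \<open>m = min 1 (k / 2)\<close>, squared.\<close>

lemma exp_neg_square_le:
  fixes k x :: real
  assumes "k > 0"
  shows "exp (- (k * x\<^sup>2)) \<le> (1 / (min 1 (k / 2))\<^sup>2) * inverse ((1 + x\<^sup>2)\<^sup>2)"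
proof -
  define m where "m = min 1 (k / 2)"
  have m: "0 < m" "m \<le> 1" "m \<le> k / 2" using assms by (auto simp: m_def)
  have p: "0 < 1 + x\<^sup>2" by (simp add: add_pos_nonneg)
  have "m * x\<^sup>2 \<le> k / 2 * x\<^sup>2" using m by (intro mult_right_mono) auto
  then have "m * (1 + x\<^sup>2) \<le> 1 + k * x\<^sup>2 / 2" using m by (simp add: distrib_left)
  also have "\<dots> \<le> exp (k * x\<^sup>2 / 2)" by (rule exp_ge_add_one_self)
  finally have "(m * (1 + x\<^sup>2))\<^sup>2 \<le> (exp (k * x\<^sup>2 / 2))\<^sup>2"
    using m p by (intro power_mono) auto
  also have "\<dots> = exp (k * x\<^sup>2)" by (simp add: power2_eq_square flip: exp_add)
  finally have le: "m\<^sup>2 * (1 + x\<^sup>2)\<^sup>2 \<le> exp (k * x\<^sup>2)" by (simp add: power_mult_distrib)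
  have "exp (- (k * x\<^sup>2)) = inverse (exp (k * x\<^sup>2))" by (simp add: exp_minus)
  also have "\<dots> \<le> inverse (m\<^sup>2 * (1 + x\<^sup>2)\<^sup>2)"
    using le m p by (intro le_imp_inverse_le) auto
  finally show ?thesis using m by (simp add: m_def inverse_eq_divide)
qed

lemma exp_neg_square_le':
  fixes k x :: real
  assumes "k > 0"
  shows "exp (- (k * x\<^sup>2)) \<le> (1 / (min 1 (k / 2))\<^sup>2) * inverse (1 + x\<^sup>2)"
proof -
  have "1 + x\<^sup>2 \<le> (1 + x\<^sup>2)\<^sup>2" by (simp add: power2_eq_square[of "1 + x\<^sup>2"] algebra_simps)
  then have "inverse ((1 + x\<^sup>2)\<^sup>2) \<le> inverse (1 + x\<^sup>2)"
    by (intro le_imp_inverse_le) (simp_all add: add_pos_nonneg)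
  then have "(1 / (min 1 (k / 2))\<^sup>2) * inverse ((1 + x\<^sup>2)\<^sup>2) \<le> (1 / (min 1 (k / 2))\<^sup>2) * inverse (1 + x\<^sup>2)"
    by (rule mult_left_mono) simp
  then show ?thesis using exp_neg_square_le[OF assms, of x] by linarith
qed

lemma exp_neg_square_le_abs:
  fixes k x :: real
  assumes "k > 0"
  shows "\<bar>x\<bar> * exp (- (k * x\<^sup>2)) \<le> (1 / (min 1 (k / 2))\<^sup>2) * inverse (1 + x\<^sup>2)"
proof -
  have "\<bar>x\<bar> \<le> 1 + x\<^sup>2"
    using zero_le_power2[of "\<bar>x\<bar> - 1"] by (simp add: power2_diff)
  then have "\<bar>x\<bar> * exp (- (k * x\<^sup>2)) \<le> (1 + x\<^sup>2) * ((1 / (min 1 (k / 2))\<^sup>2) * inverse ((1 + x\<^sup>2)\<^sup>2))"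
    by (intro mult_mono exp_neg_square_le assms) auto
  also have "\<dots> = (1 / (min 1 (k / 2))\<^sup>2) * ((1 + x\<^sup>2) * inverse ((1 + x\<^sup>2)\<^sup>2))"
    by (simp only: mult.left_commute)
  also have "(1 + x\<^sup>2) * inverse ((1 + x\<^sup>2)\<^sup>2) = inverse (1 + x\<^sup>2)"
    using add_pos_nonneg[of 1 "x\<^sup>2"] by (simp add: power2_eq_square[of "1 + x\<^sup>2"])
  finally show ?thesis .
qed

lemma norm_exp_minus_mult_square: "norm (exp (- (\<kappa> * of_real (x\<^sup>2)))) = exp (- (Re \<kappa> * x\<^sup>2))"
  by (simp add: norm_exp_eq_Re)

lemma integrable_abs_gaussian:
  assumes "Re \<mu> > 0"
  shows "integrable lborel (\<lambda>x. of_real \<bar>x\<bar> * exp (- (\<mu> * of_real (x\<^sup>2))) :: complex)"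
proof (rule Bochner_Integration.integrable_bound)
  show "integrable lborel (\<lambda>x::real. (1 / (min 1 (Re \<mu> / 2))\<^sup>2) * inverse (1 + x\<^sup>2))"
    by (intro integrable_mult_right integrable_inverse_1_plus_square')
  show "(\<lambda>x. of_real \<bar>x\<bar> * exp (- (\<mu> * of_real (x\<^sup>2))) :: complex) \<in> borel_measurable lborel"
    by measurable
  show "AE x in lborel. norm (of_real \<bar>x\<bar> * exp (- (\<mu> * of_real (x\<^sup>2))) :: complex) \<le> norm ((1 / (min 1 (Re \<mu> / 2))\<^sup>2) * inverse (1 + x\<^sup>2))"
    using exp_neg_square_le_abs[OF assms]
    by (intro AE_I2) (simp only: norm_mult norm_exp_minus_mult_square norm_of_real abs_abs, simp)
qed

text \<open>A primitive is exp (- \<mu> x^2) / (2 \<mu>) on the negative half-line and its negative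
  on the positive one; each half contributes 1 / (2 \<mu>).\<close>

lemma integral_abs_gaussian:
  assumes "Re \<mu> > 0"
  shows "(LINT x|lborel. of_real \<bar>x\<bar> * exp (- (\<mu> * of_real (x\<^sup>2)))) = 1 / \<mu>"
proof -
  let ?f = "\<lambda>x::real. of_real \<bar>x\<bar> * exp (- (\<mu> * of_real (x\<^sup>2))) :: complex"
  have \<mu>: "\<mu> \<noteq> 0" using assms by auto
  have der: "((\<lambda>x::real. c * exp (- (\<mu> * of_real (x\<^sup>2)))) has_vector_derivative (- 2 * c * \<mu> * of_real x * exp (- (\<mu> * of_real (x\<^sup>2))))) (at x within A)"
    for x A c
  proof -
    have "((\<lambda>z. c * exp (- (\<mu> * z\<^sup>2))) has_field_derivative (- 2 * c * \<mu> * of_real x * exp (- (\<mu> * (of_real x)\<^sup>2)))) (at (of_real x))"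
      by (auto intro!: derivative_eq_intros)
    then have "((\<lambda>z. c * exp (- (\<mu> * (of_real z)\<^sup>2))) has_vector_derivative (- 2 * c * \<mu> * of_real x * exp (- (\<mu> * (of_real x)\<^sup>2)))) (at x within A)"
      by (rule has_vector_derivative_real_field)
    then show ?thesis by simp
  qed
  have int: "integral {- real n..real n} ?f = (1 - exp (- (\<mu> * of_real ((real n)\<^sup>2)))) / \<mu>" for n
  proof (rule integral_unique)
    have 1: "((\<lambda>x. (- 2 * (1 / (2 * \<mu>)) * \<mu> * of_real x * exp (- (\<mu> * of_real (x\<^sup>2))))) has_integral
       (1 / (2 * \<mu>)) * exp (- (\<mu> * of_real (0\<^sup>2))) - (1 / (2 * \<mu>)) * exp (- (\<mu> * of_real ((- real n)\<^sup>2)))) {- real n..0}"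
      by (rule fundamental_theorem_of_calculus[OF _ der]) simp
    have 1: "(?f has_integral ((1 / (2 * \<mu>)) * exp (- (\<mu> * of_real (0\<^sup>2))) - (1 / (2 * \<mu>)) * exp (- (\<mu> * of_real ((- real n)\<^sup>2))))) {- real n..0}"
      by (rule has_integral_eq[OF _ 1]) (use \<mu> in auto)
    have 2: "((\<lambda>x. (- 2 * (- 1 / (2 * \<mu>)) * \<mu> * of_real x * exp (- (\<mu> * of_real (x\<^sup>2))))) has_integral
       (- 1 / (2 * \<mu>)) * exp (- (\<mu> * of_real ((real n)\<^sup>2))) - (- 1 / (2 * \<mu>)) * exp (- (\<mu> * of_real (0\<^sup>2)))) {0..real n}"
      by (rule fundamental_theorem_of_calculus[OF _ der]) simp
    have 2: "(?f has_integral ((- 1 / (2 * \<mu>)) * exp (- (\<mu> * of_real ((real n)\<^sup>2))) - (- 1 / (2 * \<mu>)) * exp (- (\<mu> * of_real (0\<^sup>2))))) {0..real n}"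
      by (rule has_integral_eq[OF _ 2]) (use \<mu> in auto)
    have "(?f has_integral ((1 / (2 * \<mu>)) * exp (- (\<mu> * of_real (0\<^sup>2))) - (1 / (2 * \<mu>)) * exp (- (\<mu> * of_real ((- real n)\<^sup>2)))) +
       ((- 1 / (2 * \<mu>)) * exp (- (\<mu> * of_real ((real n)\<^sup>2))) - (- 1 / (2 * \<mu>)) * exp (- (\<mu> * of_real (0\<^sup>2))))) {- real n..real n}"
      by (rule has_integral_combine[OF _ _ 1 2]) auto
    then show "(?f has_integral (1 - exp (- (\<mu> * of_real ((real n)\<^sup>2)))) / \<mu>) {- real n..real n}"
      by (rule has_integral_eq_rhs) (use \<mu> in \<open>simp add: field_simps\<close>)
  qed
  have "(\<lambda>n. exp (- (\<mu> * of_real ((real n)\<^sup>2)))) \<longlonglongrightarrow> 0"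
  proof (rule tendsto_norm_zero_cancel, unfold norm_exp_minus_mult_square)
    show "(\<lambda>n. exp (- (Re \<mu> * (real n)\<^sup>2))) \<longlonglongrightarrow> 0"
      using assms by real_asymp
  qed
  then have "(\<lambda>n. (1 - exp (- (\<mu> * of_real ((real n)\<^sup>2)))) / \<mu>) \<longlonglongrightarrow> (1 - 0) / \<mu>"
    by (intro tendsto_intros \<mu>)
  then have "(\<lambda>n. integral {- real n..real n} ?f) \<longlonglongrightarrow> 1 / \<mu>"
    unfolding int by simp
  with tendsto_lborel_integral_symmetric[OF integrable_abs_gaussian[OF assms]] show ?thesis
    by (rule LIMSEQ_unique)
qed

text \<open>The substitution v = w t and an exchange of integrals lead to |w| exp (- \<kappa> (1 +
  t^2) w^2), and then to 1 / (1 + t^2). This treats complex \<kappa> directly, with neither a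
  complex square root nor analytic continuation from real \<kappa>.\<close>

lemma complex_gaussian_plane:
  assumes \<kappa>: "Re \<kappa> > 0"
  shows "integrable lborel (\<lambda>p :: real \<times> real. exp (- (\<kappa> * of_real ((fst p)\<^sup>2 + (snd p)\<^sup>2))))"
    and "(LINT p|lborel. exp (- (\<kappa> * of_real ((fst p)\<^sup>2 + (snd (p :: real \<times> real))\<^sup>2)))) = of_real pi / \<kappa>"
proof -
  let ?f = "\<lambda>p :: real \<times> real. exp (- (\<kappa> * of_real ((fst p)\<^sup>2 + (snd p)\<^sup>2)))"
  let ?C = "1 / (min 1 (Re \<kappa> / 2))\<^sup>2"
  have [measurable]: "?f \<in> borel_measurable borel"
    by (intro borel_measurable_continuous_onI continuous_intros)
  show int: "integrable lborel ?f"
  proof (rule Bochner_Integration.integrable_bound)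
    show "integrable lborel (\<lambda>p :: real \<times> real. (?C * inverse (1 + (fst p)\<^sup>2)) * (?C * inverse (1 + (snd p)\<^sup>2)))"
      by (intro integrable_lborel_times[of "\<lambda>x. ?C * inverse (1 + x\<^sup>2)" "\<lambda>x. ?C * inverse (1 + x\<^sup>2)"]
          integrable_mult_right integrable_inverse_1_plus_square')
    show "AE p in lborel. norm (?f p) \<le> norm ((?C * inverse (1 + (fst p)\<^sup>2)) * (?C * inverse (1 + (snd p)\<^sup>2)))"
    proof (rule AE_I2)
      fix p :: "real \<times> real"
      have "norm (?f p) = exp (- (Re \<kappa> * (fst p)\<^sup>2)) * exp (- (Re \<kappa> * (snd p)\<^sup>2))"
        by (simp add: norm_exp_eq_Re distrib_left flip: exp_add)
      also have "\<dots> \<le> (?C * inverse (1 + (fst p)\<^sup>2)) * (?C * inverse (1 + (snd p)\<^sup>2))"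
        by (intro mult_mono exp_neg_square_le' \<kappa>) auto
      finally show "norm (?f p) \<le> norm ((?C * inverse (1 + (fst p)\<^sup>2)) * (?C * inverse (1 + (snd p)\<^sup>2)))"
        by (rule order.trans) (simp only: real_norm_def abs_ge_self)
    qed
  qed measurable
  let ?g = "\<lambda>p :: real \<times> real. of_real \<bar>snd p\<bar> * exp (- (\<kappa> * of_real (1 + (fst p)\<^sup>2) * of_real ((snd p)\<^sup>2))) :: complex"
  have gm [measurable]: "?g \<in> borel_measurable borel"
  proof (rule borel_measurable_times)
    show "(\<lambda>p::real \<times> real. complex_of_real \<bar>snd p\<bar>) \<in> borel_measurable borel"
      by (intro borel_measurable_continuous_onI continuous_on_of_real continuous_on_rabs continuous_on_snd continuous_on_id)
    show "(\<lambda>p::real \<times> real. exp (- (\<kappa> * of_real (1 + (fst p)\<^sup>2) * of_real ((snd p)\<^sup>2)))) \<in> borel_measurable borel"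
      by (intro borel_measurable_continuous_onI continuous_intros)
  qed
  have Re: "Re (\<kappa> * of_real (1 + t\<^sup>2)) > 0" for t
    using \<kappa> by (simp add: add_pos_nonneg)
  have g_eq: "norm (?g (t, w)) = Re (of_real \<bar>w\<bar> * exp (- (of_real (Re \<kappa> * (1 + t\<^sup>2)) * of_real (w\<^sup>2))))" for t w
  proof -
    have "norm (?g (t, w)) = \<bar>w\<bar> * exp (- (Re \<kappa> * (1 + t\<^sup>2) * w\<^sup>2))"
      by (simp add: norm_mult norm_exp_eq_Re)
    also have "\<dots> = Re (of_real (\<bar>w\<bar> * exp (- (Re \<kappa> * (1 + t\<^sup>2) * w\<^sup>2))))" by simp
    also have "complex_of_real (\<bar>w\<bar> * exp (- (Re \<kappa> * (1 + t\<^sup>2) * w\<^sup>2))) =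
       of_real \<bar>w\<bar> * exp (- (of_real (Re \<kappa> * (1 + t\<^sup>2)) * of_real (w\<^sup>2)))"
      by (simp flip: exp_of_real)
    finally show ?thesis .
  qed
  have gnorm: "(LINT w|lborel. norm (?g (t, w))) = (1 / Re \<kappa>) * inverse (1 + t\<^sup>2)" for t
  proof -
    have R: "Re (complex_of_real (Re \<kappa> * (1 + t\<^sup>2))) > 0"
      using \<kappa> by (simp add: add_pos_nonneg)
    have "(LINT w|lborel. norm (?g (t, w))) = Re (LINT w|lborel. of_real \<bar>w\<bar> * exp (- (of_real (Re \<kappa> * (1 + t\<^sup>2)) * of_real (w\<^sup>2))))"
      unfolding g_eq by (rule integral_Re[OF integrable_abs_gaussian[OF R]])
    also have "\<dots> = Re (of_real (1 / (Re \<kappa> * (1 + t\<^sup>2))))"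
      unfolding integral_abs_gaussian[OF R] by (simp only: of_real_divide of_real_1)
    finally show ?thesis by (simp add: field_simps)
  qed
  have gint: "integrable (lborel \<Otimes>\<^sub>M lborel) ?g"
  proof (rule lborel_pair.Fubini_integrable)
    show "?g \<in> borel_measurable (lborel \<Otimes>\<^sub>M lborel)"
      using gm by (simp only: lborel_prod measurable_lborel1 measurable_lborel2)
    show "integrable lborel (\<lambda>t. LINT w|lborel. norm (?g (t, w)))"
      unfolding gnorm by (intro integrable_mult_right integrable_inverse_1_plus_square')
    show "AE t in lborel. integrable lborel (\<lambda>w. ?g (t, w))"
      using integrable_abs_gaussian[OF Re] by (intro AE_I2) simp
  qed
  have "(LINT p|lborel. ?f p) = (LINT w|lborel. LINT v|lborel. ?f (w, v))"
    using lborel_pair.integral_fst'[of ?f] int by (simp add: lborel_prod)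
  also have "\<dots> = (LINT w|lborel. LINT t|lborel. ?g (t, w))"
  proof (rule Bochner_Integration.integral_cong_AE)
    show "AE w in lborel. (LINT v|lborel. ?f (w, v)) = (LINT t|lborel. ?g (t, w))"
      using AE_lborel_singleton[of "0 :: real"]
    proof eventually_elim
      case (elim w)
      have "(LINT v|lborel. ?f (w, v)) = \<bar>w\<bar> *\<^sub>R (LINT t|lborel. ?f (w, 0 + w * t))"
        using elim by (rule lborel_integral_real_affine)
      also have "\<dots> = (LINT t|lborel. \<bar>w\<bar> *\<^sub>R ?f (w, 0 + w * t))"
        by (rule integral_scaleR_right[symmetric])
      also have "(\<lambda>t. \<bar>w\<bar> *\<^sub>R ?f (w, 0 + w * t)) = (\<lambda>t. ?g (t, w))"
        by (rule ext) (simp add: scaleR_conv_of_real power_mult_distrib algebra_simps)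
      finally show ?case .
    qed
  next
    show "(\<lambda>w. LINT v|lborel. ?f (w, v)) \<in> borel_measurable lborel"
      by measurable
    show "(\<lambda>w. LINT t|lborel. ?g (t, w)) \<in> borel_measurable lborel"
      by measurable
  qed
  also have "\<dots> = (LINT t|lborel. LINT w|lborel. ?g (t, w))"
    using lborel_pair.Fubini_integral[of "\<lambda>t w. ?g (t, w)"] gint by (simp add: case_prod_beta')
  also have "\<dots> = (LINT t|lborel. (1 / \<kappa>) * of_real (inverse (1 + t\<^sup>2)))"
  proof -
    have "(LINT w|lborel. ?g (t, w)) = (1 / \<kappa>) * of_real (inverse (1 + t\<^sup>2))" for t
      using integral_abs_gaussian[OF Re[of t]] by (simp add: field_simps)
    then show ?thesis by (simp only:)
  qed
  also have "\<dots> = (1 / \<kappa>) * of_real (LINT t|lborel. inverse (1 + t\<^sup>2))"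
    by (simp only: integral_mult_right_zero integral_complex_of_real)
  also have "(LINT t|lborel. inverse (1 + t\<^sup>2)) = pi"
    using LBINT_inverse_1_plus_square by (simp add: interval_lebesgue_integral_def set_lebesgue_integral_def)
  finally show "(LINT p|lborel. ?f p) = of_real pi / \<kappa>" by simp
qed

text \<open>Since 1 + i s = i (s - i), the integrand is a Gaussian on the line Im = - 1, which is
  moved to the real axis.\<close>

lemma integral_shifted_gaussian:
  assumes c: "c > 0"
  shows "(LINT s|lborel. exp (of_real (c / 4) * (1 + \<i> * of_real s)\<^sup>2)) = complex_of_real (sqrt (4 * pi / c))"
proof -
  let ?f = "\<lambda>z. exp (- (of_real (c / 4) * z\<^sup>2)) :: complex"
  have "(LINT s|lborel. exp (of_real (c / 4) * (1 + \<i> * of_real s)\<^sup>2)) = (LINT s|lborel. ?f (Complex s (- 1)))"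
  proof -
    have "(1 + \<i> * of_real s)\<^sup>2 = - (Complex s (- 1))\<^sup>2" for s
      by (simp add: complex_eq_iff power2_eq_square)
    then show ?thesis by simp
  qed
  also have "\<dots> = (LINT s|lborel. ?f (Complex s 0))"
  proof (rule contour_shift[where \<alpha> = "- 2" and \<beta> = 2 and B = "exp (c / 4) * (1 / (min 1 (c / 4 / 2))\<^sup>2)"])
    show "?f holomorphic_on {z. - 2 < Im z \<and> Im z < 2}" by (intro holomorphic_intros)
    show "norm (?f (Complex x y)) \<le> exp (c / 4) * (1 / (min 1 (c / 4 / 2))\<^sup>2) * inverse (1 + x\<^sup>2)"
      if "y \<in> closed_segment (- 1) 0" for x y
    proof -
      have y: "- 1 \<le> y" "y \<le> 0" using that by (auto simp: closed_segment_eq_real_ivl)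
      then have y2: "y\<^sup>2 \<le> 1" using power_mono[of "- y" 1 2] by simp
      have "norm (?f (Complex x y)) = exp (c / 4 * y\<^sup>2) * exp (- (c / 4 * x\<^sup>2))"
        unfolding norm_exp_eq_Re by (simp add: power2_eq_square right_diff_distrib diff_divide_distrib flip: exp_add)
      also have "\<dots> \<le> exp (c / 4) * ((1 / (min 1 (c / 4 / 2))\<^sup>2) * inverse (1 + x\<^sup>2))"
        using c y2 mult_left_mono[OF y2, of "c / 4"] by (intro mult_mono exp_neg_square_le') auto
      finally show ?thesis by (simp only: mult.assoc)
    qed
  qed auto
  also have "\<dots> = (LINT s|lborel. complex_of_real (exp (- (c / 4 * s\<^sup>2))))"
    by (simp add: exp_of_real[symmetric] Complex_eq)
  also have "\<dots> = complex_of_real (LINT s|lborel. exp (- (c / 4 * s\<^sup>2)))"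
    by (rule integral_complex_of_real)
  also have "(LINT s|lborel. exp (- (c / 4 * s\<^sup>2))) = sqrt (4 * pi / c)"
  proof -
    \<comment> \<open>The variance for which 1 / (2 \<sigma>^2) = c / 4.\<close>
    define \<sigma> where "\<sigma> = sqrt (2 / c)"
    have \<sigma>: "\<sigma> > 0" "\<sigma>\<^sup>2 = 2 / c" using c by (auto simp: \<sigma>_def)
    have 1: "(LINT s|lborel. normal_density 0 \<sigma> s) = 1"
      by (rule integral_normal_density) (rule \<sigma>)
    have 2: "normal_density 0 \<sigma> s = exp (- (c / 4 * s\<^sup>2)) / sqrt (4 * pi / c)" for s
      unfolding normal_density_def \<sigma> using c by (simp add: mult.commute)
    have "(LINT s|lborel. exp (- (c / 4 * s\<^sup>2))) / sqrt (4 * pi / c) = 1"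
      using 1 unfolding 2 integral_divide_zero .
    moreover have "sqrt (4 * pi / c) > 0" using c by simp
    ultimately show ?thesis by (metis divide_eq_1_iff)
  qed
  finally show ?thesis .
qed

section \<open>Polynomial control of the rescaled variables by the gain in the phase\<close>

lemma square_add_le:
  fixes a b :: real
  shows "(a + b)\<^sup>2 \<le> 2 * a\<^sup>2 + 2 * b\<^sup>2"
  using zero_le_power2[of "a - b"] by (simp add: power2_eq_square algebra_simps)

text \<open>For S \<ge> 1, one of the two terms of \<open>rel\<close> carries half of S. If it is C
  Y, then S Y \<le> 2 G S bounds Y, hence S, linearly in G. If it is C q^2 P, then P \<le> 2 G S
  yields 1 \<le> 4 C G q^2; squaring produces q^4, and multiplication by S turns this into S \<le>
  16 C^2 G^2 A.\<close>

lemma growth_bound: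
  fixes S P Y G A q C :: real
  assumes q: "q > 0" and C: "C \<ge> 1" and nn: "S \<ge> 0" "P \<ge> 0" "Y \<ge> 0" "G \<ge> 0"
    and A: "A = q ^ 4 * S" and rel: "S \<le> C * (q\<^sup>2 * P + Y)" and main: "P + S * Y \<le> G * (1 + S)"
  shows "1 + S \<le> 18 * C\<^sup>2 * ((1 + G)\<^sup>2 * (1 + A))"
proof -
  have A0: "A \<ge> 0" using nn by (simp add: A)
  have C2: "1 \<le> C\<^sup>2" "C \<le> C\<^sup>2" using C by (auto simp: power2_eq_square one_le_power intro: mult_ge1_I mult_left_mono[of 1 C C, simplified])
  have G1: "G \<le> (1 + G)\<^sup>2 * (1 + A)" "1 \<le> (1 + G)\<^sup>2 * (1 + A)" "G\<^sup>2 * A \<le> (1 + G)\<^sup>2 * (1 + A)"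
  proof -
    have 1: "(1 + G)\<^sup>2 * 1 \<le> (1 + G)\<^sup>2 * (1 + A)"
      using A0 by (intro mult_left_mono) auto
    have 2: "1 \<le> (1 + G)\<^sup>2" "G \<le> (1 + G)\<^sup>2"
      using nn by (auto simp: power2_eq_square algebra_simps add_increasing)
    show "G \<le> (1 + G)\<^sup>2 * (1 + A)" "1 \<le> (1 + G)\<^sup>2 * (1 + A)" using 1 2 by auto
    show "G\<^sup>2 * A \<le> (1 + G)\<^sup>2 * (1 + A)"
      using nn A0 by (intro mult_mono power_mono) auto
  qed
  let ?Z = "(1 + G)\<^sup>2 * (1 + A)"
  have "S \<le> 16 * C\<^sup>2 * ?Z"
  proof (cases "S \<ge> 1")
    case False
    then have "S \<le> 1 * ?Z" using G1 by linarith
    also have "\<dots> \<le> 16 * C\<^sup>2 * ?Z" using C2 G1 by (intro mult_right_mono) auto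
    finally show ?thesis .
  next
    case True
    have GS: "P + S * Y \<le> 2 * G * S"
    proof -
      have "G * (1 + S) \<le> G * (2 * S)" using True nn by (intro mult_left_mono) auto
      with main show ?thesis by simp
    qed
    show ?thesis
    proof (cases "S \<le> 2 * C * Y")
      case True
      have "S * Y \<le> S * (2 * G)" using GS nn by (simp add: mult_ac)
      then have "Y \<le> 2 * G" using \<open>S \<ge> 1\<close> by (simp add: mult_le_cancel_left)
      then have "S \<le> 2 * C * (2 * G)"
        using True C by (intro order.trans[OF True] mult_left_mono) auto
      also have "\<dots> = 4 * C * G" by simp
      also have "\<dots> \<le> 16 * C\<^sup>2 * ?Z"
        using C C2 G1 nn by (intro mult_mono) auto
      finally show ?thesis .
    next
      case False
      have "S \<le> 2 * C * (q\<^sup>2 * P)"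
        using rel False by (simp add: algebra_simps)
      also have "\<dots> \<le> 2 * C * (q\<^sup>2 * (2 * G * S))"
      proof -
        have "0 \<le> S * Y" using nn by simp
        then have "P \<le> 2 * G * S" using GS by linarith
        then show ?thesis using C by (intro mult_left_mono) auto
      qed
      finally have "S * 1 \<le> S * (4 * C * G * q\<^sup>2)" by (simp add: mult_ac)
      then have "1 \<le> 4 * C * G * q\<^sup>2" using \<open>S \<ge> 1\<close> by (simp add: mult_le_cancel_left)
      then have "1\<^sup>2 \<le> (4 * C * G * q\<^sup>2)\<^sup>2" by (intro power_mono) auto
      then have "1 \<le> 16 * C\<^sup>2 * (G\<^sup>2 * q ^ 4)"
        by (simp add: power_mult_distrib flip: power_mult)
      then have "1 * S \<le> 16 * C\<^sup>2 * (G\<^sup>2 * q ^ 4) * S" using nn by (intro mult_right_mono) auto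
      also have "\<dots> = 16 * C\<^sup>2 * (G\<^sup>2 * A)" by (simp add: A mult_ac)
      also have "\<dots> \<le> 16 * C\<^sup>2 * ?Z" using G1 by (intro mult_left_mono) auto
      finally show ?thesis by simp
    qed
  qed
  moreover have "1 \<le> 2 * C\<^sup>2 * ?Z"
  proof -
    have "1 * 1 \<le> (2 * C\<^sup>2) * ?Z" using C2 G1 by (intro mult_mono) auto
    then show ?thesis by simp
  qed
  ultimately show ?thesis by (simp add: algebra_simps)
qed

text \<open>The real parts of \<lambda> on the scaled contour are q^2 s, q^2 y1, q^2 y2, and q^2 X
  is the completed square of \<open>Re_quotient_identity\<close>. For small q, X is nearly q w1, so
  (X^2 + y2^2) / q^2 controls w1 and w2, while s is controlled because X - y1 is nearly \<beta> s.
  The exponents arise from (1 + P)^2 (1 + S)^2 with 1 + P \<le> (1 + G) (1 + S) and, up to a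
  constant, 1 + S \<le> (1 + G)^2 (1 + A): 2 + 2 * 4 = 10 for 1 + G, and 4 for 1 + A.\<close>

lemma scaled_weights_bound:
  fixes \<beta> q s w1 w2 G :: real
  defines "\<gamma> \<equiv> 1 + \<beta>\<^sup>2"
  defines "C \<equiv> 1 + 8 * \<gamma>\<^sup>2 / \<beta>\<^sup>2"
  defines "y1 \<equiv> q * w1 - \<beta> * s" and "y2 \<equiv> q * w2"
  defines "S \<equiv> s\<^sup>2 + y1\<^sup>2 + y2\<^sup>2"
  defines "X \<equiv> y1 + 2 * \<beta> / (2 * pi - \<gamma> * q\<^sup>2) * (s * (pi - q\<^sup>2) + y1 * (\<beta> * q\<^sup>2))"
  assumes \<beta>: "\<beta> > 0" and q: "q > 0" "q \<le> 1" "\<gamma> * q\<^sup>2 \<le> pi" and G: "G \<ge> 0"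
    and main: "(X\<^sup>2 + y2\<^sup>2) / q\<^sup>2 + S * (y1\<^sup>2 + y2\<^sup>2) \<le> G * (1 + S)"
  shows "(1 + w1\<^sup>2) * ((1 + s\<^sup>2) * (1 + w2\<^sup>2)) \<le> (2 + 2 * \<gamma> ^ 4) * (18 * C\<^sup>2) ^ 4 * ((1 + G) ^ 10 * (1 + q ^ 4 * S) ^ 4)"
proof -
  define \<delta> where "\<delta> = 2 * pi - \<gamma> * q\<^sup>2"
  define P where "P = (X\<^sup>2 + y2\<^sup>2) / q\<^sup>2"
  define A where "A = q ^ 4 * S"
  have \<gamma>: "\<gamma> \<ge> 1" by (simp add: \<gamma>_def)
  have \<delta>: "pi \<le> \<delta>" "\<delta> \<le> 2 * pi" "\<delta> > 0"
  proof -
    have "0 \<le> \<gamma> * q\<^sup>2" using \<gamma> by simp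
    then show "pi \<le> \<delta>" "\<delta> \<le> 2 * pi" "\<delta> > 0"
      using q(3) pi_gt_zero unfolding \<delta>_def by linarith+
  qed
  \<comment> \<open>\<open>\<theta>\<close> and the next quantity \<open>\<eta>\<close> measure how
    the coefficients of \<open>X\<close> depend on q; as q tends to 0 they tend to 0 and 1.\<close>
  define \<theta> where "\<theta> = 2 * \<beta>\<^sup>2 * q\<^sup>2 / \<delta>"
  define \<eta> where "\<eta> = 2 * (pi - q\<^sup>2) / \<delta>"
  have q2: "q\<^sup>2 \<le> 1" using q by (simp add: power_le_one)
  have X: "X = (1 + \<theta>) * y1 + \<beta> * \<eta> * s"
    unfolding X_def \<delta>_def[symmetric] \<theta>_def \<eta>_def using \<delta>(3)
    by (simp add: power2_eq_square field_simps)
  have \<theta>: "0 \<le> \<theta>" "\<theta> \<le> \<beta>\<^sup>2"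
  proof -
    show "0 \<le> \<theta>" using \<delta> by (simp add: \<theta>_def)
    have "2 * \<beta>\<^sup>2 * q\<^sup>2 \<le> \<beta>\<^sup>2 * 2"
      using q2 mult_left_mono[OF q2, of "\<beta>\<^sup>2"] by simp
    also have "\<dots> \<le> \<beta>\<^sup>2 * \<delta>" using \<delta> pi_gt3 by (intro mult_left_mono) auto
    finally show "\<theta> \<le> \<beta>\<^sup>2" using \<delta> by (simp add: \<theta>_def divide_le_eq)
  qed
  have \<eta>: "1 / 2 \<le> \<eta>"
  proof -
    have "\<delta> \<le> 4 * (pi - q\<^sup>2)" using \<delta> q2 pi_gt3 by argo
    then show ?thesis using \<delta> by (simp add: \<eta>_def le_divide_eq)
  qed
  have nn: "S \<ge> 0" "P \<ge> 0" "A \<ge> 0" "y1\<^sup>2 + y2\<^sup>2 \<ge> 0" by (auto simp: S_def P_def A_def)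
  have qP: "q\<^sup>2 * P = X\<^sup>2 + y2\<^sup>2" using q by (simp add: P_def)
  have C1: "C \<ge> 1" by (simp add: C_def)
  have rel: "S \<le> C * (q\<^sup>2 * P + (y1\<^sup>2 + y2\<^sup>2))"
  proof -
    have "(\<beta> * s / 2)\<^sup>2 \<le> (\<beta> * \<eta> * s)\<^sup>2"
    proof -
      have "\<bar>\<beta> * s / 2\<bar> = (1 / 2) * (\<beta> * \<bar>s\<bar>)" using \<beta> by (simp add: abs_mult)
      also have "\<dots> \<le> \<eta> * (\<beta> * \<bar>s\<bar>)" using \<eta> \<beta> by (intro mult_right_mono) auto
      also have "\<dots> = \<bar>\<beta> * \<eta> * s\<bar>" using \<beta> \<eta> by (simp add: abs_mult)
      finally show ?thesis by (simp only: abs_le_square_iff)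
    qed
    also have "\<beta> * \<eta> * s = X - (1 + \<theta>) * y1" by (simp add: X)
    also have "(X - (1 + \<theta>) * y1)\<^sup>2 \<le> 2 * X\<^sup>2 + 2 * ((1 + \<theta>) * y1)\<^sup>2"
      using zero_le_power2[of "X + (1 + \<theta>) * y1"] by (simp add: power2_eq_square algebra_simps)
    also have "((1 + \<theta>) * y1)\<^sup>2 \<le> \<gamma>\<^sup>2 * y1\<^sup>2"
      unfolding power_mult_distrib using \<theta> by (intro mult_right_mono power_mono) (auto simp: \<gamma>_def)
    finally have "\<beta>\<^sup>2 * s\<^sup>2 \<le> 8 * X\<^sup>2 + 8 * (\<gamma>\<^sup>2 * y1\<^sup>2)"
      by (simp add: power_mult_distrib power_divide)
    also have "\<dots> \<le> 8 * \<gamma>\<^sup>2 * (X\<^sup>2 + y1\<^sup>2)"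
    proof -
      have "1 * X\<^sup>2 \<le> \<gamma>\<^sup>2 * X\<^sup>2" using \<gamma> by (intro mult_right_mono) (auto simp: one_le_power)
      then show ?thesis by (simp add: algebra_simps)
    qed
    also have "\<dots> \<le> 8 * \<gamma>\<^sup>2 * (X\<^sup>2 + y1\<^sup>2 + 2 * y2\<^sup>2)" by (intro mult_left_mono) auto
    finally have "s\<^sup>2 \<le> (8 * \<gamma>\<^sup>2 / \<beta>\<^sup>2) * (X\<^sup>2 + y1\<^sup>2 + 2 * y2\<^sup>2)"
      using \<beta> by (simp add: field_simps)
    moreover have "C * (q\<^sup>2 * P + (y1\<^sup>2 + y2\<^sup>2)) = (8 * \<gamma>\<^sup>2 / \<beta>\<^sup>2) * (X\<^sup>2 + y1\<^sup>2 + 2 * y2\<^sup>2) + (X\<^sup>2 + y1\<^sup>2 + 2 * y2\<^sup>2)"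
      unfolding qP C_def distrib_right by simp
    moreover have "S = s\<^sup>2 + y1\<^sup>2 + y2\<^sup>2" by (simp add: S_def)
    moreover have "X\<^sup>2 \<ge> 0" "y2\<^sup>2 \<ge> 0" by simp_all
    ultimately show ?thesis by linarith
  qed
  let ?K = "18 * C\<^sup>2"
  let ?Z = "(1 + G)\<^sup>2 * (1 + A)"
  have S_le: "1 + S \<le> ?K * ?Z"
    by (rule growth_bound[OF q(1) C1 nn(1,2,4) G A_def rel main[folded P_def]])
  have P_le: "1 + P \<le> (1 + G) * (1 + S)"
  proof -
    have "0 \<le> S * (y1\<^sup>2 + y2\<^sup>2)" using nn by simp
    then have "P \<le> G * (1 + S)" using main unfolding P_def by linarith
    then show ?thesis using nn by (simp add: algebra_simps)
  qed
  have w2: "1 + w2\<^sup>2 \<le> 1 + P"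
  proof -
    have "w2\<^sup>2 = y2\<^sup>2 / q\<^sup>2" using q by (simp add: y2_def power_mult_distrib)
    also have "\<dots> \<le> P" unfolding P_def by (intro divide_right_mono) auto
    finally show ?thesis by simp
  qed
  have w1: "1 + w1\<^sup>2 \<le> (2 + 2 * \<gamma> ^ 4) * ((1 + P) * (1 + S))"
  proof -
    \<comment> \<open>This is the coefficient of \<beta> s in q (1 + \<theta>) w1 - X. The limits of
      1 + \<theta> and \<eta> cancel, and the remainder is of order q^2, so dividing by q leaves a
      bounded factor.\<close>
    have \<epsilon>: "1 + \<theta> - \<eta> = \<gamma> * q\<^sup>2 / \<delta>"
      using \<delta> by (simp add: \<theta>_def \<eta>_def field_simps) (simp add: \<delta>_def \<gamma>_def algebra_simps)
    have "q * ((1 + \<theta>) * w1) = X + \<beta> * s * (1 + \<theta> - \<eta>)"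
      by (simp add: X y1_def algebra_simps)
    also have "\<dots> = X + q * (\<beta> * \<gamma> * (q / \<delta>) * s)"
      unfolding \<epsilon> by (simp add: power2_eq_square)
    also have "\<dots> = q * (X / q + \<beta> * \<gamma> * (q / \<delta>) * s)"
      using q by (simp add: distrib_left)
    finally have eq: "(1 + \<theta>) * w1 = X / q + \<beta> * \<gamma> * (q / \<delta>) * s"
      using q by simp
    have "w1\<^sup>2 = 1 * w1\<^sup>2" by simp
    also have "\<dots> \<le> (1 + \<theta>)\<^sup>2 * w1\<^sup>2" using \<theta> by (intro mult_right_mono) (auto simp: one_le_power)
    also have "\<dots> = (X / q + \<beta> * \<gamma> * (q / \<delta>) * s)\<^sup>2" by (simp only: eq power_mult_distrib[symmetric])
    also have "\<dots> \<le> 2 * (X / q)\<^sup>2 + 2 * (\<beta> * \<gamma> * (q / \<delta>) * s)\<^sup>2"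
      by (rule square_add_le)
    also have "(X / q)\<^sup>2 \<le> P" unfolding P_def power_divide by (intro divide_right_mono) auto
    also have "(\<beta> * \<gamma> * (q / \<delta>) * s)\<^sup>2 \<le> \<gamma> ^ 4 * S"
    proof -
      have "q / \<delta> \<le> 1" using \<delta> q pi_gt3 by (simp add: divide_le_eq)
      then have 1: "(q / \<delta>)\<^sup>2 \<le> 1" using q \<delta> by (simp add: power_le_one)
      have "\<beta>\<^sup>2 \<le> \<gamma>" by (simp add: \<gamma>_def)
      also have "\<gamma> \<le> \<gamma>\<^sup>2" using \<gamma> by (simp add: power2_eq_square)
      finally have 2: "\<beta>\<^sup>2 \<le> \<gamma>\<^sup>2" .
      have "(\<beta> * \<gamma> * (q / \<delta>) * s)\<^sup>2 = \<beta>\<^sup>2 * \<gamma>\<^sup>2 * (q / \<delta>)\<^sup>2 * s\<^sup>2" by (simp only: power_mult_distrib)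
      also have "\<dots> \<le> \<gamma>\<^sup>2 * \<gamma>\<^sup>2 * 1 * S"
        using 1 2 by (intro mult_mono) (auto simp: S_def)
      finally show ?thesis by (simp flip: power_add)
    qed
    finally have "1 + w1\<^sup>2 \<le> 1 + (2 * P + 2 * (\<gamma> ^ 4 * S))" by simp
    also have "\<dots> \<le> (2 + 2 * \<gamma> ^ 4) * ((1 + P) * (1 + S))"
    proof -
      have "0 \<le> P * S" "0 \<le> \<gamma> ^ 4 * (1 + P + P * S)" using nn \<gamma> by auto
      then show ?thesis using nn by (simp add: algebra_simps)
    qed
    finally show ?thesis .
  qed
  have s: "1 + s\<^sup>2 \<le> 1 + S" by (simp add: S_def)
  have "(1 + w1\<^sup>2) * ((1 + s\<^sup>2) * (1 + w2\<^sup>2)) \<le> ((2 + 2 * \<gamma> ^ 4) * ((1 + P) * (1 + S))) * ((1 + S) * (1 + P))"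
    using w1 w2 s nn by (intro mult_mono) auto
  also have "\<dots> = (2 + 2 * \<gamma> ^ 4) * ((1 + P)\<^sup>2 * (1 + S)\<^sup>2)"
    by (simp only: power2_eq_square mult_ac)
  also have "\<dots> \<le> (2 + 2 * \<gamma> ^ 4) * (((1 + G) * (1 + S))\<^sup>2 * (1 + S)\<^sup>2)"
    using P_le nn \<gamma> by (intro mult_left_mono mult_right_mono power_mono) auto
  also have "\<dots> = (2 + 2 * \<gamma> ^ 4) * ((1 + G)\<^sup>2 * (1 + S) ^ 4)"
    by (simp add: power_mult_distrib mult.assoc flip: power_add)
  also have "\<dots> \<le> (2 + 2 * \<gamma> ^ 4) * ((1 + G)\<^sup>2 * (?K * ?Z) ^ 4)"
    using S_le nn \<gamma> by (intro mult_left_mono power_mono) auto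
  also have "\<dots> = (2 + 2 * \<gamma> ^ 4) * ?K ^ 4 * ((1 + G) ^ 10 * (1 + A) ^ 4)"
  proof -
    have "(1 + G)\<^sup>2 * (?K * ?Z) ^ 4 = ?K ^ 4 * (((1 + G)\<^sup>2 * (1 + G) ^ (2 * 4)) * (1 + A) ^ 4)"
      by (simp only: power_mult_distrib power_mult[symmetric] mult_ac)
    also have "(1 + G)\<^sup>2 * (1 + G) ^ (2 * 4) = (1 + G) ^ 10"
      unfolding power_add[symmetric] by simp
    finally show ?thesis by (simp only: mult.assoc)
  qed
  finally show ?thesis unfolding A_def .
qed

subsection \<open>The small-time limit\<close>

text \<open>Here \<open>q\<close> stands for the fourth root of the time \<open>h\<close>.\<close>

definition hk_scaled :: "real \<Rightarrow> real \<Rightarrow> real \<Rightarrow> real \<times> real \<times> real \<Rightarrow> complex" where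
  "hk_scaled R \<beta> q = (\<lambda>(w1, s, w2). of_real (q\<^sup>2 * exp (R\<^sup>2 * (1 + \<beta>\<^sup>2) / (4 * q ^ 4))) *
     hk_integrand R (R\<^sup>2 * \<beta>\<^sup>2 / (4 * pi)) (R\<^sup>2 * \<beta> / (2 * pi)) (q ^ 4)
       (Complex (q\<^sup>2 * s) (pi - q\<^sup>2)) (Complex (q ^ 3 * w1 - \<beta> * (q\<^sup>2 * s)) (\<beta> * q\<^sup>2)) (of_real (q ^ 3 * w2)))"

lemma one_plus_power_10_le_exp:
  fixes T :: real
  assumes "T \<ge> 0"
  shows "(1 + T) ^ 10 \<le> 10 ^ 10 * exp T"
proof -
  have "1 + T \<le> 10 * (1 + T / 10)" using assms by simp
  also have "\<dots> \<le> 10 * exp (T / 10)" using exp_ge_add_one_self[of "T / 10"] by argo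
  finally have "(1 + T) ^ 10 \<le> (10 * exp (T / 10)) ^ 10"
    using assms by (intro power_mono) auto
  also have "\<dots> = 10 ^ 10 * exp T"
    unfolding power_mult_distrib by (simp flip: exp_of_nat_mult)
  finally show ?thesis .
qed

text \<open>At the purely imaginary point of the contour this is z + pi^2, hence of order q^2 = sqrt
  h.\<close>

lemma scaled_tube:
  fixes \<beta> q :: real
  shows "pi\<^sup>2 - (pi - q\<^sup>2)\<^sup>2 - (\<beta> * q\<^sup>2)\<^sup>2 = q\<^sup>2 * (2 * pi - (1 + \<beta>\<^sup>2) * q\<^sup>2)"
  by (simp add: power2_eq_square algebra_simps)

text \<open>The gain divided by 4 h is called \<open>T\<close>. Its denominator \<open>N\<close> can
  be as large as (1 + S) (1 + A) times q^4, so what controls the variables is not T itself but G = T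
  (1 + A) / c0; the weights are then at most a constant times (1 + T)^10 (1 + A)^14. The factor exp
  (- T) absorbs the first power, and \<open>norm_sinhc_0_tube\<close> with 14 = 10 + 4 factors
  absorbs the second.\<close>

lemma hk_scaled_dominated:
  assumes R: "R > 0" and \<beta>: "\<beta> > 0"
  obtains C where "\<And>q w1 s w2. 0 < q \<Longrightarrow> q \<le> 1 \<Longrightarrow> (1 + \<beta>\<^sup>2) * q\<^sup>2 \<le> pi \<Longrightarrow>
    norm (hk_scaled R \<beta> q (w1, s, w2)) \<le> C * (inverse (1 + w1\<^sup>2) * (inverse (1 + s\<^sup>2) * inverse (1 + w2\<^sup>2)))"
proof -
  define \<gamma> where "\<gamma> = 1 + \<beta>\<^sup>2"
  \<comment> \<open>The constant left over when \<open>Num_ge\<close> and \<open>N_le\<close> are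
    inserted into \<open>T\<close>, all powers of q having cancelled.\<close>
  define c0 where "c0 = R\<^sup>2 / (16 * pi\<^sup>2)"
  define c1 where "c1 = 1 + 1 / c0"
  \<comment> \<open>K0 q^4 bounds the second-order loss of the phase at the purely imaginary point;
    divided by 4 h = 4 q^4 it is a constant.\<close>
  define K0 where "K0 = R\<^sup>2 * \<beta>\<^sup>2 * (\<gamma> / pi\<^sup>2 + 3 / (2 * pi\<^sup>2))"
  define K where "K = (real (Suc 14) * pi)\<^sup>2"
  define K1 where "K1 = (2 + 2 * \<gamma> ^ 4) * (18 * (1 + 8 * \<gamma>\<^sup>2 / \<beta>\<^sup>2)\<^sup>2) ^ 4"
  define C where "C = exp (K0 / 4) * (2 * pi * K ^ 14) * (K1 * c1 ^ 10 * 10 ^ 10)"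
  have c0: "c0 > 0" using R by (simp add: c0_def)
  have c1: "c1 > 0" "c1 \<ge> 1" "c1 \<ge> 1 / c0" using c0 by (auto simp: c1_def add_pos_pos)
  have \<gamma>: "\<gamma> \<ge> 1" by (simp add: \<gamma>_def)
  have K: "K > 0" by (simp add: K_def)
  have K1: "K1 > 0"
  proof -
    have "0 < 1 + 8 * \<gamma>\<^sup>2 / \<beta>\<^sup>2" using \<beta> by (auto intro!: add_pos_nonneg)
    then show ?thesis unfolding K1_def using \<gamma>
      by (intro mult_pos_pos zero_less_power add_pos_nonneg) auto
  qed
  show ?thesis
  proof (rule that)
    fix q w1 s w2 :: real
    assume q: "0 < q" "q \<le> 1" "(1 + \<beta>\<^sup>2) * q\<^sup>2 \<le> pi"
    define \<delta> where "\<delta> = 2 * pi - \<gamma> * q\<^sup>2"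
    have g: "(1 + \<beta>\<^sup>2) * q\<^sup>2 = \<gamma> * q\<^sup>2" by (simp add: \<gamma>_def)
    have \<delta>: "pi \<le> \<delta>" "\<delta> \<le> 2 * pi" "\<delta> > 0"
    proof -
      have "0 \<le> \<gamma> * q\<^sup>2" using \<gamma> by simp
      then show "pi \<le> \<delta>" "\<delta> \<le> 2 * pi" "\<delta> > 0"
        using q(3) pi_gt_zero unfolding \<delta>_def g by linarith+
    qed
    define y1 y2 where "y1 = q * w1 - \<beta> * s" and "y2 = q * w2"
    define S where "S = s\<^sup>2 + y1\<^sup>2 + y2\<^sup>2"
    define X where "X = y1 + 2 * \<beta> / \<delta> * (s * (pi - q\<^sup>2) + y1 * (\<beta> * q\<^sup>2))"
    define A where "A = q ^ 4 * S"
    define \<tau>1 \<tau>2 where "\<tau>1 = pi - q\<^sup>2" and "\<tau>2 = \<beta> * q\<^sup>2"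
    define t1 t2 where "t1 = R\<^sup>2 * \<beta>\<^sup>2 / (4 * pi)" and "t2 = R\<^sup>2 * \<beta> / (2 * pi)"
    define a b c where "a = q\<^sup>2 * s" and "b = q ^ 3 * w1 - \<beta> * (q\<^sup>2 * s)" and "c = q ^ 3 * w2"
    define m where "m = pi\<^sup>2 - \<tau>1\<^sup>2 - \<tau>2\<^sup>2"
    define z where "z = a * \<tau>1 + b * \<tau>2"
    define Num where "Num = m * c\<^sup>2 + m * (b + 2 * \<tau>2 * z / m)\<^sup>2 + (a\<^sup>2 + b\<^sup>2 + c\<^sup>2) * (\<tau>2\<^sup>2 + b\<^sup>2 + c\<^sup>2)"
    define N where "N = (m + (a\<^sup>2 + b\<^sup>2 + c\<^sup>2))\<^sup>2 + 4 * z\<^sup>2"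
    define T where "T = 2 * R\<^sup>2 * (Num / N) / (4 * q ^ 4)"
    define D where "D = R\<^sup>2 * (1 + \<beta>\<^sup>2)"
    have nn: "S \<ge> 0" "A \<ge> 0" by (auto simp: S_def A_def)
    have m: "m = q\<^sup>2 * \<delta>" unfolding m_def \<tau>1_def \<tau>2_def scaled_tube by (simp add: \<delta>_def \<gamma>_def)
    have m0: "m > 0" using \<delta> q by (simp add: m)
    have tube: "\<tau>1\<^sup>2 + \<tau>2\<^sup>2 < pi\<^sup>2" using m0 by (simp add: m_def)
    have b: "b = q\<^sup>2 * y1" and c: "c = q\<^sup>2 * y2" by (simp_all add: b_def c_def y1_def y2_def power2_eq_square power3_eq_cube algebra_simps)
    have A: "a\<^sup>2 + b\<^sup>2 + c\<^sup>2 = A"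
      unfolding a_def b c A_def S_def by (simp add: power_mult_distrib distrib_left flip: power_mult)
    have zeq: "z = q\<^sup>2 * (s * \<tau>1 + y1 * \<tau>2)" by (simp add: z_def a_def b algebra_simps)
    have bX: "b + 2 * \<tau>2 * z / m = q\<^sup>2 * X"
      unfolding zeq m b X_def \<tau>2_def \<tau>1_def using q \<delta> by (simp add: field_simps)
    define P where "P = (X\<^sup>2 + y2\<^sup>2) / q\<^sup>2"
    have P0: "P \<ge> 0" by (simp add: P_def)
    have Num: "Num = q ^ 8 * (\<delta> * P + S * (\<beta>\<^sup>2 + (y1\<^sup>2 + y2\<^sup>2)))"
    proof -
      have "m * c\<^sup>2 + m * (b + 2 * \<tau>2 * z / m)\<^sup>2 = q ^ 8 * (\<delta> * P)"
      proof -
        have "q ^ 8 * (\<delta> * P) = (q ^ 8 / q\<^sup>2) * (\<delta> * (X\<^sup>2 + y2\<^sup>2))" by (simp add: P_def)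
        also have "q ^ 8 / q\<^sup>2 = q ^ 6" using q by (simp add: power_diff[symmetric])
        finally have 1: "q ^ 8 * (\<delta> * P) = q ^ 6 * (\<delta> * (X\<^sup>2 + y2\<^sup>2))" .
        have "q\<^sup>2 * (q\<^sup>2)\<^sup>2 = q ^ 6" by (simp flip: power_mult power_add)
        moreover have "m * c\<^sup>2 + m * (b + 2 * \<tau>2 * z / m)\<^sup>2 = (q\<^sup>2 * (q\<^sup>2)\<^sup>2) * (\<delta> * (X\<^sup>2 + y2\<^sup>2))"
        proof -
          have "m * c\<^sup>2 + m * (b + 2 * \<tau>2 * z / m)\<^sup>2 = (q\<^sup>2 * \<delta>) * (q\<^sup>2 * y2)\<^sup>2 + (q\<^sup>2 * \<delta>) * (q\<^sup>2 * X)\<^sup>2"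
            by (simp only: bX) (simp only: m c)
          also have "\<dots> = (q\<^sup>2 * (q\<^sup>2)\<^sup>2) * (\<delta> * (X\<^sup>2 + y2\<^sup>2))"
            by (simp only: power_mult_distrib) (simp only: distrib_left add.commute mult_ac)
          finally show ?thesis .
        qed
        ultimately show ?thesis unfolding 1 by simp
      qed
      moreover have "(a\<^sup>2 + b\<^sup>2 + c\<^sup>2) * (\<tau>2\<^sup>2 + b\<^sup>2 + c\<^sup>2) = q ^ 8 * (S * (\<beta>\<^sup>2 + (y1\<^sup>2 + y2\<^sup>2)))"
      proof -
        have "\<tau>2\<^sup>2 + b\<^sup>2 + c\<^sup>2 = q ^ 4 * (\<beta>\<^sup>2 + (y1\<^sup>2 + y2\<^sup>2))"
          unfolding \<tau>2_def b c by (simp add: power_mult_distrib distrib_left flip: power_mult)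
        moreover have "q ^ 8 = q ^ 4 * q ^ 4" by (simp flip: power_add)
        ultimately show ?thesis unfolding A A_def by (simp only: mult_ac)
      qed
      ultimately show ?thesis unfolding Num_def by (simp add: distrib_left)
    qed
    have Num_ge: "q ^ 8 * (P + S * (y1\<^sup>2 + y2\<^sup>2)) \<le> Num"
    proof -
      have "1 * P \<le> \<delta> * P" using \<delta> pi_gt3 P0 by (intro mult_right_mono) auto
      moreover have "S * (y1\<^sup>2 + y2\<^sup>2) \<le> S * (\<beta>\<^sup>2 + (y1\<^sup>2 + y2\<^sup>2))" using nn by (intro mult_left_mono) auto
      ultimately have "P + S * (y1\<^sup>2 + y2\<^sup>2) \<le> \<delta> * P + S * (\<beta>\<^sup>2 + (y1\<^sup>2 + y2\<^sup>2))" by linarith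
      then show ?thesis unfolding Num by (rule mult_left_mono) simp
    qed
    have N_le: "N \<le> 8 * pi\<^sup>2 * q ^ 4 * ((1 + S) * (1 + A))"
    proof -
      have "(m + A)\<^sup>2 \<le> 2 * m\<^sup>2 + 2 * A\<^sup>2" by (rule square_add_le)
      also have "m\<^sup>2 \<le> (q\<^sup>2 * (2 * pi))\<^sup>2"
        unfolding m using \<delta> by (intro power_mono mult_left_mono) auto
      also have "(q\<^sup>2 * (2 * pi))\<^sup>2 = 4 * pi\<^sup>2 * q ^ 4"
        by (simp add: power_mult_distrib flip: power_mult)
      finally have 1: "(m + A)\<^sup>2 \<le> 8 * pi\<^sup>2 * q ^ 4 + 2 * A\<^sup>2" by simp
      have "z\<^sup>2 \<le> (a\<^sup>2 + b\<^sup>2) * (\<tau>1\<^sup>2 + \<tau>2\<^sup>2)"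
        using zero_le_power2[of "a * \<tau>2 - b * \<tau>1"] by (simp add: z_def power2_eq_square algebra_simps)
      also have "\<dots> \<le> A * pi\<^sup>2"
        using tube by (intro mult_mono) (auto simp flip: A)
      finally have 2: "4 * z\<^sup>2 \<le> 4 * pi\<^sup>2 * A" by (simp add: mult.commute)
      have A2: "A\<^sup>2 = q ^ 4 * (S * A)" unfolding A_def by (simp add: power2_eq_square)
      have "2 * (q ^ 4 * (S * A)) \<le> (8 * pi\<^sup>2) * (q ^ 4 * (S * A))"
      proof (rule mult_right_mono)
        have "1 \<le> pi\<^sup>2" using pi_gt3 by (intro one_le_power) auto
        then show "2 \<le> 8 * pi\<^sup>2" by simp
      qed (use nn in auto)
      moreover have "4 * pi\<^sup>2 * A \<le> (8 * pi\<^sup>2) * (q ^ 4 * S)"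
        unfolding A_def[symmetric] using nn by (intro mult_right_mono) auto
      moreover have "(8 * pi\<^sup>2 * q ^ 4) * A \<ge> 0" using nn by simp
      moreover have "8 * pi\<^sup>2 * q ^ 4 * ((1 + S) * (1 + A)) =
          8 * pi\<^sup>2 * q ^ 4 + (8 * pi\<^sup>2) * (q ^ 4 * S) + (8 * pi\<^sup>2 * q ^ 4) * A + (8 * pi\<^sup>2) * (q ^ 4 * (S * A))"
        by (simp add: algebra_simps)
      ultimately show ?thesis using 1 2 unfolding N_def A A2 by linarith
    qed
    have N0: "N > 0" unfolding N_def A using m0 nn by (intro add_pos_nonneg zero_less_power) auto
    have Num0: "Num \<ge> 0"
      by (rule order.trans[OF _ Num_ge]) (use P0 nn in auto)
    have T0: "T \<ge> 0" unfolding T_def using Num0 N0 by auto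
    define G where "G = T * (1 + A) / c0"
    have G0: "G \<ge> 0" using T0 nn c0 by (simp add: G_def)
    have main: "P + S * (y1\<^sup>2 + y2\<^sup>2) \<le> G * (1 + S)"
    proof -
      let ?V = "P + S * (y1\<^sup>2 + y2\<^sup>2)"
      let ?W = "(1 + S) * (1 + A)"
      have W: "?W > 0" using nn by (intro mult_pos_pos) auto
      have V: "?V \<ge> 0" using P0 nn by simp
      have "c0 * ?V / ?W = 2 * R\<^sup>2 * (q ^ 8 * ?V / (8 * pi\<^sup>2 * q ^ 4 * ?W)) / (4 * q ^ 4)"
      proof -
        have "q ^ 8 = q ^ 4 * q ^ 4" by (simp flip: power_add)
        then have "c0 * v / w = 2 * R\<^sup>2 * (q ^ 8 * v / (8 * pi\<^sup>2 * q ^ 4 * w)) / (4 * q ^ 4)" if "w > 0" for v w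
          using q that unfolding c0_def by (simp add: field_simps)
        then show ?thesis using W .
      qed
      also have "\<dots> \<le> T"
        unfolding T_def using Num_ge N_le N0 V q Num0
        by (intro divide_right_mono mult_left_mono frac_le) auto
      finally have "c0 * ?V \<le> T * ?W" using W by (simp add: divide_le_eq)
      then show ?thesis using c0 by (simp add: G_def field_simps)
    qed
    have weights: "(1 + w1\<^sup>2) * ((1 + s\<^sup>2) * (1 + w2\<^sup>2)) \<le> K1 * ((1 + G) ^ 10 * (1 + A) ^ 4)"
      unfolding K1_def A_def S_def y1_def y2_def \<gamma>_def
      by (rule scaled_weights_bound)
        (use q \<beta> G0 main in \<open>auto simp: P_def S_def y1_def y2_def X_def \<delta>_def \<gamma>_def\<close>)
    let ?w = "(1 + w1\<^sup>2) * ((1 + s\<^sup>2) * (1 + w2\<^sup>2))"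
    have w0: "?w > 0" by (intro mult_pos_pos) (auto simp: add_pos_nonneg)
    have G_le: "1 + G \<le> c1 * ((1 + T) * (1 + A))"
    proof -
      have "1 + G \<le> c1 * 1 + c1 * (T * (1 + A))"
      proof (rule add_mono)
        have "(1 / c0) * (T * (1 + A)) \<le> c1 * (T * (1 + A))"
          using c1 T0 nn by (intro mult_right_mono) auto
        then show "G \<le> c1 * (T * (1 + A))" by (simp add: G_def)
      qed (use c1 in auto)
      also have "\<dots> \<le> c1 * ((1 + T) * (1 + A))"
        using c1 nn by (simp add: algebra_simps)
      finally show ?thesis .
    qed
    have "?w \<le> K1 * ((c1 * ((1 + T) * (1 + A))) ^ 10 * (1 + A) ^ 4)"
      by (rule order.trans[OF weights]) (use G_le G0 K1 nn in \<open>intro mult_left_mono mult_right_mono power_mono; simp\<close>)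
    also have "\<dots> = K1 * c1 ^ 10 * ((1 + T) ^ 10 * (1 + A) ^ 14)"
    proof -
      have "(1 + A) ^ 14 = (1 + A) ^ 10 * (1 + A) ^ 4" by (simp flip: power_add)
      then show ?thesis by (simp only: power_mult_distrib mult_ac)
    qed
    also have "\<dots> \<le> K1 * c1 ^ 10 * ((10 ^ 10 * exp T) * (1 + A) ^ 14)"
      using one_plus_power_10_le_exp[OF T0] K1 c1 nn by (intro mult_left_mono mult_right_mono) auto
    finally have w_le: "?w \<le> (K1 * c1 ^ 10 * 10 ^ 10) * (exp T * (1 + A) ^ 14)"
      by (simp only: mult.assoc)
    have phase: "D - K0 * q ^ 4 + 2 * R\<^sup>2 * (Num / N) \<le> Re (hk_phase R t1 t2 (Complex a \<tau>1) (Complex b \<tau>2) (of_real c))"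
    proof -
      have "D - K0 * q ^ 4 \<le> R\<^sup>2 * (1 - 2 * \<tau>2\<^sup>2 / m - \<tau>2\<^sup>2 * (3 / (2 * pi\<^sup>2))) + 4 * (t1 * \<tau>1 + t2 * \<tau>2)"
      proof -
        have q4: "(q\<^sup>2)\<^sup>2 = q ^ 4" by (simp flip: power_mult)
        have "4 * (t1 * \<tau>1 + t2 * \<tau>2) = R\<^sup>2 * \<beta>\<^sup>2 * (1 + q\<^sup>2 / pi)"
          unfolding t1_def t2_def \<tau>1_def \<tau>2_def by (simp add: power2_eq_square field_simps)
        moreover have "2 * \<tau>2\<^sup>2 / m = \<beta>\<^sup>2 * (2 * q\<^sup>2 / \<delta>)"
          unfolding \<tau>2_def m using q by (simp add: power2_eq_square)
        moreover have "\<tau>2\<^sup>2 = \<beta>\<^sup>2 * q ^ 4" unfolding \<tau>2_def power_mult_distrib q4 ..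
        ultimately have "R\<^sup>2 * (1 - 2 * \<tau>2\<^sup>2 / m - \<tau>2\<^sup>2 * (3 / (2 * pi\<^sup>2))) + 4 * (t1 * \<tau>1 + t2 * \<tau>2) =
           R\<^sup>2 * (1 - \<beta>\<^sup>2 * (2 * q\<^sup>2 / \<delta>) - \<beta>\<^sup>2 * q ^ 4 * (3 / (2 * pi\<^sup>2))) + R\<^sup>2 * \<beta>\<^sup>2 * (1 + q\<^sup>2 / pi)"
          by (simp only:)
        also have "\<dots> = D + R\<^sup>2 * \<beta>\<^sup>2 * ((q\<^sup>2 / pi - 2 * q\<^sup>2 / \<delta>) - q ^ 4 * (3 / (2 * pi\<^sup>2)))"
          by (simp add: D_def algebra_simps)
        \<comment> \<open>The first-order losses from the pole and from the linear term cancel; this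
          is the purpose of \<open>\<tau>2 = \<beta> * q\<^sup>2\<close>.\<close>
        also have "q\<^sup>2 / pi - 2 * q\<^sup>2 / \<delta> = - (\<gamma> * q ^ 4 / (pi * \<delta>))"
        proof -
          have "q\<^sup>2 / pi - 2 * q\<^sup>2 / \<delta> = q\<^sup>2 * (\<delta> - 2 * pi) / (pi * \<delta>)"
            using \<delta> by (simp add: field_simps)
          also have "q\<^sup>2 * (\<delta> - 2 * pi) = - (\<gamma> * q ^ 4)"
            unfolding \<delta>_def q4[symmetric] by (simp add: power2_eq_square)
          finally show ?thesis by simp
        qed
        finally have eq: "R\<^sup>2 * (1 - 2 * \<tau>2\<^sup>2 / m - \<tau>2\<^sup>2 * (3 / (2 * pi\<^sup>2))) + 4 * (t1 * \<tau>1 + t2 * \<tau>2) =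
          D + R\<^sup>2 * \<beta>\<^sup>2 * (- (\<gamma> * q ^ 4 / (pi * \<delta>)) - q ^ 4 * (3 / (2 * pi\<^sup>2)))" .
        have "\<gamma> * q ^ 4 / (pi * \<delta>) \<le> \<gamma> * q ^ 4 / (pi * pi)"
          using \<delta> \<gamma> by (intro divide_left_mono mult_left_mono) auto
        then have "- (q ^ 4 * (\<gamma> / pi\<^sup>2 + 3 / (2 * pi\<^sup>2))) \<le> - (\<gamma> * q ^ 4 / (pi * \<delta>)) - q ^ 4 * (3 / (2 * pi\<^sup>2))"
          by (simp add: distrib_left power2_eq_square mult.commute)
        then have "R\<^sup>2 * \<beta>\<^sup>2 * (- (q ^ 4 * (\<gamma> / pi\<^sup>2 + 3 / (2 * pi\<^sup>2)))) \<le> R\<^sup>2 * \<beta>\<^sup>2 * (- (\<gamma> * q ^ 4 / (pi * \<delta>)) - q ^ 4 * (3 / (2 * pi\<^sup>2)))"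
          by (intro mult_left_mono) auto
        then show ?thesis unfolding eq K0_def by (simp add: mult_ac)
      qed
      then show ?thesis
        using Re_hk_phase_tube[OF tube, where R = R and a = a and b = b and c = c and ?t1.0 = t1 and ?t2.0 = t2] unfolding Num_def N_def m_def z_def by linarith
    qed
    let ?d = "(m + A) / pi\<^sup>2 * ((1 / 2) * ((1 + A) / K) ^ 14)"
    have d: "?d \<le> norm (sinhc 0 (sq3 (Complex a \<tau>1) (Complex b \<tau>2) (of_real c)))"
      using norm_sinhc_0_tube[OF tube, of a b c 14] unfolding A K_def m_def by simp
    have d0: "?d > 0" using m0 nn K by (intro mult_pos_pos divide_pos_pos zero_less_power) auto
    have "norm (hk_integrand R t1 t2 (q ^ 4) (Complex a \<tau>1) (Complex b \<tau>2) (of_real c)) \<le>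
      exp (- (D - K0 * q ^ 4 + 2 * R\<^sup>2 * (Num / N)) / (4 * q ^ 4)) / ?d"
      by (rule norm_hk_integrand_le[OF _ phase d0 d]) (use q in simp)
    also have "- (D - K0 * q ^ 4 + 2 * R\<^sup>2 * (Num / N)) / (4 * q ^ 4) = - (D / (4 * q ^ 4)) + (K0 / 4 + - T)"
    proof -
      have "K0 * q ^ 4 / (4 * q ^ 4) = K0 / 4" using q by simp
      then show ?thesis unfolding T_def by (simp add: diff_divide_distrib add_divide_distrib)
    qed
    also have "exp (- (D / (4 * q ^ 4)) + (K0 / 4 + - T)) = exp (- (D / (4 * q ^ 4))) * (exp (K0 / 4) * exp (- T))"
      by (simp only: exp_add)
    finally have bound: "norm (hk_integrand R t1 t2 (q ^ 4) (Complex a \<tau>1) (Complex b \<tau>2) (of_real c)) \<le>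
      exp (- (D / (4 * q ^ 4))) * (exp (K0 / 4) * exp (- T)) / ?d" .
    have "norm (hk_scaled R \<beta> q (w1, s, w2)) = q\<^sup>2 * exp (D / (4 * q ^ 4)) *
        norm (hk_integrand R t1 t2 (q ^ 4) (Complex a \<tau>1) (Complex b \<tau>2) (of_real c))"
      unfolding hk_scaled_def prod.case D_def t1_def t2_def a_def b_def c_def \<tau>1_def \<tau>2_def norm_mult norm_of_real
      by simp
    also have "\<dots> \<le> q\<^sup>2 * exp (D / (4 * q ^ 4)) * (exp (- (D / (4 * q ^ 4))) * (exp (K0 / 4) * exp (- T)) / ?d)"
      using bound by (rule mult_left_mono) simp
    also have "\<dots> = (exp (D / (4 * q ^ 4)) * exp (- (D / (4 * q ^ 4)))) * ((exp (K0 / 4) * exp (- T)) * (q\<^sup>2 / ?d))"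
      by simp
    also have "exp (D / (4 * q ^ 4)) * exp (- (D / (4 * q ^ 4))) = 1"
      by (simp flip: exp_add)
    also have "1 * ((exp (K0 / 4) * exp (- T)) * (q\<^sup>2 / ?d)) \<le> exp (K0 / 4) * exp (- T) * (2 * pi * K ^ 14 / (1 + A) ^ 14)"
    proof -
      \<comment> \<open>The normalising \<open>q\<^sup>2\<close> of \<open>hk_scaled\<close>
        compensates the small factor of \<open>sinhc 0\<close>, for which m \<ge> pi q^2.\<close>
      have "q\<^sup>2 / ?d \<le> q\<^sup>2 / ((q\<^sup>2 * pi) / pi\<^sup>2 * ((1 / 2) * ((1 + A) / K) ^ 14))"
      proof (rule divide_left_mono)
        have "q\<^sup>2 * pi \<le> q\<^sup>2 * \<delta>" using \<delta> by (intro mult_left_mono) auto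
        then have "q\<^sup>2 * pi \<le> m + A" unfolding m using nn by linarith
        then show "(q\<^sup>2 * pi) / pi\<^sup>2 * ((1 / 2) * ((1 + A) / K) ^ 14) \<le> ?d"
          using nn K by (intro mult_right_mono divide_right_mono) auto
        have "m + A > 0" using m0 nn by linarith
        then show "0 < ?d * ((q\<^sup>2 * pi) / pi\<^sup>2 * ((1 / 2) * ((1 + A) / K) ^ 14))"
          using d0 q nn K by (intro mult_pos_pos divide_pos_pos zero_less_power) auto
      qed simp
      also have "\<dots> = 2 * pi * K ^ 14 / (1 + A) ^ 14"
        using q nn K by (simp add: power_divide power2_eq_square)
      finally have "q\<^sup>2 / ?d \<le> 2 * pi * K ^ 14 / (1 + A) ^ 14" .
      then show ?thesis unfolding mult_1_left by (rule mult_left_mono) simp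
    qed
    also have "\<dots> \<le> C * inverse ?w"
    proof -
      have "exp (K0 / 4) * exp (- T) * (2 * pi * K ^ 14 / (1 + A) ^ 14) = exp (K0 / 4) * (2 * pi * K ^ 14) * (1 / (exp T * (1 + A) ^ 14))"
        by (simp add: exp_minus field_simps)
      also have "\<dots> \<le> exp (K0 / 4) * (2 * pi * K ^ 14) * ((K1 * c1 ^ 10 * 10 ^ 10) * inverse ?w)"
      proof (rule mult_left_mono)
        have "0 < exp T * (1 + A) ^ 14" using nn by (intro mult_pos_pos zero_less_power) auto
        then show "1 / (exp T * (1 + A) ^ 14) \<le> (K1 * c1 ^ 10 * 10 ^ 10) * inverse ?w"
          using w_le w0 by (simp add: divide_le_eq le_divide_eq inverse_eq_divide mult.commute)
      qed (use K in auto)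
      finally show ?thesis unfolding C_def by (simp only: mult.assoc)
    qed
    also have "inverse ?w = inverse (1 + w1\<^sup>2) * (inverse (1 + s\<^sup>2) * inverse (1 + w2\<^sup>2))"
      by simp
    finally show "norm (hk_scaled R \<beta> q (w1, s, w2)) \<le> C * (inverse (1 + w1\<^sup>2) * (inverse (1 + s\<^sup>2) * inverse (1 + w2\<^sup>2)))" .
  qed
qed

section \<open>The limiting integrand and its integral\<close>

lemma isCont_sinhc: "isCont (sinhc n) z"
  using holomorphic_on_imp_continuous_on[OF sinhc_holomorphic[of n UNIV]] by (simp add: continuous_on_eq_continuous_at)

lemma isCont_cothc:
  assumes "sinhc n z \<noteq> 0"
  shows "isCont (cothc n) z"
proof -
  have "open {z. sinhc n z \<noteq> 0}"
    by (intro open_Collect_neq holomorphic_on_imp_continuous_on sinhc_holomorphic continuous_on_const)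
  then show ?thesis
    using holomorphic_on_imp_continuous_on[OF cothc_holomorphic[of n]] assms
    by (simp add: continuous_on_eq_continuous_at)
qed

text \<open>Here 1 + i s is the rescaled complex variable along the degenerate direction. The factor
  pi / (1 + i s) comes from the zero of \<open>sinhc 0\<close> at the critical point and the
  Gaussian in (w1, w2) from the pole of \<open>cothc 0\<close> there. In the last exponent, 4 +
  \<beta>^2 collects 1 + \<beta>^2 from the second-order term of z + pi^2 and 3 from the farther
  poles.\<close>

definition hk_limit :: "real \<Rightarrow> real \<Rightarrow> real \<times> real \<times> real \<Rightarrow> complex" where
  "hk_limit R \<beta> = (\<lambda>(w1, s, w2). of_real pi / (1 + \<i> * of_real s) *
     exp (- (of_real (R\<^sup>2 / (4 * pi)) / (1 + \<i> * of_real s) * of_real (w1\<^sup>2 + w2\<^sup>2))) *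
     exp (of_real (R\<^sup>2 * \<beta>\<^sup>2 * (4 + \<beta>\<^sup>2) / (2 * pi\<^sup>2) / 4) * (1 + \<i> * of_real s)\<^sup>2))"

context
  fixes R \<beta> q w1 s w2 :: real
  assumes q: "q > 0" "(1 + \<beta>\<^sup>2) * q\<^sup>2 \<le> pi"
begin

lemma scaled_tube_less: "(pi - q\<^sup>2)\<^sup>2 + (\<beta> * q\<^sup>2)\<^sup>2 < pi\<^sup>2"
proof -
  have "(1 + \<beta>\<^sup>2) * q\<^sup>2 < 2 * pi" using q pi_gt_zero by linarith
  then have "0 < q\<^sup>2 * (2 * pi - (1 + \<beta>\<^sup>2) * q\<^sup>2)" using q by simp
  then show ?thesis using scaled_tube[of q \<beta>] by linarith
qed

text \<open>An exact identity on the contour \<lambda> = (i (pi - q^2 U), i \<beta> q^2 U + q^3 w1,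
  q^3 w2): the square of the last two components is q^4 \<kappa>, and z + pi^2 = q^2 \<mu>. The
  terms of order q^2 in the phase cancel and all others beyond the critical value carry q^4 = h, so
  no negative power of q survives and q can be sent to 0.\<close>

lemma hk_scaled_expansion:
  defines "U \<equiv> 1 + \<i> * of_real s" and "W \<equiv> complex_of_real (w1\<^sup>2 + w2\<^sup>2)"
  defines "\<nu> \<equiv> - of_real (1 + \<beta>\<^sup>2) * U\<^sup>2 + 2 * \<i> * of_real (\<beta> * q * w1) * U + of_real (q\<^sup>2) * W"
  defines "\<kappa> \<equiv> - of_real (\<beta>\<^sup>2) * U\<^sup>2 + 2 * \<i> * of_real (\<beta> * q * w1) * U + of_real (q\<^sup>2) * W"
  defines "\<mu> \<equiv> 2 * of_real pi * U + of_real (q\<^sup>2) * \<nu>"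
  defines "z \<equiv> - of_real (pi\<^sup>2) + of_real (q\<^sup>2) * \<mu>"
  shows "hk_scaled R \<beta> q (w1, s, w2) =
     exp (- (of_real (R\<^sup>2 / 4) * ((2 * W + (of_real (\<beta>\<^sup>2 / pi) * U - 2 * \<i> * of_real (\<beta> * q * w1 / pi)) * \<nu>) / \<mu> + \<kappa> * cothc 1 z))) *
     (of_real (pi\<^sup>2) / (\<mu> * sinhc 1 z))"
proof -
  let ?l1 = "Complex (q\<^sup>2 * s) (pi - q\<^sup>2)" and ?l2 = "Complex (q ^ 3 * w1 - \<beta> * (q\<^sup>2 * s)) (\<beta> * q\<^sup>2)" and ?l3 = "complex_of_real (q ^ 3 * w2)"
  let ?q = "complex_of_real q"
  have q0: "?q \<noteq> 0" using q by simp
  have l1: "?l1 = \<i> * (of_real pi - ?q\<^sup>2 * U)" and l2: "?l2 = \<i> * of_real \<beta> * ?q\<^sup>2 * U + ?q ^ 3 * of_real w1"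
    and l3: "?l3 = ?q ^ 3 * of_real w2"
    by (simp_all add: U_def complex_eq_iff flip: of_real_power)
  have i2: "\<i> * (\<i> * x) = - x" for x by (simp add: mult.assoc[symmetric])
  have Q: "?l2\<^sup>2 + ?l3\<^sup>2 = ?q ^ 4 * \<kappa>"
    unfolding l2 l3 \<kappa>_def W_def by (simp add: power2_eq_square power3_eq_cube power4_eq_xxxx algebra_simps i2)
  have z: "sq3 ?l1 ?l2 ?l3 = z"
  proof -
    have "sq3 ?l1 ?l2 ?l3 = ?l1\<^sup>2 + ?q ^ 4 * \<kappa>" by (simp only: sq3_def Q[symmetric] add.assoc)
    also have "\<dots> = z"
      unfolding l1 z_def \<mu>_def \<nu>_def \<kappa>_def W_def by (simp add: power2_eq_square power4_eq_xxxx algebra_simps i2)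
    finally show ?thesis .
  qed
  have nz: "sinhc 0 z \<noteq> 0" unfolding z[symmetric] by (rule sinhc_0_tube_nz[OF scaled_tube_less])
  have zpi: "1 + z / of_real (pi\<^sup>2) = ?q\<^sup>2 * \<mu> / of_real (pi\<^sup>2)"
    by (simp add: z_def field_simps)
  have S: "sinhc 0 z = ?q\<^sup>2 * \<mu> / of_real (pi\<^sup>2) * sinhc 1 z"
    unfolding sinhc_0_split zpi ..
  have \<mu>: "\<mu> \<noteq> 0" using nz unfolding S by auto
  have c: "cothc 0 z = 2 / (?q\<^sup>2 * \<mu>) + cothc 1 z"
    unfolding cothc_0_split[OF nz] by (simp add: z_def)
  define E where "E = (2 * W + (of_real (\<beta>\<^sup>2 / pi) * U - 2 * \<i> * of_real (\<beta> * q * w1 / pi)) * \<nu>) / \<mu>"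
  define V where "V = of_real (\<beta>\<^sup>2 / pi) * U - 2 * \<i> * of_real (\<beta> * q * w1 / pi)"
  \<comment> \<open>Division of \<open>2 * \<kappa>\<close> by \<open>\<mu>\<close> with a remainder
    of order q^2. The quotient \<open>- V\<close> is cancelled by the linear term of the phase; this
    is where the particular values of t1 and t2 enter.\<close>
  have "2 * \<kappa> + V * \<mu> = ?q\<^sup>2 * (2 * W + V * \<nu>)"
    unfolding \<mu>_def \<kappa>_def V_def by (simp add: power2_eq_square field_simps)
  also have "\<dots> = ?q\<^sup>2 * (E * \<mu>)" using \<mu> by (simp add: E_def V_def)
  finally have "2 * \<kappa> = (?q\<^sup>2 * E - V) * \<mu>" by (simp add: algebra_simps)
  then have key: "2 * \<kappa> / \<mu> = ?q\<^sup>2 * E - V"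
    using \<mu> by (simp add: divide_eq_eq)
  let ?D = "complex_of_real (R\<^sup>2 * (1 + \<beta>\<^sup>2))"
  let ?ph = "hk_phase R (R\<^sup>2 * \<beta>\<^sup>2 / (4 * pi)) (R\<^sup>2 * \<beta> / (2 * pi)) ?l1 ?l2 ?l3"
  have "?ph = of_real (R\<^sup>2) * (1 + (?q ^ 4 * \<kappa>) * (2 / (?q\<^sup>2 * \<mu>) + cothc 1 z)) -
      4 * \<i> * (of_real (R\<^sup>2 * \<beta>\<^sup>2 / (4 * pi)) * ?l1 + of_real (R\<^sup>2 * \<beta> / (2 * pi)) * ?l2)"
    unfolding hk_phase_def z Q c ..
  also have "4 * \<i> * (of_real (R\<^sup>2 * \<beta>\<^sup>2 / (4 * pi)) * ?l1 + of_real (R\<^sup>2 * \<beta> / (2 * pi)) * ?l2) =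
      - of_real (R\<^sup>2) * (of_real (\<beta>\<^sup>2) + ?q\<^sup>2 * V)"
    unfolding l1 l2 V_def by (simp add: field_simps i2 power2_eq_square power3_eq_cube)
  also have "?q ^ 4 * \<kappa> * (2 / (?q\<^sup>2 * \<mu>) + cothc 1 z) = ?q\<^sup>2 * (2 * \<kappa> / \<mu>) + ?q ^ 4 * (\<kappa> * cothc 1 z)"
    using q0 by (simp add: field_simps power2_eq_square power4_eq_xxxx)
  finally have ph: "?ph = ?D + ?q ^ 4 * (of_real (R\<^sup>2) * (E + \<kappa> * cothc 1 z))"
    unfolding key by (simp add: algebra_simps power2_eq_square power4_eq_xxxx)
  have "complex_of_real (exp (R\<^sup>2 * (1 + \<beta>\<^sup>2) / (4 * q ^ 4))) * exp (- ?ph / of_real (4 * q ^ 4)) =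
      exp (?D / (4 * ?q ^ 4) + - ?ph / (4 * ?q ^ 4))"
    unfolding exp_add by (simp flip: exp_of_real)
  also have "?D / (4 * ?q ^ 4) + - ?ph / (4 * ?q ^ 4) = - (of_real (R\<^sup>2 / 4) * (E + \<kappa> * cothc 1 z))"
    unfolding ph using q0 by (simp add: field_simps)
  finally have ex: "complex_of_real (exp (R\<^sup>2 * (1 + \<beta>\<^sup>2) / (4 * q ^ 4))) * exp (- ?ph / of_real (4 * q ^ 4)) =
     exp (- (of_real (R\<^sup>2 / 4) * (E + \<kappa> * cothc 1 z)))" .
  have "hk_scaled R \<beta> q (w1, s, w2) =
     (complex_of_real (exp (R\<^sup>2 * (1 + \<beta>\<^sup>2) / (4 * q ^ 4))) * exp (- ?ph / of_real (4 * q ^ 4))) * (?q\<^sup>2 / sinhc 0 z)"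
    unfolding hk_scaled_def hk_integrand_def prod.case z by simp
  also have "?q\<^sup>2 / sinhc 0 z = of_real (pi\<^sup>2) / (\<mu> * sinhc 1 z)"
    unfolding S using q0 by (simp add: field_simps)
  finally show ?thesis unfolding ex E_def .
qed

lemma continuous_on_hk_scaled: "continuous_on UNIV (hk_scaled R \<beta> q)"
proof -
  have "continuous_on UNIV (\<lambda>p. hk_integrand R (R\<^sup>2 * \<beta>\<^sup>2 / (4 * pi)) (R\<^sup>2 * \<beta> / (2 * pi)) (q ^ 4)
       (Complex (q\<^sup>2 * fst (snd p)) (pi - q\<^sup>2)) (Complex (q ^ 3 * fst p - \<beta> * (q\<^sup>2 * fst (snd p))) (\<beta> * q\<^sup>2)) (of_real (q ^ 3 * snd (snd p))))"
  proof (rule continuous_on_hk_integrand)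
    show "sinhc 0 (sq3 (Complex (q\<^sup>2 * fst (snd p)) (pi - q\<^sup>2)) (Complex (q ^ 3 * fst p - \<beta> * (q\<^sup>2 * fst (snd p))) (\<beta> * q\<^sup>2))
       (of_real (q ^ 3 * snd (snd p)))) \<noteq> 0" for p
      by (rule sinhc_0_tube_nz[OF scaled_tube_less])
  qed (use q in \<open>auto simp: Complex_eq intro!: continuous_intros\<close>)
  then show ?thesis
    unfolding hk_scaled_def case_prod_unfold by (intro continuous_on_mult continuous_on_const)
qed

end

lemma hk_scaled_tendsto: "((\<lambda>q. hk_scaled R \<beta> q (w1, s, w2)) \<longlongrightarrow> hk_limit R \<beta> (w1, s, w2)) (at_right 0)"
proof -
  define U W where "U = 1 + \<i> * of_real s" and "W = complex_of_real (w1\<^sup>2 + w2\<^sup>2)"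
  define \<nu> where "\<nu> = (\<lambda>q. - of_real (1 + \<beta>\<^sup>2) * U\<^sup>2 + 2 * \<i> * of_real (\<beta> * q * w1) * U + of_real (q\<^sup>2) * W)"
  define \<kappa> where "\<kappa> = (\<lambda>q. - of_real (\<beta>\<^sup>2) * U\<^sup>2 + 2 * \<i> * of_real (\<beta> * q * w1) * U + of_real (q\<^sup>2) * W)"
  define \<mu> where "\<mu> = (\<lambda>q. 2 * of_real pi * U + of_real (q\<^sup>2) * \<nu> q)"
  define z where "z = (\<lambda>q. - of_real (pi\<^sup>2) + of_real (q\<^sup>2) * \<mu> q)"
  define g where "g = (\<lambda>q. exp (- (of_real (R\<^sup>2 / 4) * ((2 * W + (of_real (\<beta>\<^sup>2 / pi) * U - 2 * \<i> * of_real (\<beta> * q * w1 / pi)) * \<nu> q) / \<mu> q + \<kappa> q * cothc 1 (z q)))) *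
     (of_real (pi\<^sup>2) / (\<mu> q * sinhc 1 (z q))))"
  have U: "U \<noteq> 0" by (auto simp: U_def complex_eq_iff)
  have id: "((\<lambda>q::real. q) \<longlongrightarrow> 0) (at_right 0)" by (rule tendsto_ident_at)
  have \<nu>: "(\<nu> \<longlongrightarrow> - of_real (1 + \<beta>\<^sup>2) * U\<^sup>2 + 2 * \<i> * of_real (\<beta> * 0 * w1) * U + of_real (0\<^sup>2) * W) (at_right 0)"
    unfolding \<nu>_def by (intro tendsto_intros id)
  have \<kappa>: "(\<kappa> \<longlongrightarrow> - of_real (\<beta>\<^sup>2) * U\<^sup>2 + 2 * \<i> * of_real (\<beta> * 0 * w1) * U + of_real (0\<^sup>2) * W) (at_right 0)"
    unfolding \<kappa>_def by (intro tendsto_intros id)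
  have "(\<mu> \<longlongrightarrow> 2 * of_real pi * U + of_real (0\<^sup>2) * (- of_real (1 + \<beta>\<^sup>2) * U\<^sup>2 + 2 * \<i> * of_real (\<beta> * 0 * w1) * U + of_real (0\<^sup>2) * W)) (at_right 0)"
    unfolding \<mu>_def by (intro tendsto_intros id \<nu>)
  then have \<mu>: "(\<mu> \<longlongrightarrow> 2 * of_real pi * U) (at_right 0)" by simp
  have "(z \<longlongrightarrow> - of_real (pi\<^sup>2) + of_real (0\<^sup>2) * (2 * of_real pi * U)) (at_right 0)"
    unfolding z_def by (intro tendsto_intros id \<mu>)
  then have z: "(z \<longlongrightarrow> - of_real (pi\<^sup>2)) (at_right 0)" by simp
  have s1: "sinhc 1 (- of_real (pi\<^sup>2)) \<noteq> 0" by (simp only: sinhc_1_value) simp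
  have S: "((\<lambda>q. sinhc 1 (z q)) \<longlongrightarrow> 1 / 2) (at_right 0)"
    using isCont_tendsto_compose[OF isCont_sinhc z, of 1] by (simp only: sinhc_1_value)
  have c: "((\<lambda>q. cothc 1 (z q)) \<longlongrightarrow> of_real (3 / (2 * pi\<^sup>2))) (at_right 0)"
    using isCont_tendsto_compose[OF isCont_cothc[OF s1] z] by (simp only: cothc_1_value)
  have "(g \<longlongrightarrow> exp (- (of_real (R\<^sup>2 / 4) * ((2 * W + (of_real (\<beta>\<^sup>2 / pi) * U - 2 * \<i> * of_real (\<beta> * 0 * w1 / pi)) *
       (- of_real (1 + \<beta>\<^sup>2) * U\<^sup>2 + 2 * \<i> * of_real (\<beta> * 0 * w1) * U + of_real (0\<^sup>2) * W)) / (2 * of_real pi * U) +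
       (- of_real (\<beta>\<^sup>2) * U\<^sup>2 + 2 * \<i> * of_real (\<beta> * 0 * w1) * U + of_real (0\<^sup>2) * W) * of_real (3 / (2 * pi\<^sup>2))))) *
     (of_real (pi\<^sup>2) / ((2 * of_real pi * U) * (1 / 2)))) (at_right 0)" (is "(g \<longlongrightarrow> ?L) _")
    unfolding g_def by (intro tendsto_intros id \<nu> \<kappa> \<mu> S c) (use U in auto)
  also have "?L = hk_limit R \<beta> (w1, s, w2)"
  proof -
    have e: "- (of_real (R\<^sup>2 / 4) * ((2 * W + (of_real (\<beta>\<^sup>2 / pi) * U - 2 * \<i> * of_real (\<beta> * 0 * w1 / pi)) *
       (- of_real (1 + \<beta>\<^sup>2) * U\<^sup>2 + 2 * \<i> * of_real (\<beta> * 0 * w1) * U + of_real (0\<^sup>2) * W)) / (2 * of_real pi * U) +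
       (- of_real (\<beta>\<^sup>2) * U\<^sup>2 + 2 * \<i> * of_real (\<beta> * 0 * w1) * U + of_real (0\<^sup>2) * W) * of_real (3 / (2 * pi\<^sup>2)))) =
      - (of_real (R\<^sup>2 / (4 * pi)) / U * W) + of_real (R\<^sup>2 * \<beta>\<^sup>2 * (4 + \<beta>\<^sup>2) / (2 * pi\<^sup>2) / 4) * U\<^sup>2"
      using U by (simp add: field_simps power2_eq_square)
    have a: "of_real (pi\<^sup>2) / ((2 * of_real pi * U) * (1 / 2)) = of_real pi / U"
      using U by (simp add: power2_eq_square)
    have "?L = exp (- (of_real (R\<^sup>2 / (4 * pi)) / U * W)) * exp (of_real (R\<^sup>2 * \<beta>\<^sup>2 * (4 + \<beta>\<^sup>2) / (2 * pi\<^sup>2) / 4) * U\<^sup>2) * (of_real pi / U)"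
      by (simp only: e a exp_add)
    then show ?thesis
      unfolding hk_limit_def prod.case U_def W_def by (simp only: mult_ac)
  qed
  finally have g: "(g \<longlongrightarrow> hk_limit R \<beta> (w1, s, w2)) (at_right 0)" .
  have "\<forall>\<^sub>F q in at_right 0. (1 + \<beta>\<^sup>2) * q\<^sup>2 < pi"
  proof (rule order_tendstoD(2))
    have "((\<lambda>q. (1 + \<beta>\<^sup>2) * q\<^sup>2) \<longlongrightarrow> (1 + \<beta>\<^sup>2) * 0\<^sup>2) (at_right 0)"
      by (intro tendsto_intros id)
    then show "((\<lambda>q. (1 + \<beta>\<^sup>2) * q\<^sup>2) \<longlongrightarrow> 0) (at_right 0)" by simp
  qed simp
  then have "\<forall>\<^sub>F q in at_right 0. g q = hk_scaled R \<beta> q (w1, s, w2)"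
    using eventually_at_right_less[of "0::real"]
  proof eventually_elim
    case (elim q)
    then show ?case
      unfolding g_def \<nu>_def \<kappa>_def \<mu>_def z_def U_def W_def
      by (intro hk_scaled_expansion[symmetric]) auto
  qed
  with g show ?thesis by (rule Lim_transform_eventually)
qed

text \<open>Integrating over (w1, w2) first gives pi / \<kappa> with \<kappa> = R^2 / (4 pi (1 + i
  s)); its factor 1 + i s cancels the prefactor, and a pure shifted Gaussian in s remains.\<close>

lemma hk_limit_integral:
  assumes R: "R > 0" and \<beta>: "\<beta> > 0" and int: "integrable lborel (hk_limit R \<beta>)"
  shows "(LINT p|lborel. hk_limit R \<beta> p) =
    complex_of_real (4 * pi ^ 3 / R\<^sup>2 * sqrt (4 * pi / (R\<^sup>2 * \<beta>\<^sup>2 * (4 + \<beta>\<^sup>2) / (2 * pi\<^sup>2))))"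
proof -
  define c where "c = R\<^sup>2 * \<beta>\<^sup>2 * (4 + \<beta>\<^sup>2) / (2 * pi\<^sup>2)"
  have c: "c > 0" using R \<beta> by (auto simp: c_def intro!: divide_pos_pos mult_pos_pos add_pos_nonneg)
  let ?U = "\<lambda>s::real. 1 + \<i> * complex_of_real s"
  have U: "?U s \<noteq> 0" for s by (auto simp: complex_eq_iff)
  let ?f = "\<lambda>p. hk_limit R \<beta> (fst (snd p), fst p, snd (snd p))"
  have meas: "hk_limit R \<beta> \<in> borel_measurable borel" using borel_measurable_integrable[OF int] by simp
  have f_eq: "?f (s, y) = of_real pi / ?U s * exp (of_real (c / 4) * (?U s)\<^sup>2) *
      exp (- (of_real (R\<^sup>2 / (4 * pi)) / ?U s * of_real ((fst y)\<^sup>2 + (snd y)\<^sup>2)))" for s y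
    by (simp add: hk_limit_def c_def)
  have "(LINT p|lborel. hk_limit R \<beta> p) = (LINT p|lborel. ?f p)"
    by (rule integral_lborel_swap[OF meas])
  also have "\<dots> = (LINT s|lborel. LINT y|lborel. ?f (s, y))"
    using lborel_pair.integral_fst'[of ?f] integrable_lborel_swap[OF meas int] by (simp add: lborel_prod)
  also have "(\<lambda>s. LINT y|lborel. ?f (s, y)) = (\<lambda>s. of_real (4 * pi ^ 3 / R\<^sup>2) * exp (of_real (c / 4) * (?U s)\<^sup>2))"
  proof
    fix s :: real
    have "Re (of_real k / ?U s) = k / (1 + s\<^sup>2)" for k
      by (simp add: Re_divide power2_eq_square)
    then have "Re (of_real (R\<^sup>2 / (4 * pi)) / ?U s) = (R\<^sup>2 / (4 * pi)) / (1 + s\<^sup>2)" .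
    also have "\<dots> > 0" using R by (intro divide_pos_pos) (auto simp: add_pos_nonneg)
    finally have pos: "Re (of_real (R\<^sup>2 / (4 * pi)) / ?U s) > 0" .
    have "(LINT y|lborel. ?f (s, y)) = of_real pi / ?U s * exp (of_real (c / 4) * (?U s)\<^sup>2) *
        (LINT y|lborel. exp (- (of_real (R\<^sup>2 / (4 * pi)) / ?U s * of_real ((fst y)\<^sup>2 + (snd (y :: real \<times> real))\<^sup>2))))"
      unfolding f_eq by (rule integral_mult_right_zero)
    also have "\<dots> = of_real pi / ?U s * exp (of_real (c / 4) * (?U s)\<^sup>2) * (of_real pi / (of_real (R\<^sup>2 / (4 * pi)) / ?U s))"
      by (simp only: complex_gaussian_plane(2)[OF pos])
    also have "\<dots> = of_real (4 * pi ^ 3 / R\<^sup>2) * exp (of_real (c / 4) * (?U s)\<^sup>2)"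
      using U[of s] R by (simp add: power3_eq_cube)
    finally show "(LINT y|lborel. ?f (s, y)) = of_real (4 * pi ^ 3 / R\<^sup>2) * exp (of_real (c / 4) * (?U s)\<^sup>2)" .
  qed
  also have "(LINT s|lborel. of_real (4 * pi ^ 3 / R\<^sup>2) * exp (of_real (c / 4) * (?U s)\<^sup>2)) =
      of_real (4 * pi ^ 3 / R\<^sup>2) * (LINT s|lborel. exp (of_real (c / 4) * (?U s)\<^sup>2))"
    by (rule integral_mult_right_zero)
  also have "\<dots> = of_real (4 * pi ^ 3 / R\<^sup>2 * sqrt (4 * pi / c))"
    unfolding integral_shifted_gaussian[OF c] by (simp only: of_real_mult)
  finally show ?thesis unfolding c_def .
qed

text \<open>Dominated convergence is applied with q = 1 / x and x tending to infinity.
  \<open>F\<close> vanishes for q outside the range of the bound, so that measurability and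
  domination hold for all parameters.\<close>

lemma hk_scaled_integral_tendsto:
  assumes R: "R > 0" and \<beta>: "\<beta> > 0"
  shows "((\<lambda>q. LINT p|lborel. hk_scaled R \<beta> q p) \<longlongrightarrow>
    complex_of_real (4 * pi ^ 3 / R\<^sup>2 * sqrt (4 * pi / (R\<^sup>2 * \<beta>\<^sup>2 * (4 + \<beta>\<^sup>2) / (2 * pi\<^sup>2))))) (at_right 0)"
proof -
  define good where "good = (\<lambda>q. 0 < q \<and> q \<le> 1 \<and> (1 + \<beta>\<^sup>2) * q\<^sup>2 \<le> pi)"
  define F where "F = (\<lambda>q p. if good q then hk_scaled R \<beta> q p else 0)"
  obtain C where C: "\<And>q w1 s w2. 0 < q \<Longrightarrow> q \<le> 1 \<Longrightarrow> (1 + \<beta>\<^sup>2) * q\<^sup>2 \<le> pi \<Longrightarrow>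
    norm (hk_scaled R \<beta> q (w1, s, w2)) \<le> C * (inverse (1 + w1\<^sup>2) * (inverse (1 + s\<^sup>2) * inverse (1 + w2\<^sup>2)))"
    using hk_scaled_dominated[OF R \<beta>] by blast
  let ?w = "\<lambda>p :: real \<times> real \<times> real. \<bar>C\<bar> * (inverse (1 + (fst p)\<^sup>2) * (inverse (1 + (fst (snd p))\<^sup>2) * inverse (1 + (snd (snd p))\<^sup>2)))"
  have bound: "norm (F q p) \<le> ?w p" for q p
  proof (cases "good q")
    case True
    obtain w1 s w2 where p: "p = (w1, s, w2)" by (cases p)
    have "norm (F q p) \<le> C * (inverse (1 + w1\<^sup>2) * (inverse (1 + s\<^sup>2) * inverse (1 + w2\<^sup>2)))"
      using True C[of q w1 s w2] by (simp add: F_def p good_def)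
    also have "\<dots> \<le> \<bar>C\<bar> * (inverse (1 + w1\<^sup>2) * (inverse (1 + s\<^sup>2) * inverse (1 + w2\<^sup>2)))"
      by (intro mult_right_mono) auto
    finally show ?thesis by (simp add: p)
  qed (simp add: F_def)
  have meas: "F q \<in> borel_measurable lborel" for q
  proof (cases "good q")
    case True
    then have "continuous_on UNIV (hk_scaled R \<beta> q)"
      by (intro continuous_on_hk_scaled) (auto simp: good_def)
    then show ?thesis
      using True borel_measurable_continuous_onI[of "hk_scaled R \<beta> q"] by (simp add: F_def[abs_def])
  qed (simp add: F_def[abs_def])
  have int_w: "integrable lborel ?w"
    by (intro integrable_mult_right integrable_product_decay)
  have "\<forall>\<^sub>F q in at_right 0. (1 + \<beta>\<^sup>2) * q\<^sup>2 < pi"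
  proof (rule order_tendstoD(2))
    have "((\<lambda>q::real. (1 + \<beta>\<^sup>2) * q\<^sup>2) \<longlongrightarrow> (1 + \<beta>\<^sup>2) * 0\<^sup>2) (at_right 0)"
      by (intro tendsto_intros)
    then show "((\<lambda>q::real. (1 + \<beta>\<^sup>2) * q\<^sup>2) \<longlongrightarrow> 0) (at_right 0)" by simp
  qed simp
  moreover have "\<forall>\<^sub>F q in at_right 0. q \<in> {0<..<(1::real)}"
    by (rule eventually_at_right_real) simp
  ultimately have good: "\<forall>\<^sub>F q in at_right 0. good q"
    by eventually_elim (auto simp: good_def)
  have pw: "((\<lambda>q. F q p) \<longlongrightarrow> hk_limit R \<beta> p) (at_right 0)" for p
  proof -
    obtain w1 s w2 where p: "p = (w1, s, w2)" by (cases p)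
    have "\<forall>\<^sub>F q in at_right 0. hk_scaled R \<beta> q p = F q p"
      using good by eventually_elim (simp add: F_def)
    then show ?thesis
      using Lim_transform_eventually[OF hk_scaled_tendsto[of R \<beta> w1 s w2]] by (simp add: p)
  qed
  have U: "(1 + \<i> * complex_of_real s) \<noteq> 0" for s by (auto simp: complex_eq_iff)
  have lim_meas: "hk_limit R \<beta> \<in> borel_measurable lborel"
  proof -
    have "continuous_on UNIV (hk_limit R \<beta>)"
      unfolding hk_limit_def case_prod_unfold by (intro continuous_intros) (use U in auto)
    then show ?thesis by (simp add: borel_measurable_continuous_onI)
  qed
  have pw': "AE p in lborel. ((\<lambda>x. F (inverse x) p) \<longlongrightarrow> hk_limit R \<beta> p) at_top"
    using pw unfolding filterlim_at_right_to_top by (intro AE_I2) auto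
  have bound': "\<forall>\<^sub>F x in at_top. AE p in lborel. norm (F (inverse x) p) \<le> ?w p"
    using bound by (intro always_eventually allI AE_I2)
  have int: "integrable lborel (hk_limit R \<beta>)"
    by (rule integrable_dominated_convergence_at_top[OF lim_meas meas int_w pw' bound'])
  have "((\<lambda>x. LINT p|lborel. F (inverse x) p) \<longlongrightarrow> (LINT p|lborel. hk_limit R \<beta> p)) at_top"
    by (rule integral_dominated_convergence_at_top[OF lim_meas meas int_w pw' bound'])
  then have "((\<lambda>q. LINT p|lborel. F q p) \<longlongrightarrow> (LINT p|lborel. hk_limit R \<beta> p)) (at_right 0)"
    unfolding filterlim_at_right_to_top .
  moreover have "\<forall>\<^sub>F q in at_right 0. (LINT p|lborel. F q p) = (LINT p|lborel. hk_scaled R \<beta> q p)"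
    using good by eventually_elim (simp add: F_def)
  ultimately have "((\<lambda>q. LINT p|lborel. hk_scaled R \<beta> q p) \<longlongrightarrow> (LINT p|lborel. hk_limit R \<beta> p)) (at_right 0)"
    by (rule Lim_transform_eventually)
  then show ?thesis unfolding hk_limit_integral[OF R \<beta> int] .
qed

text \<open>The Jacobian q^8 against the normalising q^2 leaves q^6 = h^(3/2).\<close>

lemma hk_integral_eq_scaled:
  assumes q: "0 < q" "q \<le> 1" "(1 + \<beta>\<^sup>2) * q\<^sup>2 \<le> pi" and \<beta>: "\<beta> > 0"
  shows "(LINT p|lborel. hk_integrand R (R\<^sup>2 * \<beta>\<^sup>2 / (4 * pi)) (R\<^sup>2 * \<beta> / (2 * pi)) (q ^ 4)
      (of_real (fst p)) (of_real (fst (snd p))) (of_real (snd (snd p)))) =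
    of_real (q ^ 6 * exp (- (R\<^sup>2 * (1 + \<beta>\<^sup>2) / (4 * q ^ 4)))) * (LINT p|lborel. hk_scaled R \<beta> q p)"
proof -
  let ?t1 = "R\<^sup>2 * \<beta>\<^sup>2 / (4 * pi)" and ?t2 = "R\<^sup>2 * \<beta> / (2 * pi)"
  let ?e = "R\<^sup>2 * (1 + \<beta>\<^sup>2) / (4 * q ^ 4)"
  let ?G = "\<lambda>p. hk_integrand R ?t1 ?t2 (q ^ 4) (Complex (q\<^sup>2 * fst (snd p)) (pi - q\<^sup>2))
      (Complex (q ^ 3 * fst p - \<beta> * (q\<^sup>2 * fst (snd p))) (\<beta> * q\<^sup>2)) (of_real (q ^ 3 * snd (snd p)))"
  have "q\<^sup>2 \<le> 1" using q by (simp add: power_le_one)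
  then have "q\<^sup>2 \<le> pi" using pi_gt3 by linarith
  then have "(LINT p|lborel. hk_integrand R ?t1 ?t2 (q ^ 4) (of_real (fst p)) (of_real (fst (snd p))) (of_real (snd (snd p)))) =
    of_real (q ^ 8) * (LINT p|lborel. ?G p)"
    using q \<beta> by (intro hk_integral_shift scaled_tube_less) auto
  also have "(LINT p|lborel. hk_scaled R \<beta> q p) = of_real (q\<^sup>2 * exp ?e) * (LINT p|lborel. ?G p)"
    unfolding hk_scaled_def case_prod_unfold by (rule integral_mult_right_zero)
  then have "of_real (q ^ 8) * (LINT p|lborel. ?G p) = of_real (q ^ 6 * exp (- ?e)) * (LINT p|lborel. hk_scaled R \<beta> q p)"
  proof (simp only:)
    have "q ^ 6 * exp (- ?e) * (q\<^sup>2 * exp ?e) = q ^ 8 * (exp (- ?e) * exp ?e)"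
      by (simp add: mult_ac flip: power_add)
    also have "exp (- ?e) * exp ?e = 1" by (simp flip: exp_add)
    finally have eq: "q ^ 6 * exp (- ?e) * (q\<^sup>2 * exp ?e) = q ^ 8" by simp
    show "of_real (q ^ 8) * (LINT p|lborel. ?G p) = of_real (q ^ 6 * exp (- ?e)) * (of_real (q\<^sup>2 * exp ?e) * (LINT p|lborel. ?G p))"
      unfolding mult.assoc[symmetric] of_real_mult[symmetric] eq[unfolded mult.assoc[symmetric]] ..
  qed
  finally show ?thesis .
qed

subsection \<open>Absolutely continuous curves\<close>

lemma division_of_real_member:
  fixes I :: "real set"
  assumes "\<D> division_of S" "I \<in> \<D>"
  shows "I = {Inf I..Sup I}" "Inf I \<le> Sup I" "Inf I \<in> I" "Sup I \<in> I" "I \<subseteq> S"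
proof -
  obtain a b where I: "I = cbox a b" "I \<noteq> {}" "I \<subseteq> S"
    using division_ofD[OF assms(1)] assms(2) by metis
  then show "I = {Inf I..Sup I}" "Inf I \<le> Sup I" "Inf I \<in> I" "Sup I \<in> I" "I \<subseteq> S"
    by auto
qed

lemma abs_continuous_curve_onD:
  assumes "abs_continuous_curve_on S f" "\<epsilon> > 0"
  obtains \<delta> where "\<delta> > 0" "\<And>\<D>. \<D> division_of \<Union>\<D> \<Longrightarrow> \<Union>\<D> \<subseteq> S \<Longrightarrow> (\<Sum>I\<in>\<D>. Sup I - Inf I) < \<delta> \<Longrightarrow>
    (\<Sum>I\<in>\<D>. dist (f (Inf I)) (f (Sup I))) < \<epsilon>"
  using assms unfolding abs_continuous_curve_on_def by meson

text \<open>The closure rule behind the others: sums, products and Lipschitz images, among them the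
  coordinates of a curve, are instances.\<close>

lemma abs_continuous_curve_on_combine:
  fixes f :: "real \<Rightarrow> 'a::metric_space" and g :: "real \<Rightarrow> 'b::metric_space" and h :: "real \<Rightarrow> 'c::metric_space"
  assumes f: "abs_continuous_curve_on S f" and g: "abs_continuous_curve_on S g" and K: "K > 0"
    and le: "\<And>x y. x \<in> S \<Longrightarrow> y \<in> S \<Longrightarrow> dist (h x) (h y) \<le> K * (dist (f x) (f y) + dist (g x) (g y))"
  shows "abs_continuous_curve_on S h"
  unfolding abs_continuous_curve_on_def
proof (intro allI impI)
  fix \<epsilon> :: real assume "\<epsilon> > 0"
  then have e: "\<epsilon> / (2 * K) > 0" using K by simp
  obtain \<delta>1 where \<delta>1: "\<delta>1 > 0" "\<And>\<D>. \<D> division_of \<Union>\<D> \<Longrightarrow> \<Union>\<D> \<subseteq> S \<Longrightarrow> (\<Sum>I\<in>\<D>. Sup I - Inf I) < \<delta>1 \<Longrightarrow>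
    (\<Sum>I\<in>\<D>. dist (f (Inf I)) (f (Sup I))) < \<epsilon> / (2 * K)"
    using abs_continuous_curve_onD[OF f e] by blast
  obtain \<delta>2 where \<delta>2: "\<delta>2 > 0" "\<And>\<D>. \<D> division_of \<Union>\<D> \<Longrightarrow> \<Union>\<D> \<subseteq> S \<Longrightarrow> (\<Sum>I\<in>\<D>. Sup I - Inf I) < \<delta>2 \<Longrightarrow>
    (\<Sum>I\<in>\<D>. dist (g (Inf I)) (g (Sup I))) < \<epsilon> / (2 * K)"
    using abs_continuous_curve_onD[OF g e] by blast
  show "\<exists>\<delta>>0. \<forall>\<D>. \<D> division_of \<Union>\<D> \<and> \<Union>\<D> \<subseteq> S \<and> (\<Sum>I\<in>\<D>. Sup I - Inf I) < \<delta> \<longrightarrow>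
      (\<Sum>I\<in>\<D>. dist (h (Inf I)) (h (Sup I))) < \<epsilon>"
  proof (intro exI[of _ "min \<delta>1 \<delta>2"] conjI allI impI)
    fix \<D> :: "real set set"
    assume D: "\<D> division_of \<Union>\<D> \<and> \<Union>\<D> \<subseteq> S \<and> (\<Sum>I\<in>\<D>. Sup I - Inf I) < min \<delta>1 \<delta>2"
    have "(\<Sum>I\<in>\<D>. dist (h (Inf I)) (h (Sup I))) \<le> (\<Sum>I\<in>\<D>. K * (dist (f (Inf I)) (f (Sup I)) + dist (g (Inf I)) (g (Sup I))))"
    proof (rule sum_mono)
      fix I assume "I \<in> \<D>"
      with D have "Inf I \<in> S" "Sup I \<in> S" using division_of_real_member[of \<D> "\<Union>\<D>" I] by auto
      then show "dist (h (Inf I)) (h (Sup I)) \<le> K * (dist (f (Inf I)) (f (Sup I)) + dist (g (Inf I)) (g (Sup I)))"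
        by (rule le)
    qed
    also have "\<dots> = K * ((\<Sum>I\<in>\<D>. dist (f (Inf I)) (f (Sup I))) + (\<Sum>I\<in>\<D>. dist (g (Inf I)) (g (Sup I))))"
      by (simp only: sum_distrib_left[symmetric] sum.distrib)
    also have "\<dots> < K * (\<epsilon> / (2 * K) + \<epsilon> / (2 * K))"
      using D by (intro mult_strict_left_mono add_strict_mono \<delta>1 \<delta>2 K) auto
    also have "\<dots> = \<epsilon>" using K by simp
    finally show "(\<Sum>I\<in>\<D>. dist (h (Inf I)) (h (Sup I))) < \<epsilon>" .
  qed (use \<delta>1 \<delta>2 in auto)
qed

lemma abs_continuous_curve_on_compose_Lipschitz:
  fixes f :: "real \<Rightarrow> 'a::metric_space" and h :: "real \<Rightarrow> 'c::metric_space"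
  assumes f: "abs_continuous_curve_on S f" and K: "K > 0"
    and le: "\<And>x y. x \<in> S \<Longrightarrow> y \<in> S \<Longrightarrow> dist (h x) (h y) \<le> K * dist (f x) (f y)"
  shows "abs_continuous_curve_on S h"
  by (rule abs_continuous_curve_on_combine[OF f f K])
    (use le K in \<open>auto intro: order.trans[OF le] simp: distrib_left\<close>)

lemma abs_continuous_curve_on_id: "abs_continuous_curve_on S (\<lambda>x::real. x)"
  unfolding abs_continuous_curve_on_def
proof (intro allI impI)
  fix \<epsilon> :: real assume e: "\<epsilon> > 0"
  show "\<exists>\<delta>>0. \<forall>\<D>. \<D> division_of \<Union>\<D> \<and> \<Union>\<D> \<subseteq> S \<and> (\<Sum>I\<in>\<D>. Sup I - Inf I) < \<delta> \<longrightarrow>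
      (\<Sum>I\<in>\<D>. dist (Inf I) (Sup I)) < \<epsilon>"
  proof (intro exI[of _ \<epsilon>] conjI allI impI e)
    fix \<D> :: "real set set"
    assume D: "\<D> division_of \<Union>\<D> \<and> \<Union>\<D> \<subseteq> S \<and> (\<Sum>I\<in>\<D>. Sup I - Inf I) < \<epsilon>"
    have "(\<Sum>I\<in>\<D>. dist (Inf I) (Sup I)) = (\<Sum>I\<in>\<D>. Sup I - Inf I)"
      by (rule sum.cong) (use D division_of_real_member(2)[of \<D> "\<Union>\<D>"] in \<open>auto simp: dist_real_def\<close>)
    with D show "(\<Sum>I\<in>\<D>. dist (Inf I) (Sup I)) < \<epsilon>" by simp
  qed
qed

lemma abs_continuous_curve_on_Lipschitz:
  fixes h :: "real \<Rightarrow> 'c::metric_space"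
  assumes "K > 0" "\<And>x y. x \<in> S \<Longrightarrow> y \<in> S \<Longrightarrow> dist (h x) (h y) \<le> K * dist x y"
  shows "abs_continuous_curve_on S h"
  by (rule abs_continuous_curve_on_compose_Lipschitz[OF abs_continuous_curve_on_id assms])

lemma abs_continuous_curve_on_C1:
  fixes h :: "real \<Rightarrow> 'c::euclidean_space"
  assumes der: "\<And>x. x \<in> {a..b} \<Longrightarrow> (h has_vector_derivative h' x) (at x within {a..b})"
    and cont: "continuous_on {a..b} h'"
  shows "abs_continuous_curve_on {a..b} h"
proof -
  have "bounded (h' ` {a..b})"
    by (intro compact_imp_bounded compact_continuous_image cont) simp
  then obtain B where B: "B > 0" "\<And>x. x \<in> {a..b} \<Longrightarrow> norm (h' x) \<le> B"
    unfolding bounded_pos by auto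
  show ?thesis
  proof (rule abs_continuous_curve_on_Lipschitz[OF B(1)])
    fix x y assume "x \<in> {a..b}" "y \<in> {a..b}"
    then have "norm (h x - h y) \<le> B * norm (x - y)"
    proof (intro differentiable_bound[of "{a..b}" h "\<lambda>x t. t *\<^sub>R h' x"])
      fix z assume z: "z \<in> {a..b}"
      show "(h has_derivative (\<lambda>t. t *\<^sub>R h' z)) (at z within {a..b})"
        using der[OF z] by (simp add: has_vector_derivative_def)
      show "onorm (\<lambda>t. t *\<^sub>R h' z) \<le> B"
        using B(1) B(2)[OF z] by (intro onorm_bound) (auto simp: mult.commute[of B] intro!: mult_left_mono)
    qed auto
    then show "dist (h x) (h y) \<le> B * dist x y" by (simp add: dist_norm)
  qed
qed

lemma abs_continuous_imp_continuous_on: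
  assumes f: "abs_continuous_curve_on {a..b} f"
  shows "continuous_on {a..b} f"
  unfolding continuous_on_iff
proof (intro ballI allI impI)
  fix x e :: real assume x: "x \<in> {a..b}" and "e > 0"
  obtain \<delta> where \<delta>: "\<delta> > 0" "\<And>\<D>. \<D> division_of \<Union>\<D> \<Longrightarrow> \<Union>\<D> \<subseteq> {a..b} \<Longrightarrow> (\<Sum>I\<in>\<D>. Sup I - Inf I) < \<delta> \<Longrightarrow>
    (\<Sum>I\<in>\<D>. dist (f (Inf I)) (f (Sup I))) < e"
    using abs_continuous_curve_onD[OF f \<open>e > 0\<close>] by blast
  have *: "dist (f u) (f v) < e" if "u \<in> {a..b}" "v \<in> {a..b}" "u \<le> v" "v - u < \<delta>" for u v
  proof -
    have "{cbox u v} division_of cbox u v" using that by (intro division_of_self) auto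
    then have "{cbox u v} division_of \<Union>{cbox u v}" by simp
    from \<delta>(2)[OF this] that show ?thesis by auto
  qed
  show "\<exists>d>0. \<forall>x'\<in>{a..b}. dist x' x < d \<longrightarrow> dist (f x') (f x) < e"
  proof (intro exI[of _ \<delta>] conjI ballI impI \<delta>(1))
    fix x' assume "x' \<in> {a..b}" "dist x' x < \<delta>"
    then show "dist (f x') (f x) < e"
      using *[of x x'] *[of x' x] x by (cases "x \<le> x'") (auto simp: dist_real_def dist_commute)
  qed
qed

lemma abs_continuous_bounded:
  fixes f :: "real \<Rightarrow> real"
  assumes f: "abs_continuous_curve_on {a..b} f"
  obtains B where "B > 0" "\<And>x. x \<in> {a..b} \<Longrightarrow> \<bar>f x\<bar> \<le> B"
proof -
  have "bounded (f ` {a..b})"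
    by (intro compact_imp_bounded compact_continuous_image abs_continuous_imp_continuous_on f) simp
  then show ?thesis unfolding bounded_pos using that by auto
qed

lemma abs_continuous_add:
  fixes f g :: "real \<Rightarrow> real"
  assumes "abs_continuous_curve_on S f" "abs_continuous_curve_on S g"
  shows "abs_continuous_curve_on S (\<lambda>x. f x + g x)"
  by (rule abs_continuous_curve_on_combine[OF assms, of 1]) (auto simp: dist_real_def)

lemma abs_continuous_mult:
  fixes f g :: "real \<Rightarrow> real"
  assumes f: "abs_continuous_curve_on {a..b} f" and g: "abs_continuous_curve_on {a..b} g"
  shows "abs_continuous_curve_on {a..b} (\<lambda>x. f x * g x)"
proof -
  obtain A where A: "A > 0" "\<And>x. x \<in> {a..b} \<Longrightarrow> \<bar>f x\<bar> \<le> A" using abs_continuous_bounded[OF f] by blast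
  obtain B where B: "B > 0" "\<And>x. x \<in> {a..b} \<Longrightarrow> \<bar>g x\<bar> \<le> B" using abs_continuous_bounded[OF g] by blast
  show ?thesis
  proof (rule abs_continuous_curve_on_combine[OF f g, of "A + B"])
    fix x y assume x: "x \<in> {a..b}" "y \<in> {a..b}"
    have "\<bar>f x * g x - f y * g y\<bar> = \<bar>(f x - f y) * g x + f y * (g x - g y)\<bar>" by (simp add: algebra_simps)
    also have "\<dots> \<le> \<bar>f x - f y\<bar> * \<bar>g x\<bar> + \<bar>f y\<bar> * \<bar>g x - g y\<bar>"
      using abs_triangle_ineq[of "(f x - f y) * g x" "f y * (g x - g y)"] by (simp only: abs_mult)
    also have "\<dots> \<le> \<bar>f x - f y\<bar> * (A + B) + (A + B) * \<bar>g x - g y\<bar>"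
      using A(1) B(1) A(2)[OF x(2)] B(2)[OF x(1)] by (intro add_mono mult_left_mono mult_right_mono) auto
    finally show "dist (f x * g x) (f y * g y) \<le> (A + B) * (dist (f x) (f y) + dist (g x) (g y))"
      by (simp add: dist_real_def algebra_simps)
  qed (use A B in auto)
qed

text \<open>The fundamental theorem for absolutely continuous functions, proved in the gauge
  integral. At tags outside the null set \<open>N\<close> the gauge comes from differentiability
  (the straddle estimate). At tags in \<open>N\<close> it is an open set \<open>T\<close> that
  contains \<open>N\<close> and has measure below \<delta>, so that absolute continuity makes the
  increments over those cells small.\<close>

theorem abs_continuous_has_integral:
  fixes f :: "real \<Rightarrow> real"
  assumes ab: "a \<le> b" and f: "abs_continuous_curve_on {a..b} f"
    and der: "AE s in lebesgue. s \<in> {a..b} \<longrightarrow> (f has_vector_derivative f' s) (at s within {a..b})"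
  shows "(f' has_integral (f b - f a)) {a..b}"
proof -
  obtain N where N': "{s \<in> space lebesgue. \<not> (s \<in> {a..b} \<longrightarrow> (f has_vector_derivative f' s) (at s within {a..b}))} \<subseteq> N"
    "emeasure lebesgue N = 0" "N \<in> sets lebesgue"
    using der by (rule AE_E)
  have N: "N \<in> null_sets lebesgue" "{s. \<not> (s \<in> {a..b} \<longrightarrow> (f has_vector_derivative f' s) (at s within {a..b}))} \<subseteq> N"
    using null_setsI[OF N'(2,3)] N'(1) by simp_all
  then have neg: "negligible N" by (simp add: negligible_iff_null_sets)
  \<comment> \<open>With the value 0 on \<open>N\<close>, cells tagged there contribute nothing but
    increments of \<open>f\<close>.\<close>
  define g where "g = (\<lambda>s. if s \<in> N then 0 else f' s)"
  have "(g has_integral (f b - f a)) (cbox a b)"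
    unfolding has_integral
  proof (intro allI impI)
    fix e :: real assume e: "e > 0"
    then have e2: "e / 2 > 0" by simp
    obtain \<delta> where \<delta>: "\<delta> > 0" "\<And>\<D>. \<D> division_of \<Union>\<D> \<Longrightarrow> \<Union>\<D> \<subseteq> {a..b} \<Longrightarrow> (\<Sum>I\<in>\<D>. Sup I - Inf I) < \<delta> \<Longrightarrow>
      (\<Sum>I\<in>\<D>. dist (f (Inf I)) (f (Sup I))) < e / 2"
      using abs_continuous_curve_onD[OF f e2] by blast
    obtain T where T: "open T" "N \<subseteq> T" "T - N \<in> lmeasurable" "emeasure lebesgue (T - N) < ennreal \<delta>"
      using sets_lebesgue_outer_open[of N \<delta>] N(1) \<delta>(1) by (auto simp: null_sets_def)
    have TN: "T = (T - N) \<union> N" using T by auto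
    have Tm: "T \<in> lmeasurable"
      using T(3) N(1) by (subst TN) (intro fmeasurable.Un; auto simp: fmeasurableI_null_sets)
    have "measure lebesgue T \<le> measure lebesgue (T - N) + measure lebesgue N"
      by (subst TN) (intro measure_Un_le; use T N in \<open>auto simp: null_sets_def fmeasurableD\<close>)
    also have "measure lebesgue N = 0" using N(1) by (simp add: measure_eq_0_null_sets)
    also have "measure lebesgue (T - N) < \<delta>"
      using T(3,4) \<delta>(1) by (simp add: emeasure_eq_measure2 ennreal_less_iff)
    finally have Tlt: "measure lebesgue T < \<delta>" by simp
    define e' where "e' = e / (2 * (b - a + 1))"
    have e': "e' > 0" using e ab by (simp add: e'_def)
    have "\<exists>d>0. \<forall>y\<in>{a..b}. norm (y - x) < d \<longrightarrow> norm (f y - f x - (y - x) *\<^sub>R f' x) \<le> e' * norm (y - x)"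
      if "x \<in> {a..b}" "x \<notin> N" for x
    proof -
      have "(f has_vector_derivative f' x) (at x within {a..b})" using N(2) that by auto
      then show ?thesis
        unfolding has_vector_derivative_def has_derivative_within_alt using e' by blast
    qed
    then obtain d where d: "\<And>x. x \<in> {a..b} \<Longrightarrow> x \<notin> N \<Longrightarrow> d x > 0"
      "\<And>x y. x \<in> {a..b} \<Longrightarrow> x \<notin> N \<Longrightarrow> y \<in> {a..b} \<Longrightarrow> norm (y - x) < d x \<Longrightarrow> norm (f y - f x - (y - x) *\<^sub>R f' x) \<le> e' * norm (y - x)"
      by metis
    define \<gamma> where "\<gamma> = (\<lambda>x. if x \<in> N then T else if x \<in> {a..b} then ball x (d x) else UNIV)"
    have gauge: "gauge \<gamma>"
      unfolding gauge_def \<gamma>_def using T d by auto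
    show "\<exists>\<gamma>. gauge \<gamma> \<and> (\<forall>\<D>. \<D> tagged_division_of cbox a b \<and> \<gamma> fine \<D> \<longrightarrow>
        norm ((\<Sum>(x, k)\<in>\<D>. measure lborel k *\<^sub>R g x) - (f b - f a)) < e)"
    proof (intro exI[of _ \<gamma>] conjI allI impI gauge)
      fix p assume p: "p tagged_division_of cbox a b \<and> \<gamma> fine p"
      then have pt: "p tagged_division_of {a..b}" and fine: "\<gamma> fine p" by auto
      have fin: "finite p" using pt by blast
      have K: "\<exists>u v. K = {u..v} \<and> u \<le> x \<and> x \<le> v \<and> a \<le> u \<and> v \<le> b" if xK: "(x, K) \<in> p" for x K
      proof -
        obtain u v where "K = cbox u v" using tagged_division_ofD(4)[OF pt xK] by blast
        moreover have "x \<in> K" "K \<subseteq> {a..b}" using tagged_division_ofD(2,3)[OF pt xK] by auto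
        ultimately show ?thesis by auto
      qed
      define h where "h = (\<lambda>(x, K). measure lborel K *\<^sub>R g x - (f (Sup K) - f (Inf K)))"
      have sum_h: "(\<Sum>(x, k)\<in>p. measure lborel k *\<^sub>R g x) - (f b - f a) = sum h p"
        unfolding h_def additive_tagged_division_1[OF ab pt, of f, symmetric]
        by (simp add: sum_subtractf case_prod_unfold)
      define pN where "pN = {(x, K) \<in> p. x \<in> N}"
      define pG where "pG = {(x, K) \<in> p. x \<notin> N}"
      have split: "p = pN \<union> pG" "pN \<inter> pG = {}" by (auto simp: pN_def pG_def)
      have finN: "finite pN" "finite pG" using fin split by auto
      have "norm (sum h pG) \<le> (\<Sum>(x, K)\<in>pG. e' * measure lborel K)"
      proof (rule sum_norm_le, clarify)
        fix x K assume xK: "(x, K) \<in> pG"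
        then have xp: "(x, K) \<in> p" and xN: "x \<notin> N" by (auto simp: pG_def)
        obtain u v where uv: "K = {u..v}" "u \<le> x" "x \<le> v" "a \<le> u" "v \<le> b" using K[OF xp] by blast
        have x: "x \<in> {a..b}" using uv by auto
        have "K \<subseteq> \<gamma> x" using fine xp by (auto simp: fine_def)
        then have "K \<subseteq> ball x (d x)" using x xN by (simp add: \<gamma>_def)
        moreover have "u \<in> K" "v \<in> K" using uv by auto
        ultimately have "u \<in> ball x (d x)" "v \<in> ball x (d x)" by blast+
        then have uvd: "norm (u - x) < d x" "norm (v - x) < d x" by (auto simp: dist_real_def abs_minus_commute)
        have 1: "norm (f u - f x - (u - x) *\<^sub>R f' x) \<le> e' * norm (u - x)"
          using d(2)[OF x xN _ uvd(1)] uv by auto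
        have 2: "norm (f v - f x - (v - x) *\<^sub>R f' x) \<le> e' * norm (v - x)"
          using d(2)[OF x xN _ uvd(2)] uv by auto
        have "h (x, K) = (f u - f x - (u - x) *\<^sub>R f' x) - (f v - f x - (v - x) *\<^sub>R f' x)"
          using uv xN by (simp add: h_def g_def algebra_simps)
        then have "norm (h (x, K)) \<le> norm (f u - f x - (u - x) *\<^sub>R f' x) + norm (f v - f x - (v - x) *\<^sub>R f' x)"
          by (simp only: norm_triangle_ineq4)
        also have "\<dots> \<le> e' * norm (u - x) + e' * norm (v - x)" using 1 2 by (rule add_mono)
        also have "\<dots> = e' * measure lborel K" using uv by (simp add: algebra_simps)
        finally show "norm (h (x, K)) \<le> e' * measure lborel K" .
      qed
      also have "\<dots> \<le> (\<Sum>(x, K)\<in>p. e' * measure lborel K)"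
        using e' by (intro sum_mono2 fin) (auto simp: pG_def)
      also have "\<dots> = e' * (\<Sum>(x, K)\<in>p. measure lborel K)" by (simp add: sum_distrib_left case_prod_unfold)
      also have "(\<Sum>(x, K)\<in>p. measure lborel K) = b - a"
        using additive_content_tagged_division[of p a b] pt ab by simp
      also have "e' * (b - a) < e / 2"
      proof -
        have "e' * (b - a) < e' * (b - a + 1)" using e' by simp
        also have "\<dots> = e / 2" using ab by (simp add: e'_def field_simps)
        finally show ?thesis .
      qed
      finally have good: "norm (sum h pG) < e / 2" .
      let ?D = "snd ` pN"
      have part: "pN tagged_partial_division_of {a..b}"
      proof (rule tagged_partial_division_subset)
        show "p tagged_partial_division_of {a..b}" using pt unfolding tagged_division_of_def by blast
        show "pN \<subseteq> p" unfolding split(1) by blast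
      qed
      have div: "?D division_of \<Union>?D" by (rule partial_division_of_tagged_division[OF part])
      have tag: "pN tagged_division_of \<Union>(snd ` pN)" by (rule tagged_partial_division_of_Union_self[OF part])
      have sub: "\<Union>?D \<subseteq> {a..b}" using tagged_partial_division_ofD(3)[OF part] by fastforce
      have "(\<Sum>I\<in>?D. Sup I - Inf I) = (\<Sum>I\<in>?D. measure lborel I)"
      proof (rule sum.cong[OF refl])
        fix I assume I: "I \<in> ?D"
        have "measure lborel {Inf I..Sup I} = Sup I - Inf I" using division_of_real_member(2)[OF div I] by simp
        then show "Sup I - Inf I = measure lborel I" using division_of_real_member(1)[OF div I] by simp
      qed
      also have "\<dots> = measure lebesgue (\<Union>?D)"
      proof -
        have "measure lborel I = measure lebesgue I" if "I \<in> ?D" for I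
        proof -
          have "{Inf I..Sup I} \<in> sets lborel" by simp
          then have "measure lebesgue {Inf I..Sup I} = measure lborel {Inf I..Sup I}" by (rule measure_completion)
          then show ?thesis using division_of_real_member(1)[OF div that] by simp
        qed
        then have "(\<Sum>I\<in>?D. measure lborel I) = (\<Sum>I\<in>?D. measure lebesgue I)" by (rule sum.cong[OF refl])
        then show ?thesis using content_division[OF div] by simp
      qed
      also have "\<dots> \<le> measure lebesgue T"
      proof (rule measure_mono_fmeasurable)
        show "\<Union>?D \<subseteq> T" using fine by (fastforce simp: fine_def pN_def \<gamma>_def)
        show "\<Union>?D \<in> sets lebesgue"
          using div by (intro fmeasurableD lmeasurable_division)
      qed (rule Tm)
      finally have "(\<Sum>I\<in>?D. Sup I - Inf I) < \<delta>" using Tlt by linarith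
      from \<delta>(2)[OF div sub this] have small: "(\<Sum>I\<in>?D. dist (f (Inf I)) (f (Sup I))) < e / 2" .
      have "norm (sum h pN) \<le> (\<Sum>(x, K)\<in>pN. dist (f (Inf K)) (f (Sup K)))"
        by (rule sum_norm_le) (auto simp: h_def g_def pN_def dist_real_def)
      also have "\<dots> = (\<Sum>I\<in>?D. dist (f (Inf I)) (f (Sup I)))"
      proof -
        \<comment> \<open>Passing from tagged pairs to their cells calls for a function that is 0 on
          cells with empty interior. The increment of \<open>f\<close> over a single point is 0; the
          empty set, which has no meaningful endpoints, is assigned 0.\<close>
        define dd where "dd = (\<lambda>I. if I = {} then 0 else dist (f (Inf I)) (f (Sup I)))"
        have "dd (cbox u v) = 0" if "box u v = {}" for u v
        proof -
          have "v \<le> u" using that by (simp add: box_eq_empty)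
          then show ?thesis by (cases "u = v") (auto simp: dd_def)
        qed
        from sum.over_tagged_division_lemma[OF tag, of dd, OF this]
        have 1: "(\<Sum>(x, K)\<in>pN. dd K) = sum dd ?D" .
        have ne: "K \<noteq> {}" if "K \<in> ?D" for K using division_ofD(3)[OF div that] .
        have 2: "sum dd ?D = (\<Sum>I\<in>?D. dist (f (Inf I)) (f (Sup I)))"
          by (rule sum.cong[OF refl]) (use ne in \<open>auto simp: dd_def\<close>)
        have 3: "(\<Sum>(x, K)\<in>pN. dd K) = (\<Sum>(x, K)\<in>pN. dist (f (Inf K)) (f (Sup K)))"
        proof (rule sum.cong[OF refl], clarify)
          fix x K assume "(x, K) \<in> pN"
          then have "K \<noteq> {}" by (intro ne) force
          then show "dd K = dist (f (Inf K)) (f (Sup K))" by (simp add: dd_def)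
        qed
        show ?thesis using 1 2 3 by (simp only:)
      qed
      finally have bad: "norm (sum h pN) < e / 2" using small by linarith
      have "sum h (pN \<union> pG) = sum h pN + sum h pG"
        by (rule sum.union_disjoint[OF finN split(2)])
      then have eq: "sum h p = sum h pN + sum h pG" by (simp only: split(1)[symmetric])
      have "norm (sum h p) \<le> norm (sum h pN) + norm (sum h pG)"
        unfolding eq by (rule norm_triangle_ineq)
      also have "\<dots> < e / 2 + e / 2" by (rule add_strict_mono[OF bad good])
      finally have "norm (sum h p) < e" by (simp only: field_sum_of_halves)
      then show "norm ((\<Sum>(x, k)\<in>p. measure lborel k *\<^sub>R g x) - (f b - f a)) < e" unfolding sum_h .
    qed
  qed
  then have "(g has_integral (f b - f a)) {a..b}" by simp
  then show ?thesis by (rule has_integral_spike[OF neg, rotated]) (simp add: g_def)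
qed

lemma integrable_abs_diff:
  fixes f g :: "real \<Rightarrow> real"
  assumes "f absolutely_integrable_on S" "g absolutely_integrable_on S"
  shows "(\<lambda>s. \<bar>f s - g s\<bar>) integrable_on S"
proof -
  have "(\<lambda>s. f s - g s) absolutely_integrable_on S" by (rule set_integral_diff(1)[OF assms])
  from absolutely_integrable_norm[OF this] have "(\<lambda>s. \<bar>f s - g s\<bar>) absolutely_integrable_on S"
    by (simp add: o_def)
  then show ?thesis by (rule set_lebesgue_integral_eq_integral(1))
qed

text \<open>The function is cut off at height k, and the result is approximated by continuous
  functions clipped at the same height; both errors tend to 0 by dominated convergence. The
  pointwise approximants are those contained in the meaning of \<open>measurable_on\<close>.\<close>

lemma continuous_approximation_L1:
  fixes b :: "real \<Rightarrow> real"
  assumes b: "b absolutely_integrable_on {0..1}" and nn: "\<And>s. b s \<ge> 0" and \<eta>: "\<eta> > 0"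
  obtains g where "continuous_on UNIV g" "\<And>s. g s \<ge> 0" "integral {0..1} (\<lambda>s. \<bar>b s - g s\<bar>) < \<eta>"
proof -
  have bi: "b integrable_on {0..1}" using b by (simp add: set_lebesgue_integral_eq_integral)
  define c where "c = (\<lambda>k s. min (b s) (real k))"
  have ck: "c k absolutely_integrable_on {0..1}" for k
    unfolding c_def by (intro absolutely_integrable_min_1 b absolutely_integrable_on_const) auto
  have "(\<lambda>k. integral {0..1} (\<lambda>s. b s - c k s)) \<longlonglongrightarrow> integral {0..1::real} (\<lambda>s. 0 :: real)"
  proof (rule Equivalence_Lebesgue_Henstock_Integration.dominated_convergence(2)[where h = b])
    show "(\<lambda>s. b s - c k s) integrable_on {0..1}" for k
      using ck b by (intro integrable_diff) (auto simp: set_lebesgue_integral_eq_integral)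
    show "norm (b s - c k s) \<le> b s" for k s using nn[of s] by (auto simp: c_def min_def)
    show "(\<lambda>k. b s - c k s) \<longlonglongrightarrow> 0" for s
    proof (rule tendsto_eventually)
      obtain n where "b s \<le> real n" using real_arch_simple by blast
      then show "\<forall>\<^sub>F k in sequentially. b s - c k s = 0"
        unfolding eventually_sequentially by (intro exI[of _ n]) (auto simp: c_def min_def)
    qed
  qed (rule bi)
  then have "\<forall>\<^sub>F k in sequentially. integral {0..1} (\<lambda>s. b s - c k s) < \<eta> / 2"
    using \<eta> by (intro order_tendstoD(2)) auto
  then obtain k where k: "integral {0..1} (\<lambda>s. b s - c k s) < \<eta> / 2"
    by (auto simp: eventually_sequentially)
  have "(\<lambda>s. if s \<in> {0..1} then b s else 0) integrable_on UNIV"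
    using bi by (simp only: integrable_restrict_UNIV)
  then have "(\<lambda>s. if s \<in> {0..1} then b s else 0) measurable_on UNIV"
    by (intro integrable_subintervals_imp_measurable) (rule integrable_on_subcbox, auto)
  then obtain N G where N: "negligible N" and G: "\<And>n. continuous_on UNIV (G n)"
    and lim: "\<And>s. s \<notin> N \<Longrightarrow> (\<lambda>n. G n s) \<longlonglongrightarrow> (if s \<in> {0..1} then b s else 0)"
    unfolding measurable_on_def by auto
  define g where "g = (\<lambda>n s. min \<bar>G n s\<bar> (real k))"
  have g: "continuous_on UNIV (g n)" for n unfolding g_def by (intro continuous_intros G)
  have gi: "g n absolutely_integrable_on {0..1}" for n
    by (rule absolutely_integrable_continuous_real[OF continuous_on_subset[OF g]]) simp
  have di: "(\<lambda>s. \<bar>c k s - g n s\<bar>) integrable_on {0..1}" for n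
    by (rule integrable_abs_diff[OF ck gi])
  define F where "F = (\<lambda>n s. if s \<in> N then 0 else \<bar>c k s - g n s\<bar>)"
  have Fi: "(F n has_integral integral {0..1} (\<lambda>s. \<bar>c k s - g n s\<bar>)) {0..1}" for n
    by (rule has_integral_spike[OF N _ integrable_integral[OF di]]) (simp add: F_def)
  have "(\<lambda>n. integral {0..1} (F n)) \<longlonglongrightarrow> integral {0..1::real} (\<lambda>s. 0 :: real)"
  proof (rule Equivalence_Lebesgue_Henstock_Integration.dominated_convergence(2)[where h = "\<lambda>s. real k"])
    show "F n integrable_on {0..1}" for n using Fi by blast
    show "norm (F n s) \<le> real k" for n s using nn[of s] by (auto simp: F_def c_def g_def min_def)
    fix s :: real assume s: "s \<in> {0..1}"
    show "(\<lambda>n. F n s) \<longlonglongrightarrow> 0"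
    proof (cases "s \<in> N")
      case False
      then have "(\<lambda>n. G n s) \<longlonglongrightarrow> b s" using lim s by fastforce
      then have "(\<lambda>n. \<bar>c k s - min \<bar>G n s\<bar> (real k)\<bar>) \<longlonglongrightarrow> \<bar>c k s - min \<bar>b s\<bar> (real k)\<bar>"
        by (intro tendsto_intros)
      then show ?thesis using False nn[of s] by (simp add: F_def g_def c_def)
    qed (simp add: F_def)
  qed auto
  then have "\<forall>\<^sub>F n in sequentially. integral {0..1} (F n) < \<eta> / 2"
    using \<eta> by (intro order_tendstoD(2)) auto
  then obtain n where "integral {0..1} (F n) < \<eta> / 2"
    by (auto simp: eventually_sequentially)
  then have n: "integral {0..1} (\<lambda>s. \<bar>c k s - g n s\<bar>) < \<eta> / 2"
    using integral_unique[OF Fi[of n]] by simp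
  show ?thesis
  proof (rule that[OF g[of n]])
    show "g n s \<ge> 0" for s by (simp add: g_def)
    have bc: "(\<lambda>s. b s - c k s) integrable_on {0..1}"
      using ck b by (intro integrable_diff) (auto simp: set_lebesgue_integral_eq_integral)
    have "integral {0..1} (\<lambda>s. \<bar>b s - g n s\<bar>) \<le> integral {0..1} (\<lambda>s. (b s - c k s) + \<bar>c k s - g n s\<bar>)"
    proof (rule integral_le)
      show "(\<lambda>s. \<bar>b s - g n s\<bar>) integrable_on {0..1}"
        by (rule integrable_abs_diff[OF b gi])
      show "(\<lambda>s. (b s - c k s) + \<bar>c k s - g n s\<bar>) integrable_on {0..1}" by (intro integrable_add bc di)
      show "\<bar>b s - g n s\<bar> \<le> (b s - c k s) + \<bar>c k s - g n s\<bar>" for s by (auto simp: c_def min_def)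
    qed
    also have "\<dots> = integral {0..1} (\<lambda>s. b s - c k s) + integral {0..1} (\<lambda>s. \<bar>c k s - g n s\<bar>)"
      by (rule Henstock_Kurzweil_Integration.integral_add[OF bc di])
    finally show "integral {0..1} (\<lambda>s. \<bar>b s - g n s\<bar>) < \<eta>" using k n by linarith
  qed
qed

subsection \<open>The isoperimetric inequality and the distance\<close>

lemma sin_pi_mult_ge:
  fixes e u :: real
  assumes "0 < e" "e \<le> u" "u \<le> 1 - e"
  shows "sin (pi * e) \<le> sin (pi * u)" "0 < sin (pi * e)"
proof -
  have e: "e \<le> 1 / 2" using assms by simp
  have "pi * e \<le> pi * (1 / 2)" using e by (intro mult_left_mono) auto
  moreover have "0 < pi * e" using assms by simp
  ultimately show "0 < sin (pi * e)" by (intro sin_gt_zero) auto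
  show "sin (pi * e) \<le> sin (pi * u)"
  proof (cases "u \<le> 1 / 2")
    case True
    have "pi * e \<le> pi * u" "pi * u \<le> pi * (1 / 2)" using True assms by (intro mult_left_mono; simp)+
    then show ?thesis using \<open>0 < pi * e\<close> pi_gt_zero by (intro sin_monotone_2pi_le) linarith+
  next
    case False
    have "sin (pi * u) = sin (pi * (1 - u))" by (simp add: right_diff_distrib)
    moreover have "pi * e \<le> pi * (1 - u)" "pi * (1 - u) \<le> pi * (1 / 2)" using False assms by (intro mult_left_mono; simp)+
    then have "sin (pi * e) \<le> sin (pi * (1 - u))" using \<open>0 < pi * e\<close> pi_gt_zero by (intro sin_monotone_2pi_le) linarith+
    ultimately show ?thesis by simp
  qed
qed

text \<open>The function differentiated below is the classical action (a solution of the Hamilton--Jacobi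
  equation) of the Heisenberg problem. The pole of its cotangent is pushed outside the time interval,
  so it bounds the area by the length without any reparametrization of the curve.\<close>

lemma isoperimetric_aux:
  fixes y z A u v :: "real \<Rightarrow> real"
  assumes ac: "abs_continuous_curve_on {0..1} y" "abs_continuous_curve_on {0..1} z" "abs_continuous_curve_on {0..1} A"
    and der: "AE s in lebesgue. s \<in> {0..1} \<longrightarrow> (y has_vector_derivative u s) (at s within {0..1}) \<and>
      (z has_vector_derivative v s) (at s within {0..1}) \<and>
      (A has_vector_derivative (z s * u s - y s * v s) / 2) (at s within {0..1})"
    and ends: "y 0 = 0" "z 0 = 0" "A 0 = 0" "y 1 = 0" "z 1 = 0"
    and int: "(\<lambda>s. sqrt ((u s)\<^sup>2 + (v s)\<^sup>2)) absolutely_integrable_on {0..1}"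
    and L: "integral {0..1} (\<lambda>s. sqrt ((u s)\<^sup>2 + (v s)\<^sup>2)) < L"
  shows "4 * pi * A 1 \<le> L * integral {0..1} (\<lambda>s. sqrt ((u s)\<^sup>2 + (v s)\<^sup>2))"
proof (rule field_le_epsilon)
  fix \<epsilon> :: real assume \<epsilon>: "\<epsilon> > 0"
  define b where "b = (\<lambda>s. sqrt ((u s)\<^sup>2 + (v s)\<^sup>2))"
  define l where "l = integral {0..1} b"
  have b0: "b s \<ge> 0" for s by (simp add: b_def)
  have babs: "b absolutely_integrable_on {0..1}" using int by (simp add: b_def)
  have bi: "b integrable_on {0..1}" using babs by (simp add: set_lebesgue_integral_eq_integral)
  have l0: "l \<ge> 0" unfolding l_def using b0 by (intro integral_nonneg bi) auto
  have lL: "l < L" using L by (simp add: l_def b_def)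
  then have L0: "L > 0" using l0 by simp
  \<comment> \<open>This splits the slack: l / L = 1 - 4 e, so a phase that starts at e and grows by
    at most l / L + e stays below 1 - e.\<close>
  define e where "e = (1 - l / L) / 4"
  have e: "0 < e" "e \<le> 1 / 4" using lL L0 l0 by (auto simp: e_def)
  obtain Y where Y: "Y > 0" "\<And>s. s \<in> {0..1} \<Longrightarrow> \<bar>y s\<bar> \<le> Y" using abs_continuous_bounded[OF ac(1)] by blast
  obtain Z where Z: "Z > 0" "\<And>s. s \<in> {0..1} \<Longrightarrow> \<bar>z s\<bar> \<le> Z" using abs_continuous_bounded[OF ac(2)] by blast
  \<comment> \<open>A bound for the norm \<open>w\<close> below, which equals pi |(y, z)| / sin (pi
    \<phi>).\<close>
  define V where "V = pi * (Y + Z) / sin (pi * e)"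
  have sine: "0 < sin (pi * e)" using sin_pi_mult_ge(2)[of e e] e by simp
  have V: "V > 0" using Y Z sine by (simp add: V_def)
  \<comment> \<open>The first bound keeps \<open>\<phi>\<close> below \<open>1 - e\<close>; the
    second makes the total error at most \<epsilon>.\<close>
  define \<eta> where "\<eta> = min (e * L) (\<epsilon> / (L + 2 * V))"
  have \<eta>: "\<eta> > 0" using e L0 \<epsilon> V by (simp add: \<eta>_def)
  obtain g where g: "continuous_on UNIV g" "\<And>s. g s \<ge> 0" "integral {0..1} (\<lambda>s. \<bar>b s - g s\<bar>) < \<eta>"
    using continuous_approximation_L1[OF babs b0 \<eta>] by blast
  have gc: "continuous_on {0..1} g" by (rule continuous_on_subset[OF g(1)]) simp
  have gi: "g integrable_on {0..1}" using integrable_continuous_interval[OF gc] .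
  have gabs: "g absolutely_integrable_on {0..1}" by (rule absolutely_integrable_continuous_real[OF gc])
  have di: "(\<lambda>s. \<bar>b s - g s\<bar>) integrable_on {0..1}"
    by (rule integrable_abs_diff[OF babs gabs])
  have ig: "integral {0..1} g \<le> l + \<eta>"
  proof -
    have "integral {0..1} g \<le> integral {0..1} (\<lambda>s. b s + \<bar>b s - g s\<bar>)"
      by (rule integral_le[OF gi integrable_add[OF bi di]]) auto
    also have "\<dots> = l + integral {0..1} (\<lambda>s. \<bar>b s - g s\<bar>)"
      unfolding l_def by (rule Henstock_Kurzweil_Integration.integral_add[OF bi di])
    finally show ?thesis using g(3) by simp
  qed
  \<comment> \<open>Arc length over L, started at e, with the continuous \<open>g\<close> in place
    of the speed \<open>b\<close>: the cotangent has to be continuously differentiable, while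
    \<open>b\<close> is merely integrable.\<close>
  define \<phi> where "\<phi> = (\<lambda>s. e + integral {0..s} g / L)"
  have \<phi>d: "(\<phi> has_real_derivative g s / L) (at s within {0..1})" if "s \<in> {0..1}" for s
    using DERIV_add[OF DERIV_const[of e] DERIV_cdivide[OF integral_has_real_derivative[OF gc that], of L]]
    by (simp add: \<phi>_def[abs_def])
  have \<phi>: "e \<le> \<phi> s" "\<phi> s \<le> 1 - e" if "s \<in> {0..1}" for s
  proof -
    have gis: "g integrable_on {0..s}" using that by (intro integrable_continuous_interval continuous_on_subset[OF g(1)]) auto
    have "0 \<le> integral {0..s} g" by (rule integral_nonneg[OF gis]) (use g(2) in auto)
    then show "e \<le> \<phi> s" using L0 by (simp add: \<phi>_def)
    have "integral {0..s} g \<le> integral {0..1} g"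
      by (rule integral_subset_le[OF _ gis gi]) (use that g(2) in auto)
    also have "\<dots> \<le> l + e * L" using ig by (simp add: \<eta>_def)
    finally have "integral {0..s} g / L \<le> (l + e * L) / L" using L0 by (intro divide_right_mono) auto
    also have "\<dots> = l / L + e" using L0 by (simp add: add_divide_distrib)
    finally have "\<phi> s \<le> e + (l / L + e)" by (simp add: \<phi>_def)
    moreover have "l / L = 1 - 4 * e" using L0 by (simp add: e_def field_simps)
    ultimately show "\<phi> s \<le> 1 - e" using e by linarith
  qed
  have sin\<phi>: "sin (pi * e) \<le> sin (pi * \<phi> s)" "0 < sin (pi * \<phi> s)" if "s \<in> {0..1}" for s
    using sin_pi_mult_ge(1)[OF e(1) \<phi>[OF that]] sine by auto
  \<comment> \<open>It solves the Riccati equation c' = - (c^2 + pi^2) g / L.\<close>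
  define c where "c = (\<lambda>s. pi * cos (pi * \<phi> s) / sin (pi * \<phi> s))"
  define c' where "c' = (\<lambda>s. - (pi\<^sup>2 / (sin (pi * \<phi> s))\<^sup>2) * (g s / L))"
  have cd: "(c has_real_derivative c' s) (at s within {0..1})" if "s \<in> {0..1}" for s
  proof -
    let ?S = "sin (pi * \<phi> s)" and ?C = "cos (pi * \<phi> s)"
    have "(c has_real_derivative ((pi * (- ?S * (pi * (g s / L)))) * ?S - pi * ?C * (?C * (pi * (g s / L)))) / (?S * ?S)) (at s within {0..1})"
      unfolding c_def using sin\<phi>(2)[OF that] by (auto intro!: derivative_eq_intros \<phi>d[OF that] simp: mult_ac)
    also have "(pi * (- ?S * (pi * (g s / L)))) * ?S - pi * ?C * (?C * (pi * (g s / L))) = - (pi\<^sup>2 * (g s / L)) * (?S\<^sup>2 + ?C\<^sup>2)"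
    proof -
      have "(pi * (- S * (pi * G))) * S - pi * C * (C * (pi * G)) = - (pi\<^sup>2 * G) * (S\<^sup>2 + C\<^sup>2)" for S C G :: real
        by (simp add: power2_eq_square algebra_simps)
      then show ?thesis .
    qed
    also have "?S\<^sup>2 + ?C\<^sup>2 = 1" by (rule sin_cos_squared_add)
    also have "- (pi\<^sup>2 * (g s / L)) * 1 / (?S * ?S) = c' s"
      by (simp add: c'_def power2_eq_square)
    finally show ?thesis .
  qed
  have c'c: "continuous_on {0..1} c'"
  proof -
    have "continuous_on {0..1} \<phi>"
      using \<phi>d by (meson DERIV_continuous continuous_on_eq_continuous_within)
    then show ?thesis
      unfolding c'_def using sin\<phi>(2) L0 by (intro continuous_intros gc) force+
  qed
  have acc: "abs_continuous_curve_on {0..1} c"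
    by (rule abs_continuous_curve_on_C1[OF _ c'c])
      (use cd in \<open>simp add: has_real_derivative_iff_has_vector_derivative\<close>)
  define F where "F = (\<lambda>s. (y s * y s + z s * z s) * c s + 4 * pi * A s)"
  define F' where "F' = (\<lambda>s. 2 * (y s * u s + z s * v s) * c s + (y s * y s + z s * z s) * c' s + 2 * pi * (z s * u s - y s * v s))"
  have ac4: "abs_continuous_curve_on {0..1} (\<lambda>s. 4 * pi * A s)"
    by (rule abs_continuous_curve_on_compose_Lipschitz[OF ac(3), of "4 * pi"]) (auto simp: dist_real_def abs_mult simp flip: right_diff_distrib)
  have acF: "abs_continuous_curve_on {0..1} F"
    unfolding F_def by (intro abs_continuous_add abs_continuous_mult ac acc ac4)
  have "AE s in lebesgue. s \<in> {0..1} \<longrightarrow> (F has_vector_derivative F' s) (at s within {0..1})"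
    using der
  proof eventually_elim
    case (elim s)
    show ?case
    proof
      assume s: "s \<in> {0..1}"
      note d = elim[rule_format, OF s, folded has_real_derivative_iff_has_vector_derivative]
      have "(F has_real_derivative F' s) (at s within {0..1})"
        unfolding F_def F'_def
        by (rule derivative_eq_intros refl d[THEN conjunct1] d[THEN conjunct2, THEN conjunct1] d[THEN conjunct2, THEN conjunct2] cd[OF s])+
          (simp add: field_simps)
      then show "(F has_vector_derivative F' s) (at s within {0..1})"
        by (simp add: has_real_derivative_iff_has_vector_derivative)
    qed
  qed
  then have F: "(F' has_integral (F 1 - F 0)) {0..1}"
    by (intro abs_continuous_has_integral acF) auto
  have le: "F' s \<le> g s * L + 2 * V * \<bar>b s - g s\<bar>" if s: "s \<in> {0..1}" for s
  proof -
    let ?S = "sin (pi * \<phi> s)" and ?C = "cos (pi * \<phi> s)"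
    note S = sin\<phi>[OF s]
    define w1 where "w1 = c s * y s + pi * z s"
    define w2 where "w2 = c s * z s - pi * y s"
    define w where "w = sqrt (w1\<^sup>2 + w2\<^sup>2)"
    have w0: "w \<ge> 0" by (simp add: w_def)
    have "(c s)\<^sup>2 + pi\<^sup>2 = pi\<^sup>2 / ?S\<^sup>2"
    proof -
      have key: "(pi * C / S)\<^sup>2 + pi\<^sup>2 = pi\<^sup>2 * (S\<^sup>2 + C\<^sup>2) / S\<^sup>2" if "S \<noteq> 0" for S C :: real
        using that by (simp add: power_divide power_mult_distrib field_simps)
      have "(c s)\<^sup>2 + pi\<^sup>2 = pi\<^sup>2 * (?S\<^sup>2 + ?C\<^sup>2) / ?S\<^sup>2"
        unfolding c_def by (rule key) (use S in simp)
      then show ?thesis by simp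
    qed
    moreover have "w\<^sup>2 = ((c s)\<^sup>2 + pi\<^sup>2) * (y s * y s + z s * z s)"
    proof -
      have "w\<^sup>2 = w1\<^sup>2 + w2\<^sup>2" by (simp add: w_def)
      then show ?thesis by (simp add: w1_def w2_def power2_eq_square algebra_simps)
    qed
    ultimately have wsq: "w\<^sup>2 = pi\<^sup>2 / ?S\<^sup>2 * (y s * y s + z s * z s)" by simp
    have wV: "w \<le> V"
    proof -
      have "y s * y s + z s * z s \<le> (Y + Z)\<^sup>2"
      proof -
        have "\<bar>y s\<bar> * \<bar>y s\<bar> \<le> Y * Y" "\<bar>z s\<bar> * \<bar>z s\<bar> \<le> Z * Z"
          by (intro mult_mono Y(2) Z(2) s; use Y Z in simp)+
        moreover have "0 \<le> Y * Z" using Y Z by simp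
        ultimately show ?thesis by (simp add: power2_eq_square algebra_simps)
      qed
      moreover have "pi\<^sup>2 / ?S\<^sup>2 \<le> pi\<^sup>2 / (sin (pi * e))\<^sup>2"
        using S sine by (intro divide_left_mono power_mono mult_pos_pos zero_less_power) auto
      ultimately have "w\<^sup>2 \<le> pi\<^sup>2 / (sin (pi * e))\<^sup>2 * (Y + Z)\<^sup>2"
        unfolding wsq by (intro mult_mono) auto
      also have "\<dots> = V\<^sup>2" by (simp add: V_def power_divide power_mult_distrib)
      finally show ?thesis by (rule power2_le_imp_le) (use V in simp)
    qed
    have cs: "w1 * u s + w2 * v s \<le> w * b s"
    proof -
      have "(w1 * u s + w2 * v s)\<^sup>2 \<le> (w1\<^sup>2 + w2\<^sup>2) * ((u s)\<^sup>2 + (v s)\<^sup>2)"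
        using zero_le_power2[of "w1 * v s - w2 * u s"] by (simp add: power2_eq_square algebra_simps)
      also have "\<dots> = (w * b s)\<^sup>2" by (simp add: w_def b_def power_mult_distrib)
      finally show ?thesis by (rule power2_le_imp_le) (use w0 b0 in simp)
    qed
    \<comment> \<open>The Riccati equation turns the terms quadratic in (y, z) into the square of
      \<open>w\<close>. Cauchy-Schwarz and 2 w - w^2 / L \<le> L then bound F' by g L, up to the
      error of exchanging b for g.\<close>
    have "F' s = 2 * (w1 * u s + w2 * v s) - w\<^sup>2 * (g s / L)"
    proof -
      define K G where "K = pi\<^sup>2 / ?S\<^sup>2" and "G = g s / L"
      have c'K: "c' s = - (K * G)" by (simp add: c'_def K_def G_def)
      have wK: "w\<^sup>2 = K * (y s * y s + z s * z s)" by (simp only: wsq K_def)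
      have alg: "2 * (p * u' + q * v') * k + (p * p + q * q) * (- (K * G)) + 2 * pi * (q * u' - p * v') =
          2 * ((k * p + pi * q) * u' + (k * q - pi * p) * v') - K * (p * p + q * q) * G" for p q u' v' k :: real
        by (simp add: algebra_simps)
      show ?thesis
        unfolding F'_def w1_def w2_def G_def[symmetric] c'K wK by (rule alg)
    qed
    also have "\<dots> \<le> 2 * (w * b s) - w\<^sup>2 * (g s / L)" using cs by simp
    also have "\<dots> = g s * (2 * w - w\<^sup>2 / L) + 2 * w * (b s - g s)" by (simp add: algebra_simps)
    also have "\<dots> \<le> g s * L + 2 * V * \<bar>b s - g s\<bar>"
    proof (rule add_mono)
      have "2 * w * L - w\<^sup>2 \<le> L * L"
        using zero_le_power2[of "w - L"] by (simp add: power2_eq_square algebra_simps)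
      then have "2 * w - w\<^sup>2 / L \<le> L" using L0 by (simp add: field_simps)
      then show "g s * (2 * w - w\<^sup>2 / L) \<le> g s * L" using g(2) by (rule mult_left_mono)
      have "2 * w * (b s - g s) \<le> 2 * w * \<bar>b s - g s\<bar>" using w0 by (intro mult_left_mono) auto
      also have "\<dots> \<le> 2 * V * \<bar>b s - g s\<bar>" using wV by (intro mult_right_mono) auto
      finally show "2 * w * (b s - g s) \<le> 2 * V * \<bar>b s - g s\<bar>" .
    qed
    finally show ?thesis .
  qed
  \<comment> \<open>The cotangent terms drop out because y and z vanish at both ends while
    \<open>c\<close> stays finite there.\<close>
  have "F 1 = 4 * pi * A 1" "F 0 = 0" unfolding F_def ends by simp_all
  then have "4 * pi * A 1 = F 1 - F 0" by simp
  also have "\<dots> \<le> integral {0..1} g * L + 2 * V * integral {0..1} (\<lambda>s. \<bar>b s - g s\<bar>)"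
  proof (rule has_integral_le[OF F])
    show "((\<lambda>s. g s * L + 2 * V * \<bar>b s - g s\<bar>) has_integral integral {0..1} g * L + 2 * V * integral {0..1} (\<lambda>s. \<bar>b s - g s\<bar>)) {0..1}"
      by (intro has_integral_add has_integral_mult_left has_integral_mult_right integrable_integral gi di)
  qed (rule le)
  also have "\<dots> \<le> (l + \<eta>) * L + 2 * V * \<eta>"
    using ig g(3) L0 V by (intro add_mono mult_left_mono mult_right_mono) auto
  also have "\<dots> = L * l + \<eta> * (L + 2 * V)" by (simp add: algebra_simps)
  also have "\<eta> * (L + 2 * V) \<le> \<epsilon>"
  proof -
    have "\<eta> * (L + 2 * V) \<le> \<epsilon> / (L + 2 * V) * (L + 2 * V)"
      using L0 V by (intro mult_right_mono) (auto simp: \<eta>_def)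
    then show ?thesis using L0 V by simp
  qed
  finally show "4 * pi * A 1 \<le> L * integral {0..1} (\<lambda>s. sqrt ((u s)\<^sup>2 + (v s)\<^sup>2)) + \<epsilon>"
    by (simp add: l_def b_def)
qed

text \<open>L decreases to the length. Working with L strictly above it also covers curves of length
  zero, where a division by the length would fail.\<close>

lemma isoperimetric:
  fixes y z A u v :: "real \<Rightarrow> real"
  assumes "abs_continuous_curve_on {0..1} y" "abs_continuous_curve_on {0..1} z" "abs_continuous_curve_on {0..1} A"
    and "AE s in lebesgue. s \<in> {0..1} \<longrightarrow> (y has_vector_derivative u s) (at s within {0..1}) \<and>
      (z has_vector_derivative v s) (at s within {0..1}) \<and>
      (A has_vector_derivative (z s * u s - y s * v s) / 2) (at s within {0..1})"
    and "y 0 = 0" "z 0 = 0" "A 0 = 0" "y 1 = 0" "z 1 = 0"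
    and "(\<lambda>s. sqrt ((u s)\<^sup>2 + (v s)\<^sup>2)) absolutely_integrable_on {0..1}"
  shows "4 * pi * A 1 \<le> (integral {0..1} (\<lambda>s. sqrt ((u s)\<^sup>2 + (v s)\<^sup>2)))\<^sup>2"
proof -
  let ?l = "integral {0..1} (\<lambda>s. sqrt ((u s)\<^sup>2 + (v s)\<^sup>2))"
  have "((\<lambda>L. L * ?l) \<longlongrightarrow> ?l * ?l) (at_right ?l)"
    by (rule tendsto_mult[OF tendsto_ident_at tendsto_const])
  moreover have "\<forall>\<^sub>F L in at_right ?l. 4 * pi * A 1 \<le> L * ?l"
    using eventually_at_right_less[of ?l] by eventually_elim (rule isoperimetric_aux[OF assms])
  ultimately have "4 * pi * A 1 \<le> ?l * ?l"
    by (rule tendsto_lowerbound) simp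
  then show ?thesis by (simp add: power2_eq_square)
qed

section \<open>Horizontal curves, the helix and the distance\<close>

lemma has_vector_derivative_component:
  fixes f :: "real \<Rightarrow> real ^ 'n"
  assumes "(f has_vector_derivative f') F"
  shows "((\<lambda>s. f s $ i) has_vector_derivative f' $ i) F"
  by (rule bounded_linear.has_vector_derivative[OF bounded_linear_vec_nth assms])

text \<open>The first t-coordinate accumulates the signed area of the projection to the (x_2,
  x_3)-plane; it plays the part of \<open>A\<close> in the isoperimetric inequality.\<close>

lemma horizontal_curve_derivatives:
  assumes "(\<gamma> has_vector_derivative horizontal_vector a (\<gamma> s)) F"
  shows "((\<lambda>s. fst (\<gamma> s) $ i) has_vector_derivative a $ i) F"
    and "((\<lambda>s. snd (\<gamma> s) $ 1) has_vector_derivative (fst (\<gamma> s) $ 3 * a $ 2 - fst (\<gamma> s) $ 2 * a $ 3) / 2) F"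
proof -
  obtain x t where xt: "\<gamma> s = (x, t)" by (cases "\<gamma> s")
  have 1: "((\<lambda>s. fst (\<gamma> s)) has_vector_derivative a) F"
    using bounded_linear.has_vector_derivative[OF bounded_linear_fst assms]
    by (simp add: xt horizontal_vector_cross)
  have 2: "((\<lambda>s. snd (\<gamma> s)) has_vector_derivative - ((1/2) *\<^sub>R (x \<times> a))) F"
    using bounded_linear.has_vector_derivative[OF bounded_linear_snd assms]
    by (simp add: xt horizontal_vector_cross)
  show "((\<lambda>s. fst (\<gamma> s) $ i) has_vector_derivative a $ i) F"
    by (rule has_vector_derivative_component[OF 1])
  show "((\<lambda>s. snd (\<gamma> s) $ 1) has_vector_derivative (fst (\<gamma> s) $ 3 * a $ 2 - fst (\<gamma> s) $ 2 * a $ 3) / 2) F"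
    using has_vector_derivative_component[OF 2, of 1] by (simp add: xt cross3_simps diff_divide_distrib)
qed

text \<open>The projection is a closed curve of length l with l^2 \<ge> 4 pi t_1. The axial
  displacement enters through Minkowski's inequality in dual form: pairing (a_1, |(a_2, a_3)|) with
  the constant vector (x_1, l) gives D^2 = x_1^2 + l^2 \<le> D times the length.\<close>

lemma horizontal_length_lower_bound:
  assumes hc: "horizontal_curve \<gamma> a" and ends: "\<gamma> 0 = 0" "\<gamma> 1 = (x, t)"
    and x: "x $ 2 = 0" "x $ 3 = 0" and t: "t $ 1 \<ge> 0"
  shows "sqrt ((x $ 1)\<^sup>2 + 4 * pi * t $ 1) \<le> integral {0..1} (\<lambda>s. norm (a s))"
proof -
  have ac: "abs_continuous_curve_on {0..1} \<gamma>" and ai: "a absolutely_integrable_on {0..1}"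
    and der: "AE s in lebesgue. s \<in> {0..1} \<longrightarrow> (\<gamma> has_vector_derivative horizontal_vector (a s) (\<gamma> s)) (at s within {0..1})"
    using hc by (auto simp: horizontal_curve_def)
  have acf: "abs_continuous_curve_on {0..1} (\<lambda>s. fst (\<gamma> s) $ i)" for i
    by (rule abs_continuous_curve_on_compose_Lipschitz[OF ac, of 1])
      (auto intro: order.trans[OF dist_vec_nth_le dist_fst_le])
  have acs: "abs_continuous_curve_on {0..1} (\<lambda>s. snd (\<gamma> s) $ i)" for i
    by (rule abs_continuous_curve_on_compose_Lipschitz[OF ac, of 1])
      (auto intro: order.trans[OF dist_vec_nth_le dist_snd_le])
  have ani: "(\<lambda>s. norm (a s)) absolutely_integrable_on {0..1}"
    using absolutely_integrable_norm[OF ai] by (simp add: o_def)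
  define b where "b = (\<lambda>s. sqrt ((a s $ 2)\<^sup>2 + (a s $ 3)\<^sup>2))"
  have bi: "b absolutely_integrable_on {0..1}"
  proof -
    have "(\<lambda>s. (a s $ 2, a s $ 3)) absolutely_integrable_on {0..1}"
      using absolutely_integrable_linear[OF ai, of "\<lambda>v. (v $ 2, v $ 3)"]
      by (simp add: o_def bounded_linear_Pair bounded_linear_vec_nth)
    from absolutely_integrable_norm[OF this] show ?thesis
      by (simp add: o_def b_def norm_Pair)
  qed
  define l where "l = integral {0..1} b"
  have iso: "4 * pi * t $ 1 \<le> l\<^sup>2"
  proof -
    have "4 * pi * snd (\<gamma> 1) $ 1 \<le> (integral {0..1} (\<lambda>s. sqrt ((a s $ 2)\<^sup>2 + (a s $ 3)\<^sup>2)))\<^sup>2"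
    proof (rule isoperimetric[OF acf acf acs])
      show "AE s in lebesgue. s \<in> {0..1} \<longrightarrow>
        ((\<lambda>s. fst (\<gamma> s) $ 2) has_vector_derivative a s $ 2) (at s within {0..1}) \<and>
        ((\<lambda>s. fst (\<gamma> s) $ 3) has_vector_derivative a s $ 3) (at s within {0..1}) \<and>
        ((\<lambda>s. snd (\<gamma> s) $ 1) has_vector_derivative (fst (\<gamma> s) $ 3 * a s $ 2 - fst (\<gamma> s) $ 2 * a s $ 3) / 2) (at s within {0..1})"
        using der by eventually_elim (auto intro: horizontal_curve_derivatives)
      show "(\<lambda>s. sqrt ((a s $ 2)\<^sup>2 + (a s $ 3)\<^sup>2)) absolutely_integrable_on {0..1}" using bi by (simp add: b_def)
    qed (use ends x in auto)
    then show ?thesis by (simp add: ends l_def b_def)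
  qed
  have x1: "((\<lambda>s. a s $ 1) has_integral (fst (\<gamma> 1) $ 1 - fst (\<gamma> 0) $ 1)) {0..1}"
    by (rule abs_continuous_has_integral[OF _ acf])
      (use der in \<open>auto elim!: eventually_mono intro: horizontal_curve_derivatives\<close>)
  define D where "D = sqrt ((x $ 1)\<^sup>2 + l\<^sup>2)"
  have int1: "(\<lambda>s. norm (a s)) integrable_on {0..1}" "b integrable_on {0..1}"
    using ani bi by (auto intro: set_lebesgue_integral_eq_integral)
  have "((\<lambda>s. x $ 1 * a s $ 1 + l * b s) has_integral (x $ 1 * (fst (\<gamma> 1) $ 1 - fst (\<gamma> 0) $ 1) + l * l)) {0..1}"
    unfolding l_def by (intro has_integral_add has_integral_mult_right x1 integrable_integral int1)
  moreover have "((\<lambda>s. D * norm (a s)) has_integral (D * integral {0..1} (\<lambda>s. norm (a s)))) {0..1}"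
    by (intro has_integral_mult_right integrable_integral int1)
  moreover have "x $ 1 * a s $ 1 + l * b s \<le> D * norm (a s)" for s
  proof (rule power2_le_imp_le)
    have "(x $ 1 * a s $ 1 + l * b s)\<^sup>2 \<le> ((x $ 1)\<^sup>2 + l\<^sup>2) * ((a s $ 1)\<^sup>2 + (b s)\<^sup>2)"
      using zero_le_power2[of "x $ 1 * b s - l * a s $ 1"] by (simp add: power2_eq_square algebra_simps)
    also have "(b s)\<^sup>2 = (a s $ 2)\<^sup>2 + (a s $ 3)\<^sup>2" by (simp add: b_def)
    also have "(a s $ 1)\<^sup>2 + \<dots> = (norm (a s))\<^sup>2"
      unfolding norm_vec_def L2_set_def by (simp add: sum_3 add_nonneg_nonneg)
    also have "(x $ 1)\<^sup>2 + l\<^sup>2 = D\<^sup>2" by (simp add: D_def)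
    finally show "(x $ 1 * a s $ 1 + l * b s)\<^sup>2 \<le> (D * norm (a s))\<^sup>2" by (simp add: power_mult_distrib)
  qed (simp add: D_def)
  ultimately have "x $ 1 * (fst (\<gamma> 1) $ 1 - fst (\<gamma> 0) $ 1) + l * l \<le> D * integral {0..1} (\<lambda>s. norm (a s))"
    by (rule has_integral_le)
  then have "D * D \<le> D * integral {0..1} (\<lambda>s. norm (a s))"
    by (simp add: ends D_def power2_eq_square)
  moreover have "0 \<le> integral {0..1} (\<lambda>s. norm (a s))" by (intro integral_nonneg int1) auto
  moreover have "D \<ge> 0" by (simp add: D_def)
  ultimately have "D \<le> integral {0..1} (\<lambda>s. norm (a s))"
    by (cases "D = 0") (auto simp: mult_le_cancel_left)
  moreover have "sqrt ((x $ 1)\<^sup>2 + 4 * pi * t $ 1) \<le> D"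
    unfolding D_def using iso by (intro real_sqrt_le_mono) auto
  ultimately show ?thesis by linarith
qed

text \<open>A circle of radius \<rho> through the origin in the (x_2, x_3)-plane, run once at
  constant speed together with constant axial speed; the t-coordinates are integrated from the
  horizontality condition. The enclosed area is pi \<rho>^2, and the starting angle is chosen so
  that the third t-coordinate returns to 0.\<close>

lemma horizontal_helix:
  fixes R \<rho> :: real
  defines "\<theta> \<equiv> \<lambda>s::real. 2 * pi * s"
  defines "\<gamma> \<equiv> \<lambda>s. (vector [R * s, \<rho> * sin (\<theta> s), \<rho> * cos (\<theta> s) - \<rho>] :: real^3,
      vector [\<rho>\<^sup>2 / 2 * (\<theta> s - sin (\<theta> s)), R * \<rho> / 2 * (s + s * cos (\<theta> s) - sin (\<theta> s) / pi),
        - (R * \<rho> / 2) * (s * sin (\<theta> s) + (cos (\<theta> s) - 1) / pi)] :: real^3)"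
  defines "a \<equiv> \<lambda>s. vector [R, 2 * pi * \<rho> * cos (\<theta> s), - (2 * pi * \<rho> * sin (\<theta> s))] :: real^3"
  shows "horizontal_curve \<gamma> a" "\<gamma> 0 = 0" "\<gamma> 1 = (R *\<^sub>R axis 1 1, vector [pi * \<rho>\<^sup>2, R * \<rho>, 0])"
    and "integral {0..1} (\<lambda>s. norm (a s)) = sqrt (R\<^sup>2 + 4 * pi\<^sup>2 * \<rho>\<^sup>2)"
proof -
  have vec: "(vector [p, q, r] :: real^3) = p *\<^sub>R axis 1 1 + q *\<^sub>R axis 2 1 + r *\<^sub>R axis 3 1" for p q r
    by (simp add: vec_eq_iff forall_3 axis_def)
  have d_vec: "((\<lambda>s. vector [p s, q s, r s] :: real^3) has_vector_derivative vector [p', q', r']) (at s within A)"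
    if "(p has_real_derivative p') (at s within A)" "(q has_real_derivative q') (at s within A)" "(r has_real_derivative r') (at s within A)"
    for p q r p' q' r' s A
    unfolding vec using that
    by (auto intro!: derivative_eq_intros simp: has_real_derivative_iff_has_vector_derivative)
  have \<theta>: "(\<theta> has_real_derivative 2 * pi) (at s within A)" for s A
    unfolding \<theta>_def by (auto intro!: derivative_eq_intros)
  have der: "(\<gamma> has_vector_derivative horizontal_vector (a s) (\<gamma> s)) (at s within A)" for s A
  proof -
    have "(\<gamma> has_vector_derivative
      (vector [R, 2 * pi * \<rho> * cos (\<theta> s), - (2 * pi * \<rho> * sin (\<theta> s))],
       vector [pi * \<rho>\<^sup>2 * (1 - cos (\<theta> s)), R * \<rho> / 2 * (1 - cos (\<theta> s) - 2 * pi * s * sin (\<theta> s)),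
        - (R * \<rho> / 2) * (2 * pi * s * cos (\<theta> s) - sin (\<theta> s))])) (at s within A)"
      unfolding \<gamma>_def
      by (intro has_vector_derivative_Pair d_vec)
        (auto intro!: derivative_eq_intros \<theta> simp: field_simps power2_eq_square)
    also have "(vector [R, 2 * pi * \<rho> * cos (\<theta> s), - (2 * pi * \<rho> * sin (\<theta> s))],
       vector [pi * \<rho>\<^sup>2 * (1 - cos (\<theta> s)), R * \<rho> / 2 * (1 - cos (\<theta> s) - 2 * pi * s * sin (\<theta> s)),
        - (R * \<rho> / 2) * (2 * pi * s * cos (\<theta> s) - sin (\<theta> s))]) = horizontal_vector (a s) (\<gamma> s)"
    proof -
      have sc: "(sin (\<theta> s))\<^sup>2 + (cos (\<theta> s))\<^sup>2 = 1" by (rule sin_cos_squared_add)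
      have "pi * \<rho>\<^sup>2 * (1 - cos (\<theta> s)) = - ((\<rho> * sin (\<theta> s)) * (- (2 * pi * \<rho> * sin (\<theta> s))) - (\<rho> * cos (\<theta> s) - \<rho>) * (2 * pi * \<rho> * cos (\<theta> s))) / 2"
      proof -
        have "- ((\<rho> * S) * (- (2 * pi * \<rho> * S)) - (\<rho> * C - \<rho>) * (2 * pi * \<rho> * C)) / 2 = pi * \<rho>\<^sup>2 * ((S\<^sup>2 + C\<^sup>2) - C)" for S C
          by (simp add: power2_eq_square field_simps)
        then show ?thesis unfolding sc by simp
      qed
      then show ?thesis
        unfolding \<gamma>_def a_def horizontal_vector_cross
        by (simp add: vec_eq_iff forall_3 cross3_def field_simps)
    qed
    finally show ?thesis .
  qed
  have cont_a: "continuous_on A a" for A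
    unfolding a_def vec \<theta>_def by (intro continuous_intros)
  have ac: "abs_continuous_curve_on {0..1} \<gamma>"
  proof (rule abs_continuous_curve_on_C1[OF der])
    have "continuous_on {0..1} \<gamma>"
      by (rule continuous_on_vector_derivative[OF der])
    then show "continuous_on {0..1} (\<lambda>s. horizontal_vector (a s) (\<gamma> s))"
      using cont_a[of "{0..1}"] unfolding horizontal_vector_def
      by (auto simp: \<gamma>_def a_def vec \<theta>_def intro!: continuous_intros)
  qed
  have "a absolutely_integrable_on {0..1}"
    by (rule absolutely_integrable_continuous_real[OF cont_a])
  then show "horizontal_curve \<gamma> a"
    unfolding horizontal_curve_def using ac der by auto
  show "\<gamma> 0 = 0" by (simp add: \<gamma>_def \<theta>_def zero_prod_def vec_eq_iff forall_3)
  show "\<gamma> 1 = (R *\<^sub>R axis 1 1, vector [pi * \<rho>\<^sup>2, R * \<rho>, 0])"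
    by (simp add: \<gamma>_def \<theta>_def vec_eq_iff forall_3 axis_def)
  have "norm (a s) = sqrt (R\<^sup>2 + 4 * pi\<^sup>2 * \<rho>\<^sup>2)" for s
  proof -
    have "norm (a s) = sqrt (R\<^sup>2 + ((2 * pi * \<rho> * cos (\<theta> s))\<^sup>2 + (2 * pi * \<rho> * sin (\<theta> s))\<^sup>2))"
      unfolding norm_vec_def L2_set_def a_def by (simp add: sum_3 add.assoc)
    also have "(2 * pi * \<rho> * cos (\<theta> s))\<^sup>2 + (2 * pi * \<rho> * sin (\<theta> s))\<^sup>2 = 4 * pi\<^sup>2 * \<rho>\<^sup>2 * ((sin (\<theta> s))\<^sup>2 + (cos (\<theta> s))\<^sup>2)"
      by (simp only: power_mult_distrib distrib_left) simp
    finally show ?thesis by simp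
  qed
  then show "integral {0..1} (\<lambda>s. norm (a s)) = sqrt (R\<^sup>2 + 4 * pi\<^sup>2 * \<rho>\<^sup>2)"
    by simp
qed

text \<open>The relation between t_1 and t_2 says that the helix whose radius is fixed by t_2 = R
  \<rho> encloses exactly the area t_1, so the isoperimetric bound is attained.\<close>

lemma cc_dist_eq:
  assumes x: "x = norm x *\<^sub>R axis 1 1" "x \<noteq> 0" and t: "t $ 3 = 0" "t $ 1 > 0"
    and rel: "pi * (t $ 2)\<^sup>2 = (norm x)\<^sup>2 * t $ 1"
  shows "cc_dist (x, t) = sqrt ((norm x)\<^sup>2 + 4 * pi * t $ 1)"
  unfolding cc_dist_def
proof (rule cInf_eq_minimum)
  define R where "R = norm x"
  define \<rho> where "\<rho> = t $ 2 / R"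
  have R: "R > 0" using x by (simp add: R_def)
  have t1: "pi * \<rho>\<^sup>2 = t $ 1" using rel R by (simp add: \<rho>_def R_def power_divide field_simps)
  have end_pt: "(R *\<^sub>R axis 1 1, vector [pi * \<rho>\<^sup>2, R * \<rho>, 0]) = (x, t)"
    using R t x(1) t1 by (auto simp: R_def[symmetric] \<rho>_def vec_eq_iff forall_3)
  have len: "R\<^sup>2 + 4 * pi\<^sup>2 * \<rho>\<^sup>2 = (norm x)\<^sup>2 + 4 * pi * t $ 1"
    unfolding t1[symmetric] R_def by (simp add: power2_eq_square)
  note helix = horizontal_helix[of R \<rho>, unfolded end_pt len]
  show "sqrt ((norm x)\<^sup>2 + 4 * pi * t $ 1) \<in> {integral {0..1} (\<lambda>s. norm (a s)) | \<gamma> a.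
     horizontal_curve \<gamma> a \<and> \<gamma> 0 = 0 \<and> \<gamma> 1 = (x, t)}"
    by (intro CollectI exI conjI) (rule helix(4)[symmetric] helix(1-3))+
next
  fix d assume "d \<in> {integral {0..1} (\<lambda>s. norm (a s)) | \<gamma> a. horizontal_curve \<gamma> a \<and> \<gamma> 0 = 0 \<and> \<gamma> 1 = (x, t)}"
  then obtain \<gamma> a where d: "d = integral {0..1} (\<lambda>s. norm (a s))" "horizontal_curve \<gamma> a" "\<gamma> 0 = 0" "\<gamma> 1 = (x, t)"
    by auto
  have "x $ 1 = norm x" "x $ 2 = 0" "x $ 3 = 0"
    by (subst x(1), simp add: axis_def)+
  then show "sqrt ((norm x)\<^sup>2 + 4 * pi * t $ 1) \<le> d"
    using horizontal_length_lower_bound[OF d(2-4)] t unfolding d(1) by simp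
qed

section \<open>The leading constant and the asymptotics\<close>

lemma leading_constant_eq:
  fixes R \<beta> :: real
  assumes R: "R > 0" and \<beta>: "\<beta> > 0"
  shows "4 * pi ^ 3 / R\<^sup>2 * sqrt (4 * pi / (R\<^sup>2 * \<beta>\<^sup>2 * (4 + \<beta>\<^sup>2) / (2 * pi\<^sup>2))) =
    2 * sqrt (2 * pi) * pi ^ 3 * inverse (R\<^sup>2 * \<beta> / (2 * pi)) * R *
      (R ^ 4 + pi\<^sup>2 * (R\<^sup>2 * \<beta> / (2 * pi))\<^sup>2) powr (-1/2)"
proof -
  \<comment> \<open>It clears both roots: R^4 + pi^2 t_2^2 = (R^2 S / 2)^2, and the Gaussian
    constant is 2 pi times a square.\<close>
  define S where "S = sqrt (4 + \<beta>\<^sup>2)"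
  have S: "S > 0" "S\<^sup>2 = 4 + \<beta>\<^sup>2" by (simp_all add: S_def add_pos_nonneg)
  have "R ^ 4 + pi\<^sup>2 * (R\<^sup>2 * \<beta> / (2 * pi))\<^sup>2 = (R\<^sup>2 * S / 2)\<^sup>2"
    using S(2) by (simp add: power_divide power_mult_distrib field_simps flip: power_mult)
  also have "\<dots> powr (-1/2) = inverse (R\<^sup>2 * S / 2)"
    using R S(1) by (simp add: powr_minus powr_half_sqrt)
  finally have 1: "(R ^ 4 + pi\<^sup>2 * (R\<^sup>2 * \<beta> / (2 * pi))\<^sup>2) powr (-1/2) = inverse (R\<^sup>2 * S / 2)" .
  have "4 * pi / (R\<^sup>2 * \<beta>\<^sup>2 * (4 + \<beta>\<^sup>2) / (2 * pi\<^sup>2)) = (2 * pi) * (2 * pi / (R * \<beta> * S))\<^sup>2"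
    using R \<beta> S unfolding S(2)[symmetric] by (simp add: power_divide power_mult_distrib field_simps)
  then have 2: "sqrt (4 * pi / (R\<^sup>2 * \<beta>\<^sup>2 * (4 + \<beta>\<^sup>2) / (2 * pi\<^sup>2))) = sqrt (2 * pi) * (2 * pi / (R * \<beta> * S))"
    using R \<beta> S(1) by (simp only: real_sqrt_mult real_sqrt_abs) simp
  show ?thesis
    unfolding 1 2 using R \<beta> S(1) by (simp add: field_simps power2_eq_square)
qed

theorem corollary11p9:
  fixes C :: real and x t :: "real^3"
  assumes "C > 0"
    and "x = norm x *\<^sub>R axis 1 1" and "x \<noteq> 0"
    and "t $ 3 = 0" and "t $ 1 > 0" and "t $ 2 > 0"
    and "pi * (t $ 2)\<^sup>2 = (norm x)\<^sup>2 * t $ 1"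
  shows "\<exists>\<omega> :: real \<Rightarrow> real. (\<omega> \<longlongrightarrow> 0) (at_right 0) \<and>
    (\<forall>h>0. heat_kernel C h x t = complex_of_real
       (C * 2 * sqrt (2 * pi) * pi ^ 3 * h powr (-3) * inverse (t $ 2) * norm x *
        ((norm x) ^ 4 + pi\<^sup>2 * (t $ 2)\<^sup>2) powr (-1/2) *
        exp (- ((cc_dist (x, t))\<^sup>2 / (4 * h))) * (1 + \<omega> h)))"
proof -
  define R where "R = norm x"
  \<comment> \<open>Geometrically, \<beta> R is the circumference 2 pi \<rho> of the projected
    circle of the extremal helix, which explains the squared distance R^2 (1 + \<beta>^2).\<close>
  define \<beta> where "\<beta> = 2 * pi * t $ 2 / R\<^sup>2"
  have R: "R > 0" and \<beta>: "\<beta> > 0" using assms by (auto simp: R_def \<beta>_def)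
  have t2: "t $ 2 = R\<^sup>2 * \<beta> / (2 * pi)" using R by (simp add: \<beta>_def)
  have "R\<^sup>2 * t $ 1 = R\<^sup>2 * (R\<^sup>2 * \<beta>\<^sup>2 / (4 * pi))"
    using assms(7) unfolding t2 R_def[symmetric] by (auto simp: power2_eq_square field_simps)
  then have t1: "t $ 1 = R\<^sup>2 * \<beta>\<^sup>2 / (4 * pi)"
    using R by (simp only: mult_left_cancel power_not_zero less_imp_neq[symmetric] not_False_eq_True)
  have "(cc_dist (x, t))\<^sup>2 = R\<^sup>2 + 4 * pi * t $ 1"
    unfolding cc_dist_eq[OF assms(2-5,7)] R_def using assms(5) by simp
  then have dist: "(cc_dist (x, t))\<^sup>2 = R\<^sup>2 * (1 + \<beta>\<^sup>2)" by (simp add: t1 distrib_left)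
  define K where "K = 2 * sqrt (2 * pi) * pi ^ 3 * inverse (t $ 2) * R * (R ^ 4 + pi\<^sup>2 * (t $ 2)\<^sup>2) powr (-1/2)"
  define J where "J = (\<lambda>q. LINT p|lborel. hk_scaled R \<beta> q p)"
  define E where "E = (\<lambda>h. C * h powr (-3) * exp (- ((cc_dist (x, t))\<^sup>2 / (4 * h))))"
  \<comment> \<open>Solving for the error makes the formula hold for every h > 0; the contour
    argument, valid for small h, enters through the limit alone.\<close>
  define \<omega> where "\<omega> = (\<lambda>h. Re (heat_kernel C h x t) / (K * E h) - 1)"
  have "R ^ 4 + pi\<^sup>2 * (t $ 2)\<^sup>2 > 0" using R by (simp add: add_pos_nonneg)
  then have K: "K > 0" using R assms(6) by (simp add: K_def)
  have J: "(J \<longlongrightarrow> complex_of_real K) (at_right 0)"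
    using hk_scaled_integral_tendsto[OF R \<beta>]
    unfolding leading_constant_eq[OF R \<beta>] t2[symmetric] K_def[symmetric] J_def .
  have kernel: "heat_kernel C h x t = complex_of_real (E h) * J (h powr (1/4))"
    if h: "h > 0" "h powr (1/4) \<le> 1" "(1 + \<beta>\<^sup>2) * (h powr (1/4))\<^sup>2 \<le> pi" for h
  proof -
    define q where "q = h powr (1/4)"
    have q: "q > 0" using h by (simp add: q_def)
    have q4: "q ^ 4 = h" and q6: "q ^ 6 = h powr (3/2)"
      using h by (simp_all add: q_def powr_powr flip: powr_realpow)
    have "heat_profile ((1 / sqrt h) *\<^sub>R x) ((1 / h) *\<^sub>R t) =
        complex_of_real (h powr (3/2) * exp (- (R\<^sup>2 * (1 + \<beta>\<^sup>2) / (4 * h)))) * J q"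
      unfolding heat_profile_eq_hk_integral[OF assms(2,4) h(1)] J_def t1 t2 R_def[symmetric]
      using hk_integral_eq_scaled[OF q h(2,3)[folded q_def] \<beta>, of R] unfolding q4 q6 .
    moreover have "h powr (-9/2) * h powr (3/2) = h powr (-3)"
      by (simp flip: powr_add)
    ultimately show ?thesis
      by (simp add: heat_kernel_def E_def dist q_def[symmetric] mult.assoc[symmetric] flip: of_real_mult)
  qed
  have lim0: "((\<lambda>h::real. h powr (1/4)) \<longlongrightarrow> 0) (at_right 0)"
    by real_asymp
  have q_lim: "filterlim (\<lambda>h::real. h powr (1/4)) (at_right 0) (at_right 0)"
    by real_asymp
  have E: "E h > 0" if "h > 0" for h using that assms(1) by (simp add: E_def)
  show ?thesis
  proof (intro exI conjI allI impI)
    have "\<forall>\<^sub>F h in at_right 0. h powr (1/4) < (1::real)"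
      using order_tendstoD(2)[OF lim0] by simp
    moreover have "((\<lambda>h. (1 + \<beta>\<^sup>2) * (h powr (1/4))\<^sup>2) \<longlongrightarrow> (1 + \<beta>\<^sup>2) * 0\<^sup>2) (at_right 0)"
      by (intro tendsto_intros lim0)
    then have "\<forall>\<^sub>F h in at_right 0. (1 + \<beta>\<^sup>2) * (h powr (1/4))\<^sup>2 < pi"
      by (rule order_tendstoD(2)) simp
    moreover have "\<forall>\<^sub>F h in at_right 0. (h::real) > 0"
      by (simp add: eventually_at_right_less)
    ultimately have "\<forall>\<^sub>F h in at_right 0. Re (J (h powr (1/4))) / K - 1 = \<omega> h"
      by eventually_elim (use E in \<open>simp add: \<omega>_def kernel less_imp_le less_imp_neq[symmetric]\<close>)
    moreover have "((\<lambda>h. Re (J (h powr (1/4))) / K - 1) \<longlongrightarrow> Re (complex_of_real K) / K - 1) (at_right 0)"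
      by (intro tendsto_diff tendsto_divide tendsto_Re filterlim_compose[OF J q_lim] tendsto_const) (use K in simp)
    ultimately show "(\<omega> \<longlongrightarrow> 0) (at_right 0)"
      using K by (simp add: tendsto_cong)
  next
    fix h :: real assume h: "h > 0"
    have "heat_kernel C h x t = complex_of_real (Re (heat_kernel C h x t))"
      by (simp add: complex_eq_iff heat_kernel_def Im_heat_profile)
    also have "Re (heat_kernel C h x t) = K * E h * (1 + \<omega> h)"
      using K E[OF h] by (simp add: \<omega>_def)
    also have "K * E h * (1 + \<omega> h) = C * 2 * sqrt (2 * pi) * pi ^ 3 * h powr (-3) * inverse (t $ 2) * norm x *
        ((norm x) ^ 4 + pi\<^sup>2 * (t $ 2)\<^sup>2) powr (-1/2) *
        exp (- ((cc_dist (x, t))\<^sup>2 / (4 * h))) * (1 + \<omega> h)"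
      by (simp add: K_def E_def R_def mult_ac)
    finally show "heat_kernel C h x t = complex_of_real (C * 2 * sqrt (2 * pi) * pi ^ 3 * h powr (-3) * inverse (t $ 2) * norm x *
        ((norm x) ^ 4 + pi\<^sup>2 * (t $ 2)\<^sup>2) powr (-1/2) *
        exp (- ((cc_dist (x, t))\<^sup>2 / (4 * h))) * (1 + \<omega> h))" .
  qed
qed

end
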